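(* Let $\Omega \subset \mathbb{R}^3$ be a bounded, convex Lipschitz domain with boundary $\Gamma=\partial\Omega$, and let $\overline{u} \in H^1_0(\Omega) \cap H^2(\Omega)$. For a regularization parameter $\varrho>0$ and a mesh-size parameter $h>0$, let $u_{\varrho h} \in V_h$ be the unique function satisfying \[ \varrho\int_\Omega \nabla u_{\varrho h}(x)\cdot\nabla v_h(x)\, dx + \int_\Omega u_{\varrho h}(x)\, v_h(x)\, dx = \int_\Omega \overline{u}(x)\, v_h(x)\, dx \quad \text{for all } v_h\in V_h, \] where $V_h$ is the finite element space described in the context. Then there are positive constants $C_0, C_1, C_2, C_3$, independent of $h$, $\varrho$ and $\overline{u}$, such that \[ \| u_{\varrho h} - \overline{u} \|_{L^2(\Omega)}^2 \leq \big( C_0 h^4 + C_1 \varrho h^2 + C_2 \varrho^2 \big)\, \| \overline{u} \|_{H^2(\Omega)}^2 \] and \[ \| \nabla (u_{\varrho h} - \overline{u}) \|_{L^2(\Omega)}^2 \leq \big( C_0 h^4 \varrho^{-1} + C_1 h^2 + C_3 \varrho \big)\, \| \overline{u} \|_{H^2(\Omega)}^2 . \] In particular, for the choice $\varrho = h^2$ there are constants $c,\tilde c>0$, independent of $h$ and $\overline{u}$, such that \[ \| u_{\varrho h} - \overline{u} \|_{L^2(\Omega)} \leq c\, h^2\, \| \overline{u} \|_{H^2(\Omega)} \quad\text{and}\quad \| \nabla (u_{\varrho h} - \overline{u}) \|_{L^2(\Omega)} \leq \tilde{c}\, h\, \| \overline{u} \|_{H^2(\Omega)}. \]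
   Context: $\mathcal{T}_h(\Omega)$ denotes a family of admissible (conforming) decompositions of $\Omega$ into shape-regular simplicial (tetrahedral) finite elements $\tau_\ell$ with $\overline{\Omega} = \bigcup_\ell \overline{\tau}_\ell$, where $h$ is the mesh-size parameter of the decomposition (the family being uniformly shape regular). $V_h = S_h^1(\Omega_h)\cap H^1_0(\Omega)$ is the space of continuous functions on $\overline\Omega$ that are affine on each element $\tau_\ell$ and vanish on $\Gamma$. The function $u_{\varrho h}$ is the Galerkin finite element approximation of the solution $u_\varrho\in H^1_0(\Omega)$ of the singularly perturbed reaction–diffusion problem $-\varrho\Delta u_\varrho + u_\varrho = \overline{u}$ in $\Omega$, $u_\varrho = 0$ on $\Gamma$, which is the reduced optimality system of minimizing $\frac12\|u_\varrho-\overline{u}\|_{L^2(\Omega)}^2+\frac{\varrho}{2}\|z_\varrho\|_{H^{-1}(\Omega)}^2$ subject to $-\Delta u_\varrho = z_\varrho$, $u_\varrho\in H^1_0(\Omega)$. *)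

theory Defs
  imports "HOL-Analysis.Analysis"
begin

type_synonym R3 = "real^3"

definition pd :: "3 \<Rightarrow> (R3 \<Rightarrow> real) \<Rightarrow> (R3 \<Rightarrow> real)" where
  "pd i f = (\<lambda>x. frechet_derivative f (at x) (axis i 1))"

fun iter_pd :: "3 list \<Rightarrow> (R3 \<Rightarrow> real) \<Rightarrow> (R3 \<Rightarrow> real)" where
  "iter_pd [] f = f"
| "iter_pd (i # is) f = pd i (iter_pd is f)"

definition smooth_fun :: "(R3 \<Rightarrow> real) \<Rightarrow> bool" where
  "smooth_fun f \<longleftrightarrow> (\<forall>is x. iter_pd is f differentiable (at x))"

definition test_fun :: "R3 set \<Rightarrow> (R3 \<Rightarrow> real) \<Rightarrow> bool" where
  "test_fun \<Omega> \<phi> \<longleftrightarrow> smooth_fun \<phi> \<and> compact (closure {x. \<phi> x \<noteq> 0})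
      \<and> closure {x. \<phi> x \<noteq> 0} \<subseteq> \<Omega>"

definition L2 :: "R3 set \<Rightarrow> (R3 \<Rightarrow> real) \<Rightarrow> bool" where
  "L2 \<Omega> f \<longleftrightarrow> f \<in> borel_measurable (lebesgue_on \<Omega>)
      \<and> integrable (lebesgue_on \<Omega>) (\<lambda>x. (f x)\<^sup>2)"

definition L2_norm :: "R3 set \<Rightarrow> (R3 \<Rightarrow> real) \<Rightarrow> real" where
  "L2_norm \<Omega> f = sqrt (integral\<^sup>L (lebesgue_on \<Omega>) (\<lambda>x. (f x)\<^sup>2))"

definition weak_deriv1 :: "R3 set \<Rightarrow> (R3 \<Rightarrow> real) \<Rightarrow> 3 \<Rightarrow> (R3 \<Rightarrow> real) \<Rightarrow> bool" where
  "weak_deriv1 \<Omega> f i g \<longleftrightarrow> (\<forall>\<phi>. test_fun \<Omega> \<phi> \<longrightarrow>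
      integral\<^sup>L (lebesgue_on \<Omega>) (\<lambda>x. f x * pd i \<phi> x)
      = - integral\<^sup>L (lebesgue_on \<Omega>) (\<lambda>x. g x * \<phi> x))"

definition weak_deriv2 :: "R3 set \<Rightarrow> (R3 \<Rightarrow> real) \<Rightarrow> 3 \<Rightarrow> 3 \<Rightarrow> (R3 \<Rightarrow> real) \<Rightarrow> bool" where
  "weak_deriv2 \<Omega> f i j g \<longleftrightarrow> (\<forall>\<phi>. test_fun \<Omega> \<phi> \<longrightarrow>
      integral\<^sup>L (lebesgue_on \<Omega>) (\<lambda>x. f x * pd i (pd j \<phi>) x)
      = integral\<^sup>L (lebesgue_on \<Omega>) (\<lambda>x. g x * \<phi> x))"

definition wd1 :: "R3 set \<Rightarrow> (R3 \<Rightarrow> real) \<Rightarrow> 3 \<Rightarrow> (R3 \<Rightarrow> real)" where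
  "wd1 \<Omega> f i = (SOME g. L2 \<Omega> g \<and> weak_deriv1 \<Omega> f i g)"

definition wd2 :: "R3 set \<Rightarrow> (R3 \<Rightarrow> real) \<Rightarrow> 3 \<Rightarrow> 3 \<Rightarrow> (R3 \<Rightarrow> real)" where
  "wd2 \<Omega> f i j = (SOME g. L2 \<Omega> g \<and> weak_deriv2 \<Omega> f i j g)"

definition H1 :: "R3 set \<Rightarrow> (R3 \<Rightarrow> real) \<Rightarrow> bool" where
  "H1 \<Omega> f \<longleftrightarrow> L2 \<Omega> f \<and> (\<forall>i. \<exists>g. L2 \<Omega> g \<and> weak_deriv1 \<Omega> f i g)"

definition H2 :: "R3 set \<Rightarrow> (R3 \<Rightarrow> real) \<Rightarrow> bool" where
  "H2 \<Omega> f \<longleftrightarrow> H1 \<Omega> f \<and> (\<forall>i j. \<exists>g. L2 \<Omega> g \<and> weak_deriv2 \<Omega> f i j g)"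

definition grad_norm_sq :: "R3 set \<Rightarrow> (R3 \<Rightarrow> real) \<Rightarrow> real" where
  "grad_norm_sq \<Omega> f = (\<Sum>i\<in>UNIV. (L2_norm \<Omega> (wd1 \<Omega> f i))\<^sup>2)"

definition H1_norm :: "R3 set \<Rightarrow> (R3 \<Rightarrow> real) \<Rightarrow> real" where
  "H1_norm \<Omega> f = sqrt ((L2_norm \<Omega> f)\<^sup>2 + grad_norm_sq \<Omega> f)"

definition H2_norm :: "R3 set \<Rightarrow> (R3 \<Rightarrow> real) \<Rightarrow> real" where
  "H2_norm \<Omega> f = sqrt ((L2_norm \<Omega> f)\<^sup>2 + grad_norm_sq \<Omega> f
      + (\<Sum>i\<in>UNIV. \<Sum>j\<in>UNIV. (L2_norm \<Omega> (wd2 \<Omega> f i j))\<^sup>2))"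

definition H10 :: "R3 set \<Rightarrow> (R3 \<Rightarrow> real) \<Rightarrow> bool" where
  "H10 \<Omega> f \<longleftrightarrow> H1 \<Omega> f \<and>
      (\<forall>e>0. \<exists>\<phi>. test_fun \<Omega> \<phi> \<and> H1_norm \<Omega> (\<lambda>x. f x - \<phi> x) < e)"

definition admissible_mesh :: "R3 set \<Rightarrow> R3 set set \<Rightarrow> bool" where
  "admissible_mesh \<Omega> M \<longleftrightarrow> finite M \<and> M \<noteq> {} \<and> (\<forall>T\<in>M. 3 simplex T)
      \<and> \<Union>M = closure \<Omega>
      \<and> (\<forall>T1\<in>M. \<forall>T2\<in>M. (T1 \<inter> T2) face_of T1 \<and> (T1 \<inter> T2) face_of T2)"

definition inradius :: "R3 set \<Rightarrow> real" where
  "inradius T = Sup {r. \<exists>x. ball x r \<subseteq> T}"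

definition shape_regular :: "real \<Rightarrow> R3 set set \<Rightarrow> bool" where
  "shape_regular \<sigma> M \<longleftrightarrow> (\<forall>T\<in>M. diameter T \<le> \<sigma> * inradius T)"

definition mesh_size :: "R3 set set \<Rightarrow> real" where
  "mesh_size M = Max (diameter ` M)"

text \<open>V_h: continuous on closure Omega, affine on each element, zero on the boundary
  (functions are extended by zero outside Omega).\<close>
definition Vh :: "R3 set \<Rightarrow> R3 set set \<Rightarrow> (R3 \<Rightarrow> real) set" where
  "Vh \<Omega> M = {v. continuous_on (closure \<Omega>) v
      \<and> (\<forall>T\<in>M. \<exists>a b. \<forall>x\<in>T. v x = a \<bullet> x + b)
      \<and> (\<forall>x. x \<notin> \<Omega> \<longrightarrow> v x = 0)}"

definition galerkin_sol :: "R3 set \<Rightarrow> R3 set set \<Rightarrow> real \<Rightarrow> (R3 \<Rightarrow> real) \<Rightarrow> (R3 \<Rightarrow> real) \<Rightarrow> bool" where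
  "galerkin_sol \<Omega> M \<rho> ubar u \<longleftrightarrow> u \<in> Vh \<Omega> M \<and>
     (\<forall>v\<in>Vh \<Omega> M.
        \<rho> * integral\<^sup>L (lebesgue_on \<Omega>) (\<lambda>x. \<Sum>i\<in>UNIV. wd1 \<Omega> u i x * wd1 \<Omega> v i x)
        + integral\<^sup>L (lebesgue_on \<Omega>) (\<lambda>x. u x * v x)
        = integral\<^sup>L (lebesgue_on \<Omega>) (\<lambda>x. ubar x * v x))"

end

theory Submission
  imports Defs
begin

text \<open>
  Write \<open>D\<close> and \<open>L\<close> for the weak gradient and Laplacian of the target \<open>ub\<close>, \<open>v\<close> for its nodal interpolant,
  and put \<open>w = u - v\<close>. Green's formula turns the Galerkin equation, tested with \<open>w\<close>, into
  \<open>\<rho> (\<nabla>u - D, \<nabla>w) + (u - ub, w) = \<rho> (L, w)\<close>, and completing the square gives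
  \<open>\<rho> |\<nabla>u - D|\<^sup>2 + |u - ub|\<^sup>2 \<le> \<rho>\<^sup>2 |L|\<^sup>2 + |ub - v|\<^sup>2 + \<rho> |D - \<nabla>v|\<^sup>2\<close>. No elliptic regularity is
  involved; everything reduces to interpolation error bounds.

  For a vertex \<open>y\<close> of an element, let \<open>R y x\<close> be the first order Taylor remainder at \<open>y\<close> of the expansion
  about \<open>x\<close>. On each element both interpolation errors are controlled pointwise by the four remainders
  at its vertices: the affine function \<open>z \<mapsto> v z - ub x - D x \<bullet> (z - x)\<close> equals \<open>R y x\<close> at each vertex \<open>y\<close>,
  its value at \<open>x\<close> is \<open>v x - ub x\<close>, and its slope is \<open>\<nabla>v - D x\<close>, which is controlled through an inscribed
  ball. The integral form of the remainder together with a dilation towards the vertex bounds the \<open>L\<^sup>2\<close>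
  norm of \<open>R y\<close> by the Hessian. Mollification extends this from smooth functions to \<open>H\<^sup>2\<close>; averaging the
  Taylor expansion over \<open>x\<close> shows on the way that \<open>H\<^sup>2\<close> functions have continuous representatives, so
  that nodal values make sense.
\<close>

section \<open>Square-integrable functions\<close>

text \<open>Two obstacles shape the proof. Finite element functions are not test functions, so the
  weak derivatives of \<open>ub\<close> cannot be paired with \<open>w\<close> directly:
  \<open>w\<close> has to be approximated by test functions. And the interpolant lies in
  \<open>Vh\<close> only if boundary nodes carry the value 0, while \<open>H10\<close> is a mere
  closure of test functions in the H1 norm; so the continuous representative must be shown to vanish
  on the boundary. Convexity answers both: contracting towards an interior point \<open>x0\<close>
  moves the closed domain strictly inside, which leaves room for a mollifier, and a dilation with
  factor slightly above 1 compares values near the boundary with the value 0 outside.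
  \<open>wd1\<close> and \<open>wd2\<close> are made by choice and determined only almost
  everywhere, hence the uniqueness lemmas. Origin of the constants: 16 is four vertices times the 4
  of the Taylor estimate; \<open>256 * \<sigma>\<^sup>2\<close> is 16 times 4 (slope bound) times
  \<open>4 * \<sigma>\<^sup>2\<close> (diameter against inscribed radius); 3 bounds the squared
  Laplacian by the squared Hessian.\<close>

lemma integrable_lebesgue_on_subset:
  fixes f :: "R3 \<Rightarrow> real"
  assumes "integrable (lebesgue_on S) f" "S' \<subseteq> S" "S' \<in> sets lebesgue" "S \<in> sets lebesgue"
  shows "integrable (lebesgue_on S') f"
proof -
  have "integrable lebesgue (\<lambda>x. indicator S x *\<^sub>R f x)"
    using assms by (simp add: integrable_restrict_space)
  then have "integrable lebesgue (\<lambda>x. indicator S' x *\<^sub>R (indicator S x *\<^sub>R f x))"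
    using assms(3) by (rule integrable_mult_indicator[rotated])
  also have "(\<lambda>x. indicator S' x *\<^sub>R (indicator S x *\<^sub>R f x)) = (\<lambda>x. indicat_real S' x *\<^sub>R f x)"
    using assms(2) by (auto simp: indicator_def fun_eq_iff)
  finally show ?thesis using assms by (simp add: integrable_restrict_space)
qed

lemma integral_lebesgue_on_mono_set:
  fixes f :: "R3 \<Rightarrow> real"
  assumes "integrable (lebesgue_on S) f" "S' \<subseteq> S" "S' \<in> sets lebesgue" "S \<in> sets lebesgue"
    "\<And>x. x \<in> S \<Longrightarrow> 0 \<le> f x"
  shows "(\<integral>x. f x \<partial>lebesgue_on S') \<le> (\<integral>x. f x \<partial>lebesgue_on S)"
  using assms by (intro integral_mono_lebesgue_on_AE) (auto intro!: AE_I2)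

lemma L2_measurable [measurable_dest]: "L2 S f \<Longrightarrow> f \<in> borel_measurable (lebesgue_on S)"
  by (simp add: L2_def)

lemma L2_sq_integrable: "L2 S f \<Longrightarrow> integrable (lebesgue_on S) (\<lambda>x. (f x)\<^sup>2)"
  by (simp add: L2_def)

lemma L2_norm_power2: "(L2_norm S f)\<^sup>2 = (\<integral>x. (f x)\<^sup>2 \<partial>lebesgue_on S)"
  by (simp add: L2_norm_def)

lemma L2_mult_integrable:
  assumes "L2 S f" "L2 S g" shows "integrable (lebesgue_on S) (\<lambda>x. f x * g x)"
proof (rule Bochner_Integration.integrable_bound)
  show "integrable (lebesgue_on S) (\<lambda>x. (f x)\<^sup>2 + (g x)\<^sup>2)"
    using assms by (auto simp: L2_def)
  show "(\<lambda>x. f x * g x) \<in> borel_measurable (lebesgue_on S)"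
    using assms by measurable
  have "\<bar>f x * g x\<bar> \<le> (f x)\<^sup>2 + (g x)\<^sup>2" for x
    using sum_squares_bound[of "\<bar>f x\<bar>" "\<bar>g x\<bar>"] mult_nonneg_nonneg[of "\<bar>f x\<bar>" "\<bar>g x\<bar>"]
    unfolding abs_mult power2_abs by linarith
  then show "AE x in lebesgue_on S. norm (f x * g x) \<le> norm ((f x)\<^sup>2 + (g x)\<^sup>2)" by auto
qed

lemma L2_cmult: "L2 S f \<Longrightarrow> L2 S (\<lambda>x. c * f x)"
  by (auto simp: L2_def power_mult_distrib)

lemma L2_add: assumes "L2 S f" "L2 S g" shows "L2 S (\<lambda>x. f x + g x)"
  using assms L2_mult_integrable[OF assms] unfolding L2_def
  by (auto simp: power2_sum mult.assoc)

lemma L2_diff: assumes "L2 S f" "L2 S g" shows "L2 S (\<lambda>x. f x - g x)"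
  using L2_add[OF assms(1) L2_cmult[OF assms(2), of "-1"]] by simp

lemma L2_zero: "L2 S (\<lambda>x. 0)" by (simp add: L2_def)

lemma L2_sum: assumes "\<And>i. i \<in> I \<Longrightarrow> L2 S (f i)" shows "L2 S (\<lambda>x. \<Sum>i\<in>I. f i x)"
  using assms by (induction I rule: infinite_finite_induct) (auto intro: L2_zero L2_add)

lemma L2_bounded_mult:
  assumes f: "L2 S f" and g[measurable]: "g \<in> borel_measurable (lebesgue_on S)"
    and B: "\<And>x. x \<in> S \<Longrightarrow> \<bar>g x\<bar> \<le> B"
  shows "L2 S (\<lambda>x. g x * f x)"
  unfolding L2_def
proof
  show m[measurable]: "(\<lambda>x. g x * f x) \<in> borel_measurable (lebesgue_on S)" using f by measurable
  have "(g x * f x)\<^sup>2 \<le> B\<^sup>2 * (f x)\<^sup>2" if "x \<in> S" for x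
    using B[OF that] unfolding power_mult_distrib
    by (intro mult_right_mono) (auto simp: abs_le_square_iff[symmetric])
  then have "AE x in lebesgue_on S. norm ((g x * f x)\<^sup>2) \<le> norm (B\<^sup>2 * (f x)\<^sup>2)"
    by (intro AE_I2) simp
  moreover have "integrable (lebesgue_on S) (\<lambda>x. B\<^sup>2 * (f x)\<^sup>2)"
    using L2_sq_integrable[OF f] by simp
  moreover have "(\<lambda>x. (g x * f x)\<^sup>2) \<in> borel_measurable (lebesgue_on S)"
    using m by simp
  ultimately show "integrable (lebesgue_on S) (\<lambda>x. (g x * f x)\<^sup>2)"
    by (rule Bochner_Integration.integrable_bound[rotated 2])
qed

lemma L2_subset:
  assumes "L2 S f" "S' \<subseteq> S" "S' \<in> sets lebesgue" "S \<in> sets lebesgue"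
  shows "L2 S' f"
  using assms measurable_restrict_mono[of f lebesgue S borel S'] integrable_lebesgue_on_subset
  unfolding L2_def by blast

lemma L2_bounded:
  assumes f: "f \<in> borel_measurable (lebesgue_on S)" and "S \<in> lmeasurable"
    and B: "\<And>x. x \<in> S \<Longrightarrow> \<bar>f x\<bar> \<le> B"
  shows "L2 S f"
proof -
  interpret finite_measure "lebesgue_on S" using assms(2) by (rule finite_measure_lebesgue_on)
  have "L2 S (\<lambda>x. f x * 1)"
    by (rule L2_bounded_mult[OF _ f B]) (auto simp: L2_def)
  then show ?thesis by simp
qed

lemma L2_integrable:
  assumes "L2 S f" "S \<in> lmeasurable" shows "integrable (lebesgue_on S) f"
proof -
  interpret finite_measure "lebesgue_on S" using assms(2) by (rule finite_measure_lebesgue_on)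
  show ?thesis using assms square_integrable_imp_integrable by (auto simp: L2_def)
qed

text \<open>Discriminant argument for the nonnegative integral of \<open>(s f - t g)^2\<close>; two
  parameters postpone division until the case \<open>C = 0\<close> is split off.\<close>

lemma L2_Cauchy_Schwarz:
  assumes f: "L2 S f" and g: "L2 S g"
  shows "(\<integral>x. f x * g x \<partial>lebesgue_on S)\<^sup>2 \<le> (\<integral>x. (f x)\<^sup>2 \<partial>lebesgue_on S) * (\<integral>x. (g x)\<^sup>2 \<partial>lebesgue_on S)"
proof -
  define A C B where "A = (\<integral>x. (f x)\<^sup>2 \<partial>lebesgue_on S)" and "C = (\<integral>x. (g x)\<^sup>2 \<partial>lebesgue_on S)"
    and "B = (\<integral>x. f x * g x \<partial>lebesgue_on S)"
  note i = L2_sq_integrable[OF f] L2_sq_integrable[OF g] L2_mult_integrable[OF f g]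
  have q: "0 \<le> s\<^sup>2 * A - 2 * s * t * B + t\<^sup>2 * C" for s t :: real
  proof -
    have "0 \<le> (\<integral>x. (s * f x - t * g x)\<^sup>2 \<partial>lebesgue_on S)" by (simp add: integral_nonneg_AE)
    also have "\<dots> = (\<integral>x. s\<^sup>2 * (f x)\<^sup>2 - 2 * s * t * (f x * g x) + t\<^sup>2 * (g x)\<^sup>2 \<partial>lebesgue_on S)"
      by (rule Bochner_Integration.integral_cong) (auto simp: power2_diff power_mult_distrib)
    also have "\<dots> = s\<^sup>2 * A - 2 * s * t * B + t\<^sup>2 * C"
      using i unfolding A_def B_def C_def by simp
    finally show ?thesis .
  qed
  have "A \<ge> 0" "C \<ge> 0" unfolding A_def C_def by (simp_all add: integral_nonneg_AE)
  have "B\<^sup>2 \<le> A * C"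
  proof (cases "C = 0")
    case True
    have "B = 0"
    proof (rule ccontr)
      assume "B \<noteq> 0"
      \<comment> \<open>With \<open>C = 0\<close> the quadratic form is affine in \<open>t\<close>;
        this \<open>t\<close> turns it into \<open>A - (A + 1)\<close>, which is negative.\<close>
      have "0 \<le> A - 2 * ((A + 1) / (2 * B)) * B" using q[of 1 "(A+1)/(2*B)"] True by simp
      then show False using \<open>B \<noteq> 0\<close> by simp
    qed
    then show ?thesis using \<open>A \<ge> 0\<close> \<open>C \<ge> 0\<close> by simp
  next
    case False
    then have "C > 0" using \<open>C \<ge> 0\<close> by simp
    \<comment> \<open>The ratio \<open>t / s = B / C\<close> minimises the form, so what is read off
      is the discriminant condition.\<close>
    have "0 \<le> C\<^sup>2 * A - 2 * C * B * B + B\<^sup>2 * C" using q[of C B] by simp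
    also have "\<dots> = C * (A * C - B\<^sup>2)" by (simp add: power2_eq_square algebra_simps)
    finally show ?thesis using \<open>C > 0\<close> by (simp add: zero_le_mult_iff)
  qed
  then show ?thesis unfolding A_def B_def C_def .
qed

lemma integral_power2_add_le:
  assumes "L2 S f" "L2 S g"
  shows "(\<integral>x. (f x + g x)\<^sup>2 \<partial>lebesgue_on S)
      \<le> 2 * (\<integral>x. (f x)\<^sup>2 \<partial>lebesgue_on S) + 2 * (\<integral>x. (g x)\<^sup>2 \<partial>lebesgue_on S)"
proof -
  have *: "(a + b)\<^sup>2 \<le> 2 * a\<^sup>2 + 2 * b\<^sup>2" for a b :: real
    using sum_squares_bound[of a b] by (simp add: power2_sum)
  have "(\<integral>x. (f x + g x)\<^sup>2 \<partial>lebesgue_on S) \<le> (\<integral>x. 2 * (f x)\<^sup>2 + 2 * (g x)\<^sup>2 \<partial>lebesgue_on S)"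
    using assms L2_add[OF assms] 
    by (intro integral_mono) (auto simp: L2_def intro: *)
  also have "\<dots> = 2 * (\<integral>x. (f x)\<^sup>2 \<partial>lebesgue_on S) + 2 * (\<integral>x. (g x)\<^sup>2 \<partial>lebesgue_on S)"
    using assms by (simp add: L2_def)
  finally show ?thesis .
qed

section \<open>Convergence in L2 along sequences\<close>

lemma tendsto_zero_squeeze:
  fixes a b :: "nat \<Rightarrow> real"
  assumes "\<And>n. 0 \<le> a n" "\<And>n. a n \<le> b n" "b \<longlonglongrightarrow> 0"
  shows "a \<longlonglongrightarrow> 0"
  by (rule real_tendsto_sandwich[OF _ _ tendsto_const assms(3)]) (use assms in auto)

text \<open>Membership of all terms and of the limit is part of the notion: the Bochner integral of
  a non-integrable function is 0, so a limit of integrals alone could hold vacuously.\<close>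

definition L2_tendsto :: "R3 set \<Rightarrow> (nat \<Rightarrow> R3 \<Rightarrow> real) \<Rightarrow> (R3 \<Rightarrow> real) \<Rightarrow> bool" where
  "L2_tendsto S F f \<longleftrightarrow> (\<forall>n. L2 S (F n)) \<and> L2 S f
     \<and> (\<lambda>n. \<integral>x. (F n x - f x)\<^sup>2 \<partial>lebesgue_on S) \<longlonglongrightarrow> 0"

lemma L2_tendstoD:
  assumes "L2_tendsto S F f"
  shows "L2 S (F n)" "L2 S f" "(\<lambda>n. \<integral>x. (F n x - f x)\<^sup>2 \<partial>lebesgue_on S) \<longlonglongrightarrow> 0"
  using assms by (auto simp: L2_tendsto_def)

lemma L2_tendsto_const: "L2 S f \<Longrightarrow> L2_tendsto S (\<lambda>n. f) f"
  by (simp add: L2_tendsto_def)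

lemma L2_tendsto_add:
  assumes F: "L2_tendsto S F f" and G: "L2_tendsto S G g"
  shows "L2_tendsto S (\<lambda>n x. F n x + G n x) (\<lambda>x. f x + g x)"
  unfolding L2_tendsto_def
proof (intro conjI allI)
  note FD = L2_tendstoD[OF F] and GD = L2_tendstoD[OF G]
  show "L2 S (\<lambda>x. F n x + G n x)" for n using FD GD by (intro L2_add)
  show "L2 S (\<lambda>x. f x + g x)" using FD GD by (intro L2_add)
  have le: "(\<integral>x. (F n x + G n x - (f x + g x))\<^sup>2 \<partial>lebesgue_on S)
     \<le> 2 * (\<integral>x. (F n x - f x)\<^sup>2 \<partial>lebesgue_on S) + 2 * (\<integral>x. (G n x - g x)\<^sup>2 \<partial>lebesgue_on S)" for n
  proof -
    have "F n x - f x + (G n x - g x) = F n x + G n x - (f x + g x)" for x by simp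
    then show ?thesis
      using integral_power2_add_le[OF L2_diff[OF FD(1)[of n] FD(2)] L2_diff[OF GD(1)[of n] GD(2)]]
      by (simp only:)
  qed
  have "(\<lambda>n. 2 * (\<integral>x. (F n x - f x)\<^sup>2 \<partial>lebesgue_on S) + 2 * (\<integral>x. (G n x - g x)\<^sup>2 \<partial>lebesgue_on S)) \<longlonglongrightarrow> 0"
    by (intro tendsto_add_zero tendsto_mult_right_zero FD(3) GD(3))
  then show "(\<lambda>n. \<integral>x. (F n x + G n x - (f x + g x))\<^sup>2 \<partial>lebesgue_on S) \<longlonglongrightarrow> 0"
    by (rule tendsto_zero_squeeze[rotated 2]) ((rule integral_nonneg_AE, simp) | rule le)+
qed

lemma L2_tendsto_bounded_mult:
  assumes F: "L2_tendsto S F f" and g[measurable]: "g \<in> borel_measurable (lebesgue_on S)"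
    and B: "\<And>x. x \<in> S \<Longrightarrow> \<bar>g x\<bar> \<le> B"
  shows "L2_tendsto S (\<lambda>n x. g x * F n x) (\<lambda>x. g x * f x)"
  unfolding L2_tendsto_def
proof (intro conjI allI)
  note FD = L2_tendstoD[OF F]
  note dF = L2_diff[OF FD(1) FD(2)]
  show "L2 S (\<lambda>x. g x * F n x)" for n by (rule L2_bounded_mult[OF FD(1) g B])
  show "L2 S (\<lambda>x. g x * f x)" by (rule L2_bounded_mult[OF FD(2) g B])
  have le: "(\<integral>x. (g x * F n x - g x * f x)\<^sup>2 \<partial>lebesgue_on S) \<le> B\<^sup>2 * (\<integral>x. (F n x - f x)\<^sup>2 \<partial>lebesgue_on S)" for n
  proof -
    have "(\<integral>x. (g x * F n x - g x * f x)\<^sup>2 \<partial>lebesgue_on S) = (\<integral>x. (g x * (F n x - f x))\<^sup>2 \<partial>lebesgue_on S)"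
      by (simp only: right_diff_distrib)
    also have "\<dots> \<le> (\<integral>x. B\<^sup>2 * (F n x - f x)\<^sup>2 \<partial>lebesgue_on S)"
    proof (rule integral_mono)
      show "integrable (lebesgue_on S) (\<lambda>x. (g x * (F n x - f x))\<^sup>2)"
        by (rule L2_sq_integrable[OF L2_bounded_mult[OF dF g B]])
      show "integrable (lebesgue_on S) (\<lambda>x. B\<^sup>2 * (F n x - f x)\<^sup>2)" using L2_sq_integrable[OF dF] by simp
      show "(g x * (F n x - f x))\<^sup>2 \<le> B\<^sup>2 * (F n x - f x)\<^sup>2" if "x \<in> space (lebesgue_on S)" for x
        using B[of x] that unfolding power_mult_distrib
        by (intro mult_right_mono) (auto simp: abs_le_square_iff[symmetric])
    qed
    also have "\<dots> = B\<^sup>2 * (\<integral>x. (F n x - f x)\<^sup>2 \<partial>lebesgue_on S)" by simp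
    finally show ?thesis .
  qed
  have "(\<lambda>n. B\<^sup>2 * (\<integral>x. (F n x - f x)\<^sup>2 \<partial>lebesgue_on S)) \<longlonglongrightarrow> 0"
    by (intro tendsto_mult_right_zero FD(3))
  then show "(\<lambda>n. \<integral>x. (g x * F n x - g x * f x)\<^sup>2 \<partial>lebesgue_on S) \<longlonglongrightarrow> 0"
    by (rule tendsto_zero_squeeze[rotated 2]) ((rule integral_nonneg_AE, simp) | rule le)+
qed

lemma L2_tendsto_cmult:
  assumes F: "L2_tendsto S F f" shows "L2_tendsto S (\<lambda>n x. c * F n x) (\<lambda>x. c * f x)"
  using L2_tendsto_bounded_mult[OF F, of "\<lambda>_. c" "\<bar>c\<bar>"] by simp

lemma L2_tendsto_diff:
  assumes F: "L2_tendsto S F f" and G: "L2_tendsto S G g"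
  shows "L2_tendsto S (\<lambda>n x. F n x - G n x) (\<lambda>x. f x - g x)"
  using L2_tendsto_add[OF F L2_tendsto_cmult[OF G, of "-1"]] by simp

lemma L2_tendsto_sum:
  assumes "\<And>i. i \<in> I \<Longrightarrow> L2_tendsto S (F i) (f i)"
  shows "L2_tendsto S (\<lambda>n x. \<Sum>i\<in>I. F i n x) (\<lambda>x. \<Sum>i\<in>I. f i x)"
  using assms
  by (induction I rule: infinite_finite_induct) (auto intro: L2_tendsto_const L2_zero L2_tendsto_add)

text \<open>Differentiating a mollification at the dilated point \<open>s x + c\<close> yields a
  factor \<open>s\<close>; this lemma removes such factors as they tend to 1. The splitting is
  \<open>c (F - f) + (c - 1) f + f\<close>.\<close>

lemma L2_tendsto_scaled:
  assumes F: "L2_tendsto S F f" and c: "c \<longlonglongrightarrow> 1"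
  shows "L2_tendsto S (\<lambda>n x. c n * F n x) f"
proof -
  note FD = L2_tendstoD[OF F]
  have "L2_tendsto S (\<lambda>n x. c n * (F n x - f x)) (\<lambda>x. 0)"
    unfolding L2_tendsto_def
  proof (intro conjI allI)
    show "L2 S (\<lambda>x. c n * (F n x - f x))" for n by (intro L2_cmult L2_diff FD)
    have "(\<lambda>n. (c n)\<^sup>2 * (\<integral>x. (F n x - f x)\<^sup>2 \<partial>lebesgue_on S)) \<longlonglongrightarrow> 1\<^sup>2 * 0"
      by (intro tendsto_mult tendsto_power FD(3) c)
    then show "(\<lambda>n. \<integral>x. (c n * (F n x - f x) - 0)\<^sup>2 \<partial>lebesgue_on S) \<longlonglongrightarrow> 0"
      by (simp add: power_mult_distrib)
  qed (rule L2_zero)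
  moreover have "L2_tendsto S (\<lambda>n x. (c n - 1) * f x) (\<lambda>x. 0)"
    unfolding L2_tendsto_def
  proof (intro conjI allI)
    show "L2 S (\<lambda>x. (c n - 1) * f x)" for n by (intro L2_cmult FD)
    have "(\<lambda>n. (c n - 1)\<^sup>2 * (\<integral>x. (f x)\<^sup>2 \<partial>lebesgue_on S)) \<longlonglongrightarrow> (1 - 1)\<^sup>2 * (\<integral>x. (f x)\<^sup>2 \<partial>lebesgue_on S)"
      by (intro tendsto_mult tendsto_power tendsto_diff tendsto_const c)
    then show "(\<lambda>n. \<integral>x. ((c n - 1) * f x - 0)\<^sup>2 \<partial>lebesgue_on S) \<longlonglongrightarrow> 0"
      by (simp add: power_mult_distrib)
  qed (rule L2_zero)
  ultimately have "L2_tendsto S (\<lambda>n x. (c n * (F n x - f x) + (c n - 1) * f x) + f x) (\<lambda>x. 0 + 0 + f x)"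
    by (intro L2_tendsto_add L2_tendsto_const FD)
  moreover have "(\<lambda>n x. (c n * (F n x - f x) + (c n - 1) * f x) + f x) = (\<lambda>n x. c n * F n x)"
    by (intro ext) algebra
  ultimately show ?thesis by simp
qed

lemma L2_tendsto_integral_mult:
  assumes F: "L2_tendsto S F f" and g: "L2 S g"
  shows "(\<lambda>n. \<integral>x. F n x * g x \<partial>lebesgue_on S) \<longlonglongrightarrow> (\<integral>x. f x * g x \<partial>lebesgue_on S)"
proof -
  note FD = L2_tendstoD[OF F]
  let ?d = "\<lambda>n. (\<integral>x. F n x * g x \<partial>lebesgue_on S) - (\<integral>x. f x * g x \<partial>lebesgue_on S)"
  have eq: "?d n = (\<integral>x. (F n x - f x) * g x \<partial>lebesgue_on S)" for n
    using FD g by (simp add: left_diff_distrib L2_mult_integrable)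
  have le: "(?d n)\<^sup>2 \<le> (\<integral>x. (F n x - f x)\<^sup>2 \<partial>lebesgue_on S) * (\<integral>x. (g x)\<^sup>2 \<partial>lebesgue_on S)" for n
    unfolding eq by (rule L2_Cauchy_Schwarz[OF L2_diff[OF FD(1,2)] g])
  have "(\<lambda>n. (\<integral>x. (F n x - f x)\<^sup>2 \<partial>lebesgue_on S) * (\<integral>x. (g x)\<^sup>2 \<partial>lebesgue_on S)) \<longlonglongrightarrow> 0"
    by (intro tendsto_mult_left_zero FD(3))
  then have "(\<lambda>n. (?d n)\<^sup>2) \<longlonglongrightarrow> 0"
    by (rule tendsto_zero_squeeze[rotated 2]) (rule le zero_le_power2)+
  then have "(\<lambda>n. sqrt ((?d n)\<^sup>2)) \<longlonglongrightarrow> sqrt 0" by (rule tendsto_real_sqrt)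
  then have "?d \<longlonglongrightarrow> 0" by (simp add: tendsto_rabs_zero_iff)
  then show ?thesis by (simp add: LIM_zero_iff)
qed

text \<open>The squared error expands to \<open>F^2 - 2 F f + f^2\<close>, so the squares converge
  because the mixed term does. This is what carries estimates from smooth functions to H2 and
  H10.\<close>

lemma L2_tendsto_integral_power2:
  assumes F: "L2_tendsto S F f"
  shows "(\<lambda>n. \<integral>x. (F n x)\<^sup>2 \<partial>lebesgue_on S) \<longlonglongrightarrow> (\<integral>x. (f x)\<^sup>2 \<partial>lebesgue_on S)"
proof -
  note FD = L2_tendstoD[OF F]
  have eq: "(\<integral>x. (F n x)\<^sup>2 \<partial>lebesgue_on S) = (\<integral>x. (F n x - f x)\<^sup>2 \<partial>lebesgue_on S)
      + 2 * (\<integral>x. F n x * f x \<partial>lebesgue_on S) - (\<integral>x. (f x)\<^sup>2 \<partial>lebesgue_on S)" for n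
  proof -
    note i = L2_sq_integrable[OF FD(1), of n] L2_sq_integrable[OF FD(2)] L2_mult_integrable[OF FD(1,2), of n]
    have "(\<integral>x. (F n x - f x)\<^sup>2 \<partial>lebesgue_on S) = (\<integral>x. (F n x)\<^sup>2 - 2 * (F n x * f x) + (f x)\<^sup>2 \<partial>lebesgue_on S)"
      by (rule Bochner_Integration.integral_cong) (auto simp: power2_diff)
    also have "\<dots> = (\<integral>x. (F n x)\<^sup>2 \<partial>lebesgue_on S) - 2 * (\<integral>x. F n x * f x \<partial>lebesgue_on S) + (\<integral>x. (f x)\<^sup>2 \<partial>lebesgue_on S)"
      using i by simp
    finally show ?thesis by simp
  qed
  have "(\<lambda>n. (\<integral>x. (F n x - f x)\<^sup>2 \<partial>lebesgue_on S)
      + 2 * (\<integral>x. F n x * f x \<partial>lebesgue_on S) - (\<integral>x. (f x)\<^sup>2 \<partial>lebesgue_on S)) \<longlonglongrightarrow>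
      0 + 2 * (\<integral>x. f x * f x \<partial>lebesgue_on S) - (\<integral>x. (f x)\<^sup>2 \<partial>lebesgue_on S)"
    by (intro tendsto_add tendsto_diff tendsto_mult tendsto_const FD(3) L2_tendsto_integral_mult[OF F FD(2)])
  moreover have "(\<integral>x. f x * f x \<partial>lebesgue_on S) = (\<integral>x. (f x)\<^sup>2 \<partial>lebesgue_on S)"
    by (simp only: power2_eq_square)
  ultimately show ?thesis unfolding eq by simp
qed

lemma L2_tendsto_subset:
  assumes F: "L2_tendsto S F f" and S: "S' \<subseteq> S" "S' \<in> sets lebesgue" "S \<in> sets lebesgue"
  shows "L2_tendsto S' F f"
  unfolding L2_tendsto_def
proof (intro conjI allI)
  note FD = L2_tendstoD[OF F]
  show "L2 S' (F n)" for n using L2_subset[OF FD(1) S] .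
  show "L2 S' f" using L2_subset[OF FD(2) S] .
  show "(\<lambda>n. \<integral>x. (F n x - f x)\<^sup>2 \<partial>lebesgue_on S') \<longlonglongrightarrow> 0"
    by (rule tendsto_zero_squeeze[OF _ _ FD(3)])
      (auto intro!: integral_nonneg_AE integral_lebesgue_on_mono_set S L2_sq_integrable L2_diff FD(1,2))
qed

lemma L2_tendsto_cong:
  assumes F: "L2_tendsto S F f" and "\<And>n x. x \<in> S \<Longrightarrow> F n x = G n x"
  shows "L2_tendsto S G f"
proof -
  note FD = L2_tendstoD[OF F]
  have "L2 S (G n)" for n
  proof -
    have "integrable (lebesgue_on S) (\<lambda>x. (F n x)\<^sup>2) \<longleftrightarrow> integrable (lebesgue_on S) (\<lambda>x. (G n x)\<^sup>2)"
      using assms(2) by (intro Bochner_Integration.integrable_cong) auto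
    then show ?thesis
      using FD(1)[of n] measurable_lebesgue_cong[of S "F n" "G n" borel] assms(2) unfolding L2_def by blast
  qed
  moreover have "(\<integral>x. (G n x - f x)\<^sup>2 \<partial>lebesgue_on S) = (\<integral>x. (F n x - f x)\<^sup>2 \<partial>lebesgue_on S)" for n
    using assms(2) by (intro Bochner_Integration.integral_cong) auto
  ultimately show ?thesis using FD by (simp add: L2_tendsto_def)
qed

lemma L2_tendsto_unique_AE:
  assumes F: "L2_tendsto S F f" and G: "L2_tendsto S F g"
  shows "AE x in lebesgue_on S. f x = g x"
proof -
  have "L2_tendsto S (\<lambda>n x. F n x - F n x) (\<lambda>x. f x - g x)" by (rule L2_tendsto_diff[OF F G])
  note d = this
  have L: "L2 S (\<lambda>x. f x - g x)" by (rule L2_tendstoD(2)[OF d])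
  \<comment> \<open>The difference of the two sequences is constantly 0, so the squared norm of
    \<open>f - g\<close> is a limit of zeros.\<close>
  have "(\<lambda>n. 0) \<longlonglongrightarrow> (\<integral>x. (f x - g x)\<^sup>2 \<partial>lebesgue_on S)"
    using L2_tendsto_integral_power2[OF d] by simp
  from LIMSEQ_unique[OF this tendsto_const] have z: "(\<integral>x. (f x - g x)\<^sup>2 \<partial>lebesgue_on S) = 0" .
  have "AE x in lebesgue_on S. (f x - g x)\<^sup>2 = 0"
    using integral_nonneg_eq_0_iff_AE[OF L2_sq_integrable[OF L]] z by auto
  then show ?thesis by auto
qed

section \<open>Smooth bump functions\<close>

lemma pd_eqI: "(f has_derivative D) (at x) \<Longrightarrow> pd i f x = D (axis i 1)"
  unfolding pd_def using frechet_derivative_at by metis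

lemma frechet_derivative_pd:
  assumes "f differentiable (at x)"
  shows "frechet_derivative f (at x) v = (\<Sum>i\<in>UNIV. v $ i * pd i f x)"
proof -
  have lin: "linear (frechet_derivative f (at x))"
    using assms linear_frechet_derivative by blast
  have "v = (\<Sum>i\<in>UNIV. v $ i *\<^sub>R axis i 1)"
    by (simp add: vec_eq_iff axis_def if_distrib[of "\<lambda>u. _ * u"] cong: if_cong)
  then have "frechet_derivative f (at x) v = frechet_derivative f (at x) (\<Sum>i\<in>UNIV. v $ i *\<^sub>R axis i 1)"
    by simp
  also have "\<dots> = (\<Sum>i\<in>UNIV. v $ i * pd i f x)"
    by (simp add: linear_sum[OF lin] linear_scale[OF lin] pd_def)
  finally show ?thesis .
qed

lemma has_derivative_pd:
  assumes "f differentiable (at x)"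
  shows "(f has_derivative (\<lambda>v. \<Sum>i\<in>UNIV. v $ i * pd i f x)) (at x)"
proof -
  have "(f has_derivative frechet_derivative f (at x)) (at x)"
    using assms frechet_derivative_works by blast
  moreover have "frechet_derivative f (at x) = (\<lambda>v. \<Sum>i\<in>UNIV. v $ i * pd i f x)"
    using frechet_derivative_pd[OF assms] by blast
  ultimately show ?thesis by simp
qed

text \<open>The head of the list is the outermost derivative, so an additional innermost one goes to
  the end; this makes \<open>smooth_fun\<close> closed under \<open>pd\<close>.\<close>

lemma iter_pd_append: "iter_pd is (pd i f) = iter_pd (is @ [i]) f"
  by (induction "is") auto

lemma smooth_fun_pd: "smooth_fun f \<Longrightarrow> smooth_fun (pd i f)"
  unfolding smooth_fun_def iter_pd_append by blast

lemma smooth_fun_differentiable: "smooth_fun f \<Longrightarrow> f differentiable (at x)"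
  unfolding smooth_fun_def by (metis iter_pd.simps(1))

lemma smooth_fun_continuous: "smooth_fun f \<Longrightarrow> continuous_on UNIV f"
  by (meson differentiable_at_imp_differentiable_on differentiable_imp_continuous_on smooth_fun_differentiable)

text \<open>Polynomials in \<open>1/s\<close> times \<open>exp (-1/s)\<close>: this family is closed under differentiation,
  also across \<open>s = 0\<close>.\<close>

definition flat :: "real poly \<Rightarrow> real \<Rightarrow> real" where
  "flat p s = (if s > 0 then poly p (1 / s) * exp (- (1 / s)) else 0)"

lemma poly_times_exp_neg_tendsto_0: "((\<lambda>t. poly p t * exp (- t)) \<longlongrightarrow> 0) (at_top :: real filter)"
proof -
  have eq: "poly p t * exp (- t) = (\<Sum>i\<le>degree p. coeff p i * (t ^ i / exp t))" for t :: real
    by (simp add: poly_altdef sum_distrib_right exp_minus field_simps sum_divide_distrib)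
  have "((\<lambda>t. \<Sum>i\<le>degree p. coeff p i * (t ^ i / exp t)) \<longlongrightarrow> (\<Sum>i\<le>degree p. coeff p i * 0)) (at_top :: real filter)"
    by (intro tendsto_sum tendsto_mult tendsto_const tendsto_power_div_exp_0)
  then show ?thesis unfolding eq by simp
qed

text \<open>From the right, \<open>t = 1/s\<close> turns the claim into exponential decay beating a
  polynomial at infinity; from the left the function is 0.\<close>

lemma flat_tendsto_0: "(flat p \<longlongrightarrow> 0) (at 0)"
proof -
  have "((\<lambda>s. poly p (inverse s) * exp (- inverse s)) \<longlongrightarrow> 0) (at_right (0::real))"
    by (rule filterlim_compose[OF poly_times_exp_neg_tendsto_0 filterlim_inverse_at_top_right])
  moreover have "\<forall>\<^sub>F s in at_right 0. poly p (inverse s) * exp (- inverse s) = flat p s"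
    by (auto simp: eventually_at_filter flat_def inverse_eq_divide)
  ultimately have "(flat p \<longlongrightarrow> 0) (at_right 0)" using tendsto_cong by fast
  moreover have "(flat p \<longlongrightarrow> 0) (at_left 0)"
  proof -
    have "\<forall>\<^sub>F s in at_left 0. 0 = flat p s" by (auto simp: eventually_at_filter flat_def)
    then show ?thesis by (rule Lim_transform_eventually[OF tendsto_const])
  qed
  ultimately show ?thesis by (simp add: filterlim_at_split)
qed

text \<open>For \<open>s > 0\<close> the chain rule gives
  \<open>(1/s)^2 (p - p')(1/s) exp (-1/s)\<close>, whence the factor
  \<open>[:0,0,1:]\<close>.\<close>

lemma flat_has_derivative:
  "(flat p has_real_derivative flat ([:0,0,1:] * (p - pderiv p)) s) (at s)"
proof -
  consider "s > 0" | "s < 0" | "s = 0" by linarith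
  then show ?thesis
  proof cases
    case 1
    have "((\<lambda>s. poly p (1 / s) * exp (- (1 / s))) has_real_derivative
       poly ([:0,0,1:] * (p - pderiv p)) (1 / s) * exp (- (1 / s))) (at s)"
      using 1 by (auto intro!: derivative_eq_intros poly_DERIV[THEN DERIV_chain2] simp: field_simps power2_eq_square)
    moreover have "\<forall>\<^sub>F x in nhds s. poly p (1 / x) * exp (- (1 / x)) = flat p x"
      using eventually_nhds_in_open[of "{0<..}" s] 1 by (auto elim!: eventually_mono simp: flat_def)
    ultimately show ?thesis using 1 by (subst (asm) DERIV_cong_ev[OF refl]) (auto simp: flat_def)
  next
    case 2
    have "((\<lambda>s. 0) has_real_derivative 0) (at s)" by simp
    moreover have "\<forall>\<^sub>F x in nhds s. 0 = flat p x"
      using eventually_nhds_in_open[of "{..<0}" s] 2 by (auto elim!: eventually_mono simp: flat_def)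
    ultimately show ?thesis using 2 by (subst (asm) DERIV_cong_ev[OF refl]) (auto simp: flat_def)
  next
    case 3
    have "(flat ([:0,1:] * p) \<longlongrightarrow> 0) (at 0)" by (rule flat_tendsto_0)
    \<comment> \<open>At 0 the difference quotient is again a \<open>flat\<close> function, with one
      more factor \<open>1/s\<close>, so its limit is known. At \<open>h = 0\<close> both sides are
      0, since division by 0 gives 0.\<close>
    moreover have "flat ([:0,1:] * p) = (\<lambda>h. (flat p h - flat p 0) / (h - 0))"
      by (auto simp: flat_def fun_eq_iff)
    ultimately have "((\<lambda>h. (flat p h - flat p 0) / (h - 0)) \<longlongrightarrow> 0) (at 0)" by simp
    then have "(flat p has_real_derivative 0) (at 0)"
      unfolding has_field_derivative_iff by simp
    then show ?thesis using 3 by (simp add: flat_def)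
  qed
qed

text \<open>A class that contains the bump and is closed under partial derivatives:
  differentiability of all its members then yields smoothness, with no formula for higher
  derivatives.\<close>

inductive bump_alg :: "(R3 \<Rightarrow> real) \<Rightarrow> bool" where
  const: "bump_alg (\<lambda>x. c)"
| coord: "bump_alg (\<lambda>x. x $ i)"
| add: "bump_alg f \<Longrightarrow> bump_alg g \<Longrightarrow> bump_alg (\<lambda>x. f x + g x)"
| mult: "bump_alg f \<Longrightarrow> bump_alg g \<Longrightarrow> bump_alg (\<lambda>x. f x * g x)"
| flat: "bump_alg f \<Longrightarrow> bump_alg (\<lambda>x. flat p (f x))"

lemma bump_alg_pd:
  assumes "bump_alg f"
  shows "(\<forall>x. f differentiable (at x)) \<and> (\<forall>i. bump_alg (pd i f))"
  using assms
proof (induction rule: bump_alg.induct)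
  case (const c)
  have "((\<lambda>x. c) has_derivative (\<lambda>v. 0)) (at x)" for x :: R3 by simp
  then have "pd i (\<lambda>x. c) = (\<lambda>x. 0)" for i using pd_eqI by blast
  then show ?case by (simp add: bump_alg.const)
next
  case (coord j)
  have d: "((\<lambda>x. x $ j) has_derivative (\<lambda>v. v $ j)) (at x)" for x :: R3
    by (auto intro!: derivative_eq_intros bounded_linear_imp_has_derivative bounded_linear_vec_nth)
  then have "pd i (\<lambda>x. x $ j) = (\<lambda>x. axis i 1 $ j)" for i using pd_eqI by blast
  moreover have "(\<lambda>x. x $ j) differentiable (at x)" for x :: R3 using d differentiable_def by blast
  ultimately show ?case by (simp add: bump_alg.const)
next
  case (add f g)
  have d: "((\<lambda>x. f x + g x) has_derivative (\<lambda>v. frechet_derivative f (at x) v + frechet_derivative g (at x) v)) (at x)" for x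
    using add.IH frechet_derivative_works by (intro has_derivative_add) blast+
  have "pd i (\<lambda>x. f x + g x) = (\<lambda>x. pd i f x + pd i g x)" for i
    by (rule ext) (use pd_eqI[OF d] in \<open>simp only: pd_def\<close>)
  moreover have "(\<lambda>x. f x + g x) differentiable (at x)" for x using d differentiable_def by blast
  ultimately show ?case using add.IH by (simp add: bump_alg.add)
next
  case (mult f g)
  have d: "((\<lambda>x. f x * g x) has_derivative
     (\<lambda>v. f x * frechet_derivative g (at x) v + frechet_derivative f (at x) v * g x)) (at x)" for x
    using mult.IH frechet_derivative_works by (intro has_derivative_mult) blast+
  have "pd i (\<lambda>x. f x * g x) = (\<lambda>x. f x * pd i g x + pd i f x * g x)" for i
    by (rule ext) (use pd_eqI[OF d] in \<open>simp only: pd_def\<close>)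
  moreover have "(\<lambda>x. f x * g x) differentiable (at x)" for x using d differentiable_def by blast
  ultimately show ?case using mult.IH mult.hyps by (simp add: bump_alg.add bump_alg.mult)
next
  case (flat f p)
  let ?q = "[:0,0,1:] * (p - pderiv p)"
  have d: "((\<lambda>x. flat p (f x)) has_derivative (\<lambda>v. frechet_derivative f (at x) v * flat ?q (f x))) (at x)" for x
  proof -
    have "(f has_derivative frechet_derivative f (at x)) (at x)"
      using flat.IH frechet_derivative_works by blast
    moreover have "(flat p has_derivative (\<lambda>h. h * flat ?q (f x))) (at (f x))"
    proof -
      have "(*) (flat ?q (f x)) = (\<lambda>h. h * flat ?q (f x))" by (simp add: fun_eq_iff)
      then show ?thesis using flat_has_derivative[of p "f x"] unfolding has_field_derivative_def by simp
    qed
    ultimately show ?thesis by (rule has_derivative_compose)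
  qed
  have "pd i (\<lambda>x. flat p (f x)) = (\<lambda>x. pd i f x * flat ?q (f x))" for i
    by (rule ext) (use pd_eqI[OF d] in \<open>simp only: pd_def\<close>)
  moreover have "(\<lambda>x. flat p (f x)) differentiable (at x)" for x using d differentiable_def by blast
  ultimately show ?case using flat.IH flat.hyps by (simp add: bump_alg.flat bump_alg.mult)
qed

lemma bump_alg_smooth: assumes "bump_alg f" shows "smooth_fun f"
proof -
  have "bump_alg (iter_pd is f)" for "is" using assms bump_alg_pd by (induction "is") auto
  then show ?thesis unfolding smooth_fun_def using bump_alg_pd by blast
qed

text \<open>The classical bump \<open>exp (-1 / (1 - |z|^2/e^2))\<close> on the ball of radius
  \<open>e\<close>, extended by 0 and not normalised; the argument of \<open>flat\<close> has a
  shape that the rules of \<open>bump_alg\<close> accept.\<close>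

definition bump :: "real \<Rightarrow> R3 \<Rightarrow> real" where
  "bump e z = flat 1 (1 + (- 1 / e\<^sup>2) * (z \<bullet> z))"

lemma bump_smooth: "smooth_fun (bump e)"
proof -
  have eq: "bump e = (\<lambda>z. flat 1 (1 + (- 1 / e\<^sup>2) * (z $ 1 * z $ 1 + z $ 2 * z $ 2 + z $ 3 * z $ 3)))"
    by (simp add: bump_def fun_eq_iff inner_vec_def sum_3)
  show ?thesis unfolding eq
    by (intro bump_alg_smooth bump_alg.intros)
qed

lemma bump_nonneg: "0 \<le> bump e z" by (simp add: bump_def flat_def)

lemma bump_pos_iff: "e > 0 \<Longrightarrow> 0 < bump e z \<longleftrightarrow> norm z < e"
proof -
  assume "e > 0"
  then have "norm z < e \<longleftrightarrow> z \<bullet> z < e\<^sup>2"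
    by (metis norm_lt_square order_less_irrefl)
  then show ?thesis using \<open>e > 0\<close> by (auto simp: bump_def flat_def field_simps)
qed

lemma bump_eq_0: "e > 0 \<Longrightarrow> e \<le> norm z \<Longrightarrow> bump e z = 0"
  using bump_pos_iff[of e z] bump_nonneg[of e z] by linarith

lemma test_fun_bump: assumes "e > 0" shows "test_fun UNIV (bump e)"
proof -
  have "{x. bump e x \<noteq> 0} \<subseteq> cball 0 e"
    using bump_eq_0[OF assms] by (force simp: not_le intro: less_imp_le leI)
  then have "bounded {x. bump e x \<noteq> 0}" using bounded_cball bounded_subset by blast
  then show ?thesis by (simp add: test_fun_def bump_smooth)
qed

lemma pd_translate:
  assumes "f differentiable (at (z - c))"
  shows "pd i (\<lambda>z. f (z - c)) z = pd i f (z - c)"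
proof -
  have "((\<lambda>z. f (z - c)) has_derivative frechet_derivative f (at (z - c))) (at z)"
  proof (rule has_derivative_compose[where f = "\<lambda>z. z - c" and f' = "\<lambda>h. h"])
    show "((\<lambda>z. z - c) has_derivative (\<lambda>h. h)) (at z)" by (auto intro!: derivative_eq_intros)
    show "(f has_derivative frechet_derivative f (at (z - c))) (at (z - c))"
      using assms by (simp add: frechet_derivative_works)
  qed
  then show ?thesis using pd_eqI pd_def by metis
qed

lemma differentiable_translate:
  fixes f :: "R3 \<Rightarrow> real"
  assumes "f differentiable (at (z - c))"
  shows "(\<lambda>z. f (z - c)) differentiable (at z)"
  using differentiable_chain_at[of "\<lambda>z. z - c" z f] assms by (simp add: o_def)

lemma smooth_fun_translate:
  assumes "smooth_fun f" shows "smooth_fun (\<lambda>z. f (z - c))"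
proof -
  have "iter_pd is (\<lambda>z. f (z - c)) = (\<lambda>z. iter_pd is f (z - c))" for "is"
  proof (induction "is")
    case (Cons i "is")
    show ?case unfolding iter_pd.simps Cons
      using assms pd_translate by (fastforce simp: smooth_fun_def)
  qed simp
  then show ?thesis using assms differentiable_translate unfolding smooth_fun_def by simp
qed

section \<open>Test functions: support, locality, bounds and Taylor expansion\<close>

lemma test_fun_mono: "test_fun S f \<Longrightarrow> S \<subseteq> S' \<Longrightarrow> test_fun S' f"
  by (auto simp: test_fun_def)

lemma test_fun_UNIV: "test_fun S f \<Longrightarrow> test_fun UNIV f"
  by (rule test_fun_mono) auto

lemma test_fun_outside: "test_fun S f \<Longrightarrow> x \<notin> S \<Longrightarrow> f x = 0"
  using closure_subset[of "{x. f x \<noteq> 0}"] unfolding test_fun_def by auto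

lemma test_funI:
  assumes "smooth_fun f" "compact K" "K \<subseteq> S" "\<And>x. x \<notin> K \<Longrightarrow> f x = 0"
  shows "test_fun S f"
proof -
  have "closure {x. f x \<noteq> 0} \<subseteq> K"
    using assms by (intro closure_minimal compact_imp_closed) auto
  moreover from this have "compact (closure {x. f x \<noteq> 0})"
    using bounded_subset[OF compact_imp_bounded[OF assms(2)]] by (simp add: compact_eq_bounded_closed)
  ultimately show ?thesis using assms(1,3) unfolding test_fun_def by blast
qed

lemma pd_cong_open:
  assumes "open U" "x \<in> U" "\<And>y. y \<in> U \<Longrightarrow> f y = g y"
  shows "pd i f x = pd i g x"
proof -
  \<comment> \<open>\<open>frechet_derivative\<close> is a choice among derivatives; equal sets of
    derivatives make the choices equal.\<close>
  have "(f has_derivative D) (at x) \<longleftrightarrow> (g has_derivative D) (at x)" for D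
    using assms has_derivative_transform_within_open[of f D x UNIV U g]
      has_derivative_transform_within_open[of g D x UNIV U f] by auto
  then show ?thesis unfolding pd_def frechet_derivative_def by simp
qed

lemma test_fun_pd: assumes "test_fun S f" shows "test_fun S (pd i f)"
proof (rule test_funI)
  let ?K = "closure {x. f x \<noteq> 0}"
  show "smooth_fun (pd i f)" "compact ?K" "?K \<subseteq> S"
    using assms by (auto simp: test_fun_def smooth_fun_pd)
  show "pd i f x = 0" if "x \<notin> ?K" for x
  proof -
    have "pd i f x = pd i (\<lambda>_. 0) x"
      by (rule pd_cong_open[of "- ?K"]) (use that closure_subset[of "{x. f x \<noteq> 0}"] in auto)
    also have "\<dots> = 0" using pd_eqI[of "\<lambda>_. 0" "\<lambda>_. 0" x i] by simp
    finally show ?thesis .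
  qed
qed

lemma test_fun_continuous: "test_fun S f \<Longrightarrow> continuous_on UNIV f"
  by (simp add: test_fun_def smooth_fun_continuous)

lemma test_fun_bounded:
  assumes "test_fun S f" obtains B where "B \<ge> 0" "\<And>x. \<bar>f x\<bar> \<le> B"
proof -
  let ?K = "closure {x. f x \<noteq> 0}"
  have "bounded (f ` ?K)"
    using assms test_fun_continuous[OF assms]
    by (intro compact_imp_bounded compact_continuous_image) (auto simp: test_fun_def intro: continuous_on_subset)
  then obtain B where B: "\<And>x. x \<in> ?K \<Longrightarrow> \<bar>f x\<bar> \<le> B" unfolding bounded_iff by auto
  have "\<bar>f x\<bar> \<le> max B 0" for x
    using B[of x] closure_subset[of "{x. f x \<noteq> 0}"] by (cases "f x = 0") fastforce+
  then show ?thesis using that[of "max B 0"] by simp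
qed

lemma test_fun_pd_bounded:
  assumes "test_fun S f" obtains B where "B \<ge> 0" "\<And>i x. \<bar>pd i f x\<bar> \<le> B"
proof -
  have "\<exists>B. \<forall>x. \<bar>pd i f x\<bar> \<le> B" for i
    using test_fun_bounded[OF test_fun_pd[OF assms]] by metis
  then obtain B where B: "\<And>i x. \<bar>pd i f x\<bar> \<le> B i" by metis
  have "\<bar>pd i f x\<bar> \<le> (\<Sum>j\<in>UNIV. \<bar>B j\<bar>)" for i x
    using B[of i x] member_le_sum[of i UNIV "\<lambda>j. \<bar>B j\<bar>"] by fastforce
  then show ?thesis using that[of "\<Sum>j\<in>UNIV. \<bar>B j\<bar>"] by (simp add: sum_nonneg)
qed

lemma abs_sum_coord_le:
  fixes v :: R3 assumes "\<And>i. \<bar>c i\<bar> \<le> B" "B \<ge> 0"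
  shows "\<bar>\<Sum>i\<in>UNIV. v $ i * c i\<bar> \<le> 3 * B * norm v"
proof -
  have "\<bar>\<Sum>i\<in>UNIV. v $ i * c i\<bar> \<le> (\<Sum>i\<in>UNIV. \<bar>v $ i * c i\<bar>)" by (rule sum_abs)
  also have "\<dots> \<le> (\<Sum>i\<in>(UNIV::3 set). norm v * B)"
    using component_le_norm_cart[of v] assms by (intro sum_mono) (simp add: abs_mult mult_mono)
  also have "\<dots> = 3 * B * norm v" by simp
  finally show ?thesis .
qed

lemma test_fun_lipschitz:
  assumes "test_fun S f" obtains L where "L \<ge> 0" "\<And>x y. \<bar>f x - f y\<bar> \<le> L * norm (x - y)"
proof -
  obtain B where B: "B \<ge> 0" "\<And>i x. \<bar>pd i f x\<bar> \<le> B" using test_fun_pd_bounded[OF assms] by blast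
  have d: "(f has_derivative (\<lambda>v. \<Sum>i\<in>UNIV. v $ i * pd i f x)) (at x)" for x
    using assms by (intro has_derivative_pd smooth_fun_differentiable) (simp add: test_fun_def)
  have "norm (f x - f y) \<le> 3 * B * norm (x - y)" for x y
  proof (rule differentiable_bound[of UNIV f "\<lambda>x v. \<Sum>i\<in>UNIV. v $ i * pd i f x"])
    show "onorm (\<lambda>v. \<Sum>i\<in>UNIV. v $ i * pd i f x) \<le> 3 * B" for x
      by (rule onorm_bound) (use B in \<open>auto intro!: abs_sum_coord_le\<close>)
  qed (use d in auto)
  then show ?thesis using that[of "3 * B"] B by simp
qed

text \<open>Mean value inequality for \<open>f\<close> minus its linearisation, with the gradient
  Lipschitz by \<open>test_fun_lipschitz\<close> one derivative higher. Uniformity in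
  \<open>x\<close> is the point: the bound is later integrated against an arbitrary integrable
  function.\<close>

lemma test_fun_taylor:
  assumes "test_fun S f"
  obtains C where "C \<ge> 0" "\<And>x v. \<bar>f (x + v) - f x - (\<Sum>i\<in>UNIV. v $ i * pd i f x)\<bar> \<le> C * (norm v)\<^sup>2"
proof -
  have "\<exists>L. L \<ge> 0 \<and> (\<forall>x y. \<bar>pd i f x - pd i f y\<bar> \<le> L * norm (x - y))" for i
    using test_fun_lipschitz[OF test_fun_pd[OF assms]] by metis
  then obtain L where L: "\<And>i. L i \<ge> 0" "\<And>i x y. \<bar>pd i f x - pd i f y\<bar> \<le> L i * norm (x - y)" by metis
  define K where "K = (\<Sum>i\<in>UNIV. L i)"
  have K0: "K \<ge> 0" using L by (simp add: K_def sum_nonneg)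
  have K: "\<bar>pd i f x - pd i f y\<bar> \<le> K * norm (x - y)" for i x y
  proof -
    have "L i \<le> K" unfolding K_def using L(1) by (intro member_le_sum) auto
    then show ?thesis using L(2)[of i x y] mult_right_mono[of "L i" K "norm (x - y)"] by simp
  qed
  have d: "(f has_derivative (\<lambda>v. \<Sum>i\<in>UNIV. v $ i * pd i f x)) (at x)" for x
    using assms by (intro has_derivative_pd smooth_fun_differentiable) (simp add: test_fun_def)
  have "norm (f (x + v) - f x - (\<Sum>i\<in>UNIV. v $ i * pd i f x)) \<le> norm v * (3 * (K * norm v))" for x v
  proof -
    have "norm (f (x + v) - f x - (\<Sum>i\<in>UNIV. (x + v - x) $ i * pd i f x)) \<le> norm (x + v - x) * (3 * (K * norm v))"
    proof (rule differentiable_bound_linearization[where S = "cball x (norm v)" and f' = "\<lambda>x v. \<Sum>i\<in>UNIV. v $ i * pd i f x"])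
      show "(f has_derivative (\<lambda>v. \<Sum>i\<in>UNIV. v $ i * pd i f y)) (at y within cball x (norm v))" for y
        using d has_derivative_at_withinI by blast
      show "onorm ((\<lambda>w. \<Sum>i\<in>UNIV. w $ i * pd i f y) - (\<lambda>w. \<Sum>i\<in>UNIV. w $ i * pd i f x)) \<le> 3 * (K * norm v)"
        if "y \<in> cball x (norm v)" for y
        unfolding fun_diff_def
      proof (rule onorm_bound)
        fix w :: R3
        have "(\<Sum>i\<in>UNIV. w $ i * pd i f y) - (\<Sum>i\<in>UNIV. w $ i * pd i f x) = (\<Sum>i\<in>UNIV. w $ i * (pd i f y - pd i f x))"
          by (simp add: sum_subtractf right_diff_distrib)
        moreover have "\<bar>pd i f y - pd i f x\<bar> \<le> K * norm v" for i
        proof -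
          have "norm (y - x) \<le> norm v" using that by (simp add: dist_norm norm_minus_commute)
          then show ?thesis using K[of i y x] mult_left_mono[OF _ K0] by (meson order_trans)
        qed
        then have "\<bar>\<Sum>i\<in>UNIV. w $ i * (pd i f y - pd i f x)\<bar> \<le> 3 * (K * norm v) * norm w"
          using K0 by (intro abs_sum_coord_le) auto
        ultimately show "norm ((\<Sum>i\<in>UNIV. w $ i * pd i f y) - (\<Sum>i\<in>UNIV. w $ i * pd i f x)) \<le> 3 * (K * norm v) * norm w"
          by simp
      qed (use K0 in simp)
      show "x + t *\<^sub>R (x + v - x) \<in> cball x (norm v)" if "t \<in> {0..1}" for t
        using that by (simp add: dist_norm mult_left_le_one_le)
    qed auto
    then show ?thesis by simp
  qed
  then show ?thesis using that[of "3 * K"] K0 by (simp add: power2_eq_square mult_ac)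
qed

section \<open>Mollification\<close>

lemma borel_measurable_lebesgue_on:
  fixes f :: "R3 \<Rightarrow> real"
  assumes "f \<in> borel_measurable borel" shows "f \<in> borel_measurable (lebesgue_on S)"
  using assms by (intro measurable_restrict_space1 measurable_completion) simp

lemma continuous_measurable_lebesgue_on:
  fixes f :: "R3 \<Rightarrow> real"
  shows "continuous_on UNIV f \<Longrightarrow> f \<in> borel_measurable (lebesgue_on S)"
  by (intro borel_measurable_lebesgue_on borel_measurable_continuous_onI)

section \<open>Kernel integrals and differentiation under the integral sign\<close>

lemma has_derivative_of_quadratic_bound:
  fixes f :: "R3 \<Rightarrow> real"
  assumes D: "bounded_linear D" and K: "\<And>v. \<bar>f (x + v) - f x - D v\<bar> \<le> K * (norm v)\<^sup>2"
  shows "(f has_derivative D) (at x)"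
proof (rule has_derivativeI_sandwich[of 1 _ _ _ _ "\<lambda>y. K * norm (y - x)"])
  show "norm (f y - f x - D (y - x)) / norm (y - x) \<le> K * norm (y - x)" if "y \<noteq> x" for y
    using K[of "y - x"] that by (simp add: divide_le_eq power2_eq_square mult.assoc)
  have "((\<lambda>y. K * norm (y - x)) \<longlongrightarrow> K * norm (x - x)) (at x)"
    by (intro tendsto_mult tendsto_const tendsto_norm tendsto_diff tendsto_ident_at)
  then show "((\<lambda>y. K * norm (y - x)) \<longlongrightarrow> 0) (at x)" by simp
qed (use D in auto)

lemma pd_cmult:
  assumes "f differentiable (at x)"
  shows "pd i (\<lambda>x. k * f x) x = k * pd i f x"
proof -
  have "((\<lambda>x. k * f x) has_derivative (\<lambda>v. k * frechet_derivative f (at x) v)) (at x)"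
    using assms by (intro has_derivative_mult_right) (simp add: frechet_derivative_works)
  then show ?thesis using pd_eqI pd_def by metis
qed

text \<open>A correlation of \<open>G\<close> with the kernel \<open>f\<close>, taken at the dilated
  point \<open>s x + c\<close>. The dilation is built in because contraction (\<open>s < 1\<close>)
  and expansion (\<open>s > 1\<close>) about an interior point both occur later.\<close>

definition kernel_integral :: "R3 set \<Rightarrow> (R3 \<Rightarrow> real) \<Rightarrow> real \<Rightarrow> R3 \<Rightarrow> (R3 \<Rightarrow> real) \<Rightarrow> R3 \<Rightarrow> real" where
  "kernel_integral B f s c G x = (\<integral>z. G z * f (z - (s *\<^sub>R x + c)) \<partial>lebesgue_on B)"

lemma test_fun_translate:
  assumes "test_fun UNIV f" shows "test_fun UNIV (\<lambda>z. f (z - c))"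
proof (rule test_funI)
  let ?K = "closure {x. f x \<noteq> 0}"
  show "smooth_fun (\<lambda>z. f (z - c))" using assms by (simp add: test_fun_def smooth_fun_translate)
  show "compact ((\<lambda>z. z + c) ` ?K)"
    using assms by (intro compact_continuous_image continuous_intros) (auto simp: test_fun_def)
  show "f (x - c) = 0" if "x \<notin> (\<lambda>z. z + c) ` ?K" for x
    using that closure_subset[of "{x. f x \<noteq> 0}"] image_eqI[of x "\<lambda>z. z + c" "x - c" ?K] by fastforce
qed auto

lemma integrable_mult_test_fun:
  assumes G: "integrable (lebesgue_on B) G" and f: "test_fun S f"
  shows "integrable (lebesgue_on B) (\<lambda>z. G z * f z)"
proof -
  obtain K where K: "\<And>x. \<bar>f x\<bar> \<le> K" using test_fun_bounded[OF f] by blast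
  have m: "f \<in> borel_measurable (lebesgue_on B)"
    by (rule continuous_measurable_lebesgue_on[OF test_fun_continuous[OF f]])
  show ?thesis
  proof (rule Bochner_Integration.integrable_bound)
    show "integrable (lebesgue_on B) (\<lambda>z. K * G z)" using G by simp
    show "(\<lambda>z. G z * f z) \<in> borel_measurable (lebesgue_on B)"
      using G m by (intro borel_measurable_times) auto
    have "\<bar>G z * f z\<bar> \<le> \<bar>K * G z\<bar>" for z
      using K[of z] unfolding abs_mult by (subst mult.commute) (intro mult_right_mono, auto)
    then show "AE z in lebesgue_on B. norm (G z * f z) \<le> norm (K * G z)" by simp
  qed
qed

lemma integrable_kernel:
  assumes "integrable (lebesgue_on B) G" "test_fun UNIV f"
  shows "integrable (lebesgue_on B) (\<lambda>z. G z * f (z - y))"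
  using integrable_mult_test_fun[OF assms(1) test_fun_translate[OF assms(2)]] .

text \<open>The Taylor bound of \<open>f\<close> is uniform, so integrating it against
  \<open>\<bar>G\<bar>\<close> leaves an error quadratic in \<open>v\<close>; this replaces a
  dominated convergence argument.\<close>

lemma kernel_integral_has_derivative:
  assumes G: "integrable (lebesgue_on B) G" and f: "test_fun UNIV f"
  shows "(kernel_integral B f s c G has_derivative (\<lambda>v. \<Sum>i\<in>UNIV. v $ i * (- s * kernel_integral B (pd i f) s c G x))) (at x)"
proof -
  obtain C where C: "C \<ge> 0" "\<And>x v. \<bar>f (x + v) - f x - (\<Sum>i\<in>UNIV. v $ i * pd i f x)\<bar> \<le> C * (norm v)\<^sup>2"
    using test_fun_taylor[OF f] by blast
  let ?K = "(\<integral>z. \<bar>G z\<bar> \<partial>lebesgue_on B) * (C * s\<^sup>2)"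
  show ?thesis
  proof (rule has_derivative_of_quadratic_bound[where K = ?K])
    show "bounded_linear (\<lambda>v::R3. \<Sum>i\<in>UNIV. v $ i * (- s * kernel_integral B (pd i f) s c G x))"
      by (intro bounded_linear_sum bounded_linear_mult_const bounded_linear_vec_nth)
    fix v :: R3
    let ?y = "s *\<^sub>R x + c"
    let ?R = "\<lambda>z. f (z - ?y + (- s) *\<^sub>R v) - f (z - ?y) - (\<Sum>i\<in>UNIV. ((- s) *\<^sub>R v) $ i * pd i f (z - ?y))"
    have i1: "integrable (lebesgue_on B) (\<lambda>z. G z * f (z - y))" for y
      by (rule integrable_kernel[OF G f])
    have i2: "integrable (lebesgue_on B) (\<lambda>z. G z * pd i f (z - y))" for y i
      by (rule integrable_kernel[OF G test_fun_pd[OF f]])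
    have arg: "z - (s *\<^sub>R (x + v) + c) = z - ?y + (- s) *\<^sub>R v" for z
      by (simp add: algebra_simps)
    have i1': "integrable (lebesgue_on B) (\<lambda>z. G z * f (z - ?y + (- s) *\<^sub>R v))"
      using i1[of "s *\<^sub>R (x + v) + c"] unfolding arg .
    have "kernel_integral B f s c G (x + v) - kernel_integral B f s c G x - (\<Sum>i\<in>UNIV. v $ i * (- s * kernel_integral B (pd i f) s c G x))
      = (\<integral>z. G z * f (z - ?y + (- s) *\<^sub>R v) \<partial>lebesgue_on B) - (\<integral>z. G z * f (z - ?y) \<partial>lebesgue_on B)
        - (\<Sum>i\<in>UNIV. (- s * v $ i) * (\<integral>z. G z * pd i f (z - ?y) \<partial>lebesgue_on B))"
      unfolding kernel_integral_def arg by (simp add: mult_ac)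
    also have "\<dots> = (\<integral>z. G z * f (z - ?y + (- s) *\<^sub>R v) - G z * f (z - ?y)
        - (\<Sum>i\<in>UNIV. (- s * v $ i) * (G z * pd i f (z - ?y))) \<partial>lebesgue_on B)"
      using i1 i1' i2 by (simp add: Bochner_Integration.integral_diff Bochner_Integration.integral_sum)
    also have "\<dots> = (\<integral>z. G z * ?R z \<partial>lebesgue_on B)"
      by (rule Bochner_Integration.integral_cong) (simp_all add: right_diff_distrib sum_distrib_left mult_ac)
    finally have eq: "kernel_integral B f s c G (x + v) - kernel_integral B f s c G x - (\<Sum>i\<in>UNIV. v $ i * (- s * kernel_integral B (pd i f) s c G x))
      = (\<integral>z. G z * ?R z \<partial>lebesgue_on B)" .
    have bnd: "\<bar>G z * ?R z\<bar> \<le> \<bar>G z\<bar> * (C * s\<^sup>2 * (norm v)\<^sup>2)" for z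
    proof -
      have "\<bar>?R z\<bar> \<le> C * (norm ((- s) *\<^sub>R v))\<^sup>2" by (rule C(2))
      then show ?thesis unfolding abs_mult by (intro mult_left_mono) (auto simp: power_mult_distrib mult_ac)
    qed
    have "\<bar>\<integral>z. G z * ?R z \<partial>lebesgue_on B\<bar> \<le> (\<integral>z. \<bar>G z\<bar> * (C * s\<^sup>2 * (norm v)\<^sup>2) \<partial>lebesgue_on B)"
      using bnd G by (intro integral_abs_bound_integral[where g = "\<lambda>z. \<bar>G z\<bar> * (C * s\<^sup>2 * (norm v)\<^sup>2)"] 
        Bochner_Integration.integrable_bound[where g = "\<lambda>z. G z * ?R z" and f = "\<lambda>z. \<bar>G z\<bar> * (C * s\<^sup>2 * (norm v)\<^sup>2)"])
       (use i1 i1' i2 in \<open>auto simp: right_diff_distrib sum_distrib_left mult.left_commute[of "G _"] abs_mult C(1)\<close>)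
    also have "\<dots> = ?K * (norm v)\<^sup>2" by simp
    finally show "\<bar>kernel_integral B f s c G (x + v) - kernel_integral B f s c G x - (\<Sum>i\<in>UNIV. v $ i * (- s * kernel_integral B (pd i f) s c G x))\<bar> \<le> ?K * (norm v)\<^sup>2"
      unfolding eq .
  qed
qed

lemma kernel_integral_differentiable:
  assumes "integrable (lebesgue_on B) G" "test_fun UNIV f"
  shows "kernel_integral B f s c G differentiable (at x)"
  using kernel_integral_has_derivative[OF assms] differentiable_def by blast

lemma pd_kernel_integral:
  assumes "integrable (lebesgue_on B) G" "test_fun UNIV f"
  shows "pd i (kernel_integral B f s c G) = (\<lambda>x. - s * kernel_integral B (pd i f) s c G x)"
proof
  fix x
  have "pd i (kernel_integral B f s c G) x = (\<Sum>j\<in>UNIV. axis i 1 $ j * (- s * kernel_integral B (pd j f) s c G x))"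
    by (rule pd_eqI[OF kernel_integral_has_derivative[OF assms]])
  also have "\<dots> = - s * kernel_integral B (pd i f) s c G x"
    by (simp add: axis_def if_distrib[of "\<lambda>u. u * _"] sum_negf cong: if_cong)
  finally show "pd i (kernel_integral B f s c G) x = - s * kernel_integral B (pd i f) s c G x" .
qed

lemma test_fun_iter_pd: "test_fun S f \<Longrightarrow> test_fun S (iter_pd is f)"
  by (induction "is") (auto intro: test_fun_pd)

text \<open>Each derivative falls on the kernel and produces \<open>- s\<close>, since
  \<open>x\<close> enters the kernel through \<open>- s x\<close>.\<close>

lemma iter_pd_kernel_integral:
  assumes "integrable (lebesgue_on B) G" "test_fun UNIV f"
  shows "iter_pd is (kernel_integral B f s c G) = (\<lambda>x. (- s) ^ length is * kernel_integral B (iter_pd is f) s c G x)"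
proof (induction "is")
  case (Cons i "is")
  have t: "test_fun UNIV (iter_pd is f)" by (rule test_fun_iter_pd[OF assms(2)])
  show ?case unfolding iter_pd.simps Cons
    using pd_cmult[OF kernel_integral_differentiable[OF assms(1) t]] pd_kernel_integral[OF assms(1) t] by (auto simp: fun_eq_iff)
qed simp

lemma smooth_fun_cmult: assumes "smooth_fun f" shows "smooth_fun (\<lambda>x. k * f x)"
proof -
  have "iter_pd is (\<lambda>x. k * f x) = (\<lambda>x. k * iter_pd is f x)" for "is"
  proof (induction "is")
    case (Cons i "is")
    show ?case unfolding iter_pd.simps Cons
      using assms pd_cmult by (auto simp: smooth_fun_def fun_eq_iff)
  qed simp
  then show ?thesis using assms unfolding smooth_fun_def by simp
qed

lemma smooth_fun_kernel_integral:
  assumes "integrable (lebesgue_on B) G" "test_fun UNIV f"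
  shows "smooth_fun (kernel_integral B f s c G)"
  unfolding smooth_fun_def iter_pd_kernel_integral[OF assms]
  using kernel_integral_differentiable[OF assms(1) test_fun_iter_pd[OF assms(2)]] by simp

text \<open>The minus sign from the kernel cancels the one of the weak derivative. The weak identity
  is assumed for this single shifted kernel, so that the lemma serves both kernels supported in
  \<Omega> and identities on the whole space.\<close>

lemma pd_kernel_integral_weak:
  assumes "integrable (lebesgue_on B) G" "test_fun UNIV f"
    and w: "(\<integral>z. G z * pd i (\<lambda>z. f (z - (s *\<^sub>R x + c))) z \<partial>lebesgue_on B)
      = - (\<integral>z. g z * f (z - (s *\<^sub>R x + c)) \<partial>lebesgue_on B)"
  shows "pd i (kernel_integral B f s c G) x = s * kernel_integral B f s c g x"
proof -
  have "pd i (\<lambda>z. f (z - (s *\<^sub>R x + c))) z = pd i f (z - (s *\<^sub>R x + c))" for z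
    using assms(2) by (intro pd_translate smooth_fun_differentiable) (simp add: test_fun_def)
  then show ?thesis using w unfolding pd_kernel_integral[OF assms(1,2)] kernel_integral_def by simp
qed

section \<open>Normalised mollifiers: mass, L2 bound and convergence\<close>

definition bump_mass :: "real \<Rightarrow> real" where
  "bump_mass e = (\<integral>z. bump e z \<partial>lebesgue)"

definition mollify :: "R3 set \<Rightarrow> real \<Rightarrow> real \<Rightarrow> R3 \<Rightarrow> (R3 \<Rightarrow> real) \<Rightarrow> R3 \<Rightarrow> real" where
  "mollify B e s c G x = (1 / bump_mass e) * kernel_integral B (bump e) s c G x"

lemma smooth_fun_mollify:
  assumes "integrable (lebesgue_on B) G" "e > 0"
  shows "smooth_fun (mollify B e s c G)"
  using smooth_fun_cmult[OF smooth_fun_kernel_integral[OF assms(1) test_fun_bump[OF assms(2)]]]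
  unfolding mollify_def[abs_def] .

lemma pd_mollify:
  assumes "integrable (lebesgue_on B) G" "e > 0"
    and "(\<integral>z. G z * pd i (\<lambda>z. bump e (z - (s *\<^sub>R x + c))) z \<partial>lebesgue_on B)
      = - (\<integral>z. g z * bump e (z - (s *\<^sub>R x + c)) \<partial>lebesgue_on B)"
  shows "pd i (mollify B e s c G) x = s * mollify B e s c g x"
proof -
  note t = test_fun_bump[OF assms(2)]
  show ?thesis
    unfolding mollify_def[abs_def] pd_cmult[OF kernel_integral_differentiable[OF assms(1) t]] pd_kernel_integral_weak[OF assms(1) t assms(3)]
    by simp
qed

lemma nn_integral_lborel_dilation:
  fixes g :: "R3 \<Rightarrow> ennreal"
  assumes [measurable]: "g \<in> borel_measurable borel" and s: "s \<noteq> 0"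
  shows "(\<integral>\<^sup>+x. g x \<partial>lborel) = ennreal (\<bar>s\<bar> ^ 3) * (\<integral>\<^sup>+x. g (t + s *\<^sub>R x) \<partial>lborel)"
  by (subst lborel_affine[OF s, of t]) (simp add: nn_integral_density nn_integral_distr nn_integral_cmult)

lemma bump_measurable [measurable]: "bump e \<in> borel_measurable borel"
  by (intro borel_measurable_continuous_onI smooth_fun_continuous bump_smooth)

lemma bump_le_1: "bump e z \<le> 1"
  by (simp add: bump_def flat_def)

lemma integrable_bump: assumes "e > 0" shows "integrable lebesgue (bump e)"
proof -
  have "integrable lebesgue (\<lambda>x. indicator (cball 0 e) x *\<^sub>R bump e x)"
    by (rule integrableI_bounded_set_indicator[where B = 1])
      (auto simp: bump_le_1 bump_nonneg measurable_completion emeasure_lborel_cball_finite[unfolded infinity_ennreal_def])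
  moreover have "(\<lambda>x. indicator (cball 0 e) x *\<^sub>R bump e x) = bump e"
    using bump_eq_0[OF assms] by (auto simp: indicator_def fun_eq_iff)
  ultimately show ?thesis by (simp only:)
qed

lemma nn_integral_bump: "e > 0 \<Longrightarrow> (\<integral>\<^sup>+z. ennreal (bump e z) \<partial>lborel) = ennreal (bump_mass e)"
  unfolding bump_mass_def
  using nn_integral_eq_integral[OF integrable_bump[of e]] by (simp add: bump_nonneg nn_integral_completion)

text \<open>A nonnegative function with zero integral vanishes almost everywhere, but
  \<open>bump\<close> is positive on a ball, which is not negligible.\<close>

lemma bump_mass_pos: assumes "e > 0" shows "bump_mass e > 0"
proof -
  have "bump_mass e \<noteq> 0"
  proof
    assume "bump_mass e = 0"
    then have "AE z in lebesgue. bump e z = 0"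
      using integral_nonneg_eq_0_iff_AE[OF integrable_bump[OF assms]] by (simp add: bump_mass_def bump_nonneg)
    then have "AE z in lebesgue. z \<notin> ball (0::R3) e"
      by (rule AE_mp) (use bump_pos_iff[OF assms] in \<open>auto intro!: AE_I2 simp: less_le\<close>)
    then have "ball (0::R3) e \<in> null_sets lebesgue"
      by (subst AE_iff_null_sets) auto
    then have "negligible (ball (0::R3) e)" by (simp add: negligible_iff_null_sets)
    then show False using open_not_negligible[of "ball (0::R3) e"] assms by auto
  qed
  moreover have "bump_mass e \<ge> 0" unfolding bump_mass_def by (simp add: bump_nonneg integral_nonneg_AE)
  ultimately show ?thesis by linarith
qed

lemma nn_integral_bump_shifted:
  assumes "e > 0" "s \<noteq> 0"
  shows "(\<integral>\<^sup>+x. ennreal (bump e (y + s *\<^sub>R x)) \<partial>lborel) = ennreal (bump_mass e / \<bar>s\<bar> ^ 3)"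
proof -
  have "ennreal (bump_mass e) = ennreal (\<bar>s\<bar> ^ 3) * (\<integral>\<^sup>+x. ennreal (bump e (y + s *\<^sub>R x)) \<partial>lborel)"
    using nn_integral_lborel_dilation[of "\<lambda>z. ennreal (bump e z)" s y] assms nn_integral_bump by simp
  then have "ennreal (1 / \<bar>s\<bar> ^ 3) * ennreal (bump_mass e)
      = (ennreal (1 / \<bar>s\<bar> ^ 3) * ennreal (\<bar>s\<bar> ^ 3)) * (\<integral>\<^sup>+x. ennreal (bump e (y + s *\<^sub>R x)) \<partial>lborel)"
    by (simp add: mult.assoc)
  moreover have "ennreal (1 / \<bar>s\<bar> ^ 3) * ennreal (\<bar>s\<bar> ^ 3) = 1"
    using assms(2) by (subst ennreal_mult[symmetric]) auto
  moreover have "ennreal (1 / \<bar>s\<bar> ^ 3) * ennreal (bump_mass e) = ennreal (bump_mass e / \<bar>s\<bar> ^ 3)"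
    using bump_mass_pos[OF assms(1)] by (subst ennreal_mult[symmetric]) auto
  ultimately show ?thesis by simp
qed

lemma integrable_bump_on:
  assumes "e > 0" "B \<in> lmeasurable"
  shows "integrable (lebesgue_on B) (\<lambda>z. bump e (z - y))"
proof -
  interpret finite_measure "lebesgue_on B" using assms(2) by (rule finite_measure_lebesgue_on)
  show ?thesis using integrable_kernel[of B "\<lambda>_. 1", OF _ test_fun_bump[OF assms(1)]] by simp
qed

lemma integral_bump_le:
  assumes "e > 0" "B \<in> lmeasurable"
  shows "(\<integral>z. bump e (z - y) \<partial>lebesgue_on B) \<le> bump_mass e"
proof -
  have "ennreal (\<integral>z. bump e (z - y) \<partial>lebesgue_on B) = (\<integral>\<^sup>+z. ennreal (bump e (z - y)) \<partial>lebesgue_on B)"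
    using nn_integral_eq_integral[OF integrable_bump_on[OF assms]] by (simp add: bump_nonneg)
  also have "\<dots> \<le> (\<integral>\<^sup>+z. ennreal (bump e (z - y)) \<partial>lebesgue)"
    using assms(2) by (subst nn_integral_restrict_space) (auto simp: indicator_def intro!: nn_integral_mono)
  also have "\<dots> = ennreal (bump_mass e)"
    using nn_integral_bump_shifted[OF assms(1), of 1 "- y"] by (simp add: nn_integral_completion)
  finally show ?thesis using bump_mass_pos[OF assms(1)] by simp
qed

text \<open>The full mass is seen when the support of the shifted kernel stays inside
  \<open>B\<close>; in general \<open>integral_bump_le\<close> gives the inequality.\<close>

lemma integral_bump_eq:
  assumes "e > 0" "B \<in> lmeasurable" "ball y e \<subseteq> B"
  shows "(\<integral>z. bump e (z - y) \<partial>lebesgue_on B) = bump_mass e"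
proof -
  have "ennreal (\<integral>z. bump e (z - y) \<partial>lebesgue_on B) = (\<integral>\<^sup>+z. ennreal (bump e (z - y)) \<partial>lebesgue_on B)"
    using nn_integral_eq_integral[OF integrable_bump_on[OF assms(1,2)]] by (simp add: bump_nonneg)
  also have "\<dots> = (\<integral>\<^sup>+z. ennreal (bump e (z - y)) \<partial>lebesgue)"
  proof -
    have "bump e (z - y) = 0" if "z \<notin> B" for z
      using that assms(3) by (intro bump_eq_0 assms(1)) (auto simp: dist_norm norm_minus_commute not_less[symmetric])
    then show ?thesis
      using assms(2) by (subst nn_integral_restrict_space) (auto simp: indicator_def intro!: nn_integral_cong)
  qed
  also have "\<dots> = ennreal (bump_mass e)"
    using nn_integral_bump_shifted[OF assms(1), of 1 "- y"] by (simp add: nn_integral_completion)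
  finally show ?thesis using bump_mass_pos[OF assms(1)] 
    by (simp add: bump_nonneg integral_nonneg_AE)
qed

text \<open>Schur test for the kernel \<open>bump e (z - (s x + c))\<close>.\<close>

lemma mollify_L2_bound:
  assumes S: "S \<in> lmeasurable" and B: "B \<in> lmeasurable" and G: "L2 B G" and e: "e > 0" and s: "s > 0"
  shows "(\<integral>\<^sup>+x. ennreal ((mollify B e s c G x)\<^sup>2) \<partial>lebesgue_on S)
      \<le> ennreal ((1 / s ^ 3) * (\<integral>z. (G z)\<^sup>2 \<partial>lebesgue_on B))"
proof -
  interpret fS: finite_measure "lebesgue_on S" using S by (rule finite_measure_lebesgue_on)
  interpret fB: finite_measure "lebesgue_on B" using B by (rule finite_measure_lebesgue_on)
  interpret pair_sigma_finite "lebesgue_on S" "lebesgue_on B" ..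
  define m where "m = bump_mass e"
  have m: "m > 0" unfolding m_def by (rule bump_mass_pos[OF e])
  define k where "k x z = bump e (z - (s *\<^sub>R x + c))" for x z
  have k0: "0 \<le> k x z" "k x z \<le> 1" for x z by (auto simp: k_def bump_nonneg bump_le_1)
  have kz[measurable]: "k x \<in> borel_measurable (lebesgue_on B)" for x
    unfolding k_def by (intro borel_measurable_lebesgue_on) measurable
  have Gm[measurable]: "G \<in> borel_measurable (lebesgue_on B)" using G by (simp add: L2_def)
  have G2k: "integrable (lebesgue_on B) (\<lambda>z. (G z)\<^sup>2 * k x z)" for x
    unfolding k_def by (rule integrable_kernel[OF L2_sq_integrable[OF G] test_fun_bump[OF e]])
  have cs: "(kernel_integral B (bump e) s c G x)\<^sup>2 \<le> m * (\<integral>z. (G z)\<^sup>2 * k x z \<partial>lebesgue_on B)" for x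
  proof -
    \<comment> \<open>The square root of the kernel goes to each Cauchy-Schwarz factor, so that the
      factor without \<open>G\<close> integrates to at most the mass \<open>m\<close>.\<close>
    have a: "L2 B (\<lambda>z. G z * sqrt (k x z))"
      unfolding L2_def using G2k k0 by (auto simp: power_mult_distrib)
    have b: "L2 B (\<lambda>z. sqrt (k x z))"
      unfolding L2_def using integrable_bump_on[OF e B] k0 by (auto simp: k_def)
    have "(kernel_integral B (bump e) s c G x)\<^sup>2 = (\<integral>z. (G z * sqrt (k x z)) * sqrt (k x z) \<partial>lebesgue_on B)\<^sup>2"
      unfolding kernel_integral_def k_def[symmetric] using k0 by (simp add: mult.assoc)
    also have "\<dots> \<le> (\<integral>z. (G z * sqrt (k x z))\<^sup>2 \<partial>lebesgue_on B) * (\<integral>z. (sqrt (k x z))\<^sup>2 \<partial>lebesgue_on B)"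
      by (rule L2_Cauchy_Schwarz[OF a b])
    also have "\<dots> = (\<integral>z. (G z)\<^sup>2 * k x z \<partial>lebesgue_on B) * (\<integral>z. k x z \<partial>lebesgue_on B)"
      using k0 by (simp add: power_mult_distrib)
    also have "\<dots> \<le> (\<integral>z. (G z)\<^sup>2 * k x z \<partial>lebesgue_on B) * m"
      unfolding m_def using integral_bump_le[OF e B] k0
      by (intro mult_left_mono integral_nonneg_AE) (auto simp: k_def)
    finally show ?thesis by (simp add: mult.commute)
  qed
  have le: "ennreal ((mollify B e s c G x)\<^sup>2) \<le> ennreal (1 / m) * (\<integral>\<^sup>+z. ennreal ((G z)\<^sup>2) * ennreal (k x z) \<partial>lebesgue_on B)" for x
  proof -
    have "(mollify B e s c G x)\<^sup>2 = (1 / m)\<^sup>2 * (kernel_integral B (bump e) s c G x)\<^sup>2"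
      by (simp add: mollify_def m_def power_divide)
    also have "\<dots> \<le> (1 / m)\<^sup>2 * (m * (\<integral>z. (G z)\<^sup>2 * k x z \<partial>lebesgue_on B))"
      by (rule mult_left_mono[OF cs]) simp
    also have "\<dots> = (1 / m) * (\<integral>z. (G z)\<^sup>2 * k x z \<partial>lebesgue_on B)"
      using m by (simp add: power2_eq_square)
    finally have "ennreal ((mollify B e s c G x)\<^sup>2) \<le> ennreal ((1 / m) * (\<integral>z. (G z)\<^sup>2 * k x z \<partial>lebesgue_on B))"
      by (rule ennreal_leI)
    also have "\<dots> = ennreal (1 / m) * ennreal (\<integral>z. (G z)\<^sup>2 * k x z \<partial>lebesgue_on B)"
      using m k0 by (intro ennreal_mult integral_nonneg_AE) auto
    also have "ennreal (\<integral>z. (G z)\<^sup>2 * k x z \<partial>lebesgue_on B) = (\<integral>\<^sup>+z. ennreal ((G z)\<^sup>2 * k x z) \<partial>lebesgue_on B)"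
      using k0 by (intro nn_integral_eq_integral[symmetric] G2k) auto
    also have "\<dots> = (\<integral>\<^sup>+z. ennreal ((G z)\<^sup>2) * ennreal (k x z) \<partial>lebesgue_on B)"
      using k0 by (simp add: ennreal_mult)
    finally show ?thesis .
  qed
  have idm: "(\<lambda>x::R3. x) \<in> borel_measurable (lebesgue_on U)" for U
    by (intro measurable_restrict_space1 measurable_completion) simp
  have [measurable]: "fst \<in> borel_measurable (lebesgue_on S \<Otimes>\<^sub>M lebesgue_on B)"
    "snd \<in> borel_measurable (lebesgue_on S \<Otimes>\<^sub>M lebesgue_on B)"
    using measurable_compose[OF measurable_fst idm] measurable_compose[OF measurable_snd idm] by auto
  have [measurable]: "(\<lambda>p. k (fst p) (snd p)) \<in> borel_measurable (lebesgue_on S \<Otimes>\<^sub>M lebesgue_on B)"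
    unfolding k_def by measurable
  have [measurable]: "(\<lambda>p. G (snd p)) \<in> borel_measurable (lebesgue_on S \<Otimes>\<^sub>M lebesgue_on B)"
    by (rule measurable_compose[OF measurable_snd Gm])
  have kx[measurable]: "(\<lambda>x. k x z) \<in> borel_measurable (lebesgue_on S)" for z
    unfolding k_def by (intro borel_measurable_lebesgue_on) measurable
  \<comment> \<open>In the variable \<open>x\<close> the kernel is dilated by \<open>- s\<close>;
    the change of variables costs \<open>1 / s^3\<close>, which is the constant of the
    lemma.\<close>
  have kxint: "(\<integral>\<^sup>+x. ennreal (k x z) \<partial>lebesgue_on S) \<le> ennreal (m / s ^ 3)" for z
  proof -
    have "(\<integral>\<^sup>+x. ennreal (k x z) \<partial>lebesgue_on S) \<le> (\<integral>\<^sup>+x. ennreal (k x z) \<partial>lebesgue)"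
      using S by (subst nn_integral_restrict_space) (auto simp: indicator_def intro!: nn_integral_mono)
    also have "\<dots> = (\<integral>\<^sup>+x. ennreal (bump e ((z - c) + (- s) *\<^sub>R x)) \<partial>lborel)"
      unfolding k_def nn_integral_completion by (simp add: algebra_simps)
    also have "\<dots> = ennreal (m / s ^ 3)"
      using nn_integral_bump_shifted[OF e, of "- s" "z - c"] s by (simp add: m_def)
    finally show ?thesis .
  qed
  have "(\<integral>\<^sup>+x. ennreal ((mollify B e s c G x)\<^sup>2) \<partial>lebesgue_on S)
      \<le> (\<integral>\<^sup>+x. ennreal (1 / m) * (\<integral>\<^sup>+z. ennreal ((G z)\<^sup>2) * ennreal (k x z) \<partial>lebesgue_on B) \<partial>lebesgue_on S)"
    by (intro nn_integral_mono le)
  also have "\<dots> = ennreal (1 / m) * (\<integral>\<^sup>+x. (\<integral>\<^sup>+z. ennreal ((G z)\<^sup>2) * ennreal (k x z) \<partial>lebesgue_on B) \<partial>lebesgue_on S)"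
    by (rule nn_integral_cmult) (rule fB.borel_measurable_nn_integral, simp add: split_beta')
  also have "(\<integral>\<^sup>+x. (\<integral>\<^sup>+z. ennreal ((G z)\<^sup>2) * ennreal (k x z) \<partial>lebesgue_on B) \<partial>lebesgue_on S)
     = (\<integral>\<^sup>+z. (\<integral>\<^sup>+x. ennreal ((G z)\<^sup>2) * ennreal (k x z) \<partial>lebesgue_on S) \<partial>lebesgue_on B)"
    by (rule Fubini'[symmetric]) (simp add: split_beta')
  also have "\<dots> = (\<integral>\<^sup>+z. ennreal ((G z)\<^sup>2) * (\<integral>\<^sup>+x. ennreal (k x z) \<partial>lebesgue_on S) \<partial>lebesgue_on B)"
    by (intro nn_integral_cong nn_integral_cmult) simp
  also have "\<dots> \<le> (\<integral>\<^sup>+z. ennreal ((G z)\<^sup>2) * ennreal (m / s ^ 3) \<partial>lebesgue_on B)"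
    by (intro nn_integral_mono mult_left_mono kxint) auto
  also have "\<dots> = (\<integral>\<^sup>+z. ennreal ((G z)\<^sup>2) \<partial>lebesgue_on B) * ennreal (m / s ^ 3)"
    by (rule nn_integral_multc) simp
  also have "(\<integral>\<^sup>+z. ennreal ((G z)\<^sup>2) \<partial>lebesgue_on B) = ennreal (\<integral>z. (G z)\<^sup>2 \<partial>lebesgue_on B)"
    by (intro nn_integral_eq_integral L2_sq_integrable[OF G]) auto
  also have "ennreal (1 / m) * (ennreal (\<integral>z. (G z)\<^sup>2 \<partial>lebesgue_on B) * ennreal (m / s ^ 3))
     = ennreal ((1 / s ^ 3) * (\<integral>z. (G z)\<^sup>2 \<partial>lebesgue_on B))"
    using m s by (simp add: ennreal_mult[symmetric] integral_nonneg_AE)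
  finally show ?thesis by (simp add: mult_left_mono)
qed

text \<open>Truncation at height \<open>k\<close> makes \<open>G\<close> bounded. \<open>G\<close>
  is also an almost everywhere limit of continuous functions, and truncating these at the same
  height lets a constant dominate. Each error is below \<open>d/4\<close>, as squaring a sum of two
  costs a factor 2.\<close>

lemma L2_approx_continuous:
  assumes G: "L2 B G" and B: "B \<in> lmeasurable" and d: "d > 0"
  obtains g where "continuous_on UNIV g" "L2 B g" "(\<integral>x. (G x - g x)\<^sup>2 \<partial>lebesgue_on B) < d"
proof -
  interpret finite_measure "lebesgue_on B" using B by (rule finite_measure_lebesgue_on)
  define tr where "tr k y = max (- real k) (min (real k) y)" for k :: nat and y :: real
  have trb: "\<bar>tr k y\<bar> \<le> real k" for k y by (auto simp: tr_def)
  have tr_le: "\<bar>y - tr k y\<bar> \<le> \<bar>y\<bar>" for k y by (auto simp: tr_def max_def min_def)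
  have trc: "continuous_on UNIV (tr k)" for k unfolding tr_def by (intro continuous_intros)
  have trm: "tr k \<in> borel_measurable borel" for k using trc by (rule borel_measurable_continuous_onI)
  have Gm: "G \<in> borel_measurable (lebesgue_on B)" using G by (simp add: L2_def)
  have tGm: "(\<lambda>x. tr k (G x)) \<in> borel_measurable (lebesgue_on B)" for k
    by (rule measurable_compose[OF Gm trm])
  have tL: "L2 B (\<lambda>x. tr k (G x))" for k by (rule L2_bounded[OF tGm B]) (rule trb)
  have "(\<lambda>k. \<integral>x. (G x - tr k (G x))\<^sup>2 \<partial>lebesgue_on B) \<longlonglongrightarrow> (\<integral>x. 0 \<partial>lebesgue_on B)"
  proof (rule integral_dominated_convergence[where w = "\<lambda>x. (G x)\<^sup>2"])
    show "AE x in lebesgue_on B. (\<lambda>k. (G x - tr k (G x))\<^sup>2) \<longlonglongrightarrow> 0"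
    proof (rule AE_I2)
      fix x
      obtain N :: nat where N: "\<bar>G x\<bar> \<le> real N" using real_arch_simple by blast
      have "\<forall>\<^sub>F k in sequentially. (G x - tr k (G x))\<^sup>2 = 0"
        using eventually_ge_at_top[of N]
      proof eventually_elim
        case (elim k)
        then have "real N \<le> real k" by simp
        then have "tr k (G x) = G x" using N by (auto simp: tr_def max_def min_def)
        then show ?case by simp
      qed
      then show "(\<lambda>k. (G x - tr k (G x))\<^sup>2) \<longlonglongrightarrow> 0" by (rule tendsto_eventually)
    qed
    show "AE x in lebesgue_on B. norm ((G x - tr k (G x))\<^sup>2) \<le> (G x)\<^sup>2" for k
      using tr_le by (auto simp: abs_le_square_iff)
  qed (use Gm tGm L2_sq_integrable[OF G] in auto)
  then have "\<forall>\<^sub>F k in sequentially. (\<integral>x. (G x - tr k (G x))\<^sup>2 \<partial>lebesgue_on B) < d / 4"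
    by (rule order_tendstoD(2)) (use d in simp)
  then obtain k where k: "(\<integral>x. (G x - tr k (G x))\<^sup>2 \<partial>lebesgue_on B) < d / 4"
    by (auto simp: eventually_sequentially)
  have "G measurable_on B" using Gm B by (simp add: measurable_on_iff_borel_measurable fmeasurableD)
  then obtain N g where N: "negligible N" and gc: "\<And>n. continuous_on UNIV (g n :: R3 \<Rightarrow> real)"
    and gl: "\<And>x. x \<notin> N \<Longrightarrow> (\<lambda>n. g n x) \<longlonglongrightarrow> (if x \<in> B then G x else 0)"
    unfolding measurable_on_def by blast
  have tgc: "continuous_on UNIV (\<lambda>x. tr k (g n x))" for n
    using continuous_on_compose2[OF trc gc] by auto
  have tgm: "(\<lambda>x. tr k (g n x)) \<in> borel_measurable (lebesgue_on B)" for n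
    by (rule continuous_measurable_lebesgue_on[OF tgc])
  have tgL: "L2 B (\<lambda>x. tr k (g n x))" for n by (rule L2_bounded[OF tgm B]) (rule trb)
  have "(\<lambda>n. \<integral>x. (tr k (G x) - tr k (g n x))\<^sup>2 \<partial>lebesgue_on B) \<longlonglongrightarrow> (\<integral>x. 0 \<partial>lebesgue_on B)"
  proof (rule integral_dominated_convergence[where w = "\<lambda>x. (2 * real k)\<^sup>2"])
    have "AE x in lebesgue. x \<notin> N" using N by (simp add: AE_not_in negligible_iff_null_sets)
    then have "AE x in lebesgue_on B. x \<notin> N"
      using B by (subst AE_restrict_space_iff) (auto simp: fmeasurableD)
    then have "AE x in lebesgue_on B. x \<notin> N \<and> x \<in> B" using AE_space[of "lebesgue_on B"] by auto
    then show "AE x in lebesgue_on B. (\<lambda>n. (tr k (G x) - tr k (g n x))\<^sup>2) \<longlonglongrightarrow> 0"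
    proof eventually_elim
      case (elim x)
      then have "(\<lambda>n. g n x) \<longlonglongrightarrow> G x" using gl[of x] by simp
      then have "(\<lambda>n. tr k (g n x)) \<longlonglongrightarrow> tr k (G x)"
        using trc continuous_on_tendsto_compose[OF trc] by simp
      then have "(\<lambda>n. (tr k (G x) - tr k (g n x))\<^sup>2) \<longlonglongrightarrow> (tr k (G x) - tr k (G x))\<^sup>2"
        by (intro tendsto_power tendsto_diff tendsto_const)
      then show ?case by simp
    qed
    have "\<bar>tr k (G x) - tr k (g n x)\<bar> \<le> \<bar>2 * real k\<bar>" for n x
      using trb[of k "G x"] trb[of k "g n x"] by linarith
    then have "(tr k (G x) - tr k (g n x))\<^sup>2 \<le> (2 * real k)\<^sup>2" for n x
      unfolding abs_le_square_iff .
    then show "AE x in lebesgue_on B. norm ((tr k (G x) - tr k (g n x))\<^sup>2) \<le> (2 * real k)\<^sup>2" for n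
      by (intro AE_I2) (simp only: real_norm_def abs_power2)
  qed (use tGm tgm in auto)
  then have "\<forall>\<^sub>F n in sequentially. (\<integral>x. (tr k (G x) - tr k (g n x))\<^sup>2 \<partial>lebesgue_on B) < d / 4"
    by (rule order_tendstoD(2)) (use d in simp)
  then obtain n where n: "(\<integral>x. (tr k (G x) - tr k (g n x))\<^sup>2 \<partial>lebesgue_on B) < d / 4"
    by (auto simp: eventually_sequentially)
  have "(\<integral>x. (G x - tr k (g n x))\<^sup>2 \<partial>lebesgue_on B)
     = (\<integral>x. ((G x - tr k (G x)) + (tr k (G x) - tr k (g n x)))\<^sup>2 \<partial>lebesgue_on B)" by simp
  also have "\<dots> \<le> 2 * (\<integral>x. (G x - tr k (G x))\<^sup>2 \<partial>lebesgue_on B) + 2 * (\<integral>x. (tr k (G x) - tr k (g n x))\<^sup>2 \<partial>lebesgue_on B)"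
    by (rule integral_power2_add_le[OF L2_diff[OF G tL] L2_diff[OF tL tgL]])
  also have "\<dots> < d" using k n by linarith
  finally show ?thesis using that tgc tgL by blast
qed

lemma kernel_integral_diff:
  assumes "integrable (lebesgue_on B) G" "integrable (lebesgue_on B) H" "test_fun UNIV f"
  shows "kernel_integral B f s c (\<lambda>z. G z - H z) x = kernel_integral B f s c G x - kernel_integral B f s c H x"
  unfolding kernel_integral_def using integrable_kernel[OF assms(1,3)] integrable_kernel[OF assms(2,3)]
  by (simp add: left_diff_distrib)

lemma mollify_diff:
  assumes "integrable (lebesgue_on B) G" "integrable (lebesgue_on B) H" "e > 0"
  shows "mollify B e s c (\<lambda>z. G z - H z) x = mollify B e s c G x - mollify B e s c H x"
  unfolding mollify_def kernel_integral_diff[OF assms(1,2) test_fun_bump[OF assms(3)]] by (simp add: diff_divide_distrib)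

lemma L2_mollify:
  assumes "integrable (lebesgue_on B) G" "e > 0" "bounded X" "X \<in> lmeasurable"
  shows "L2 X (mollify B e s c G)"
proof -
  have c: "continuous_on UNIV (mollify B e s c G)"
    by (rule smooth_fun_continuous[OF smooth_fun_mollify[OF assms(1,2)]])
  have "bounded (mollify B e s c G ` closure X)"
    using assms(3) continuous_on_subset[OF c subset_UNIV]
    by (intro compact_imp_bounded compact_continuous_image) auto
  then obtain K where "\<And>x. x \<in> closure X \<Longrightarrow> \<bar>mollify B e s c G x\<bar> \<le> K" by (auto simp: bounded_iff)
  then show ?thesis
    using closure_subset by (intro L2_bounded[OF continuous_measurable_lebesgue_on[OF c] assms(4), of K]) blast
qed

text \<open>The kernel has full mass over the ball, so \<open>mollify\<close> is a weighted average
  there and differs from \<open>g x\<close> by at most the oscillation \<open>t\<close>.\<close>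

lemma mollify_close:
  assumes e: "e > 0" and B: "B \<in> lmeasurable" and g: "integrable (lebesgue_on B) g"
    and sub: "ball (s *\<^sub>R x + c) e \<subseteq> B"
    and t: "\<And>z. z \<in> ball (s *\<^sub>R x + c) e \<Longrightarrow> \<bar>g z - g x\<bar> \<le> t" "t \<ge> 0"
  shows "\<bar>mollify B e s c g x - g x\<bar> \<le> t"
proof -
  let ?y = "s *\<^sub>R x + c" and ?m = "bump_mass e"
  have m: "?m > 0" by (rule bump_mass_pos[OF e])
  have i: "integrable (lebesgue_on B) (\<lambda>z. g z * bump e (z - ?y))"
    by (rule integrable_kernel[OF g test_fun_bump[OF e]])
  note ib = integrable_bump_on[OF e B, of ?y]
  have "?m * (mollify B e s c g x - g x) = (\<integral>z. g z * bump e (z - ?y) \<partial>lebesgue_on B) - g x * (\<integral>z. bump e (z - ?y) \<partial>lebesgue_on B)"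
    using m by (simp add: mollify_def kernel_integral_def integral_bump_eq[OF e B sub] right_diff_distrib)
  also have "\<dots> = (\<integral>z. g z * bump e (z - ?y) - g x * bump e (z - ?y) \<partial>lebesgue_on B)"
    using i ib by simp
  finally have eq: "?m * (mollify B e s c g x - g x) = (\<integral>z. g z * bump e (z - ?y) - g x * bump e (z - ?y) \<partial>lebesgue_on B)" .
  have "\<bar>\<integral>z. g z * bump e (z - ?y) - g x * bump e (z - ?y) \<partial>lebesgue_on B\<bar> \<le> (\<integral>z. t * bump e (z - ?y) \<partial>lebesgue_on B)"
  proof (rule integral_abs_bound_integral)
    show "\<bar>g z * bump e (z - ?y) - g x * bump e (z - ?y)\<bar> \<le> t * bump e (z - ?y)" for z
    proof (cases "z \<in> ball ?y e")
      case True
      then show ?thesis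
        using t(1)[OF True] bump_nonneg[of e "z - ?y"]
        by (simp add: left_diff_distrib[symmetric] abs_mult mult_right_mono)
    next
      case False
      then have "bump e (z - ?y) = 0" by (intro bump_eq_0 e) (simp add: dist_norm norm_minus_commute)
      then show ?thesis by simp
    qed
  qed (use i ib in auto)
  also have "\<dots> = t * ?m" by (simp add: integral_bump_eq[OF e B sub])
  finally have "\<bar>?m * (mollify B e s c g x - g x)\<bar> \<le> t * ?m" unfolding eq .
  then have "?m * \<bar>mollify B e s c g x - g x\<bar> \<le> ?m * t" using m by (simp add: abs_mult mult.commute)
  then show ?thesis using m by simp
qed

text \<open>Density argument: mollification is uniformly bounded on L2 and converges uniformly for
  continuous functions. The bound \<open>s n \<ge> 1 / 2\<close> keeps the constant
  \<open>1 / s^3\<close> of \<open>mollify_L2_bound\<close> at most 8.\<close>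

lemma mollify_L2_tendsto:
  assumes X: "X \<in> lmeasurable" "X \<subseteq> B" and B: "B \<in> lmeasurable" "bounded B" and G: "L2 B G"
    and s: "s \<longlonglongrightarrow> 1" "\<And>n. s n \<ge> 1 / 2" and c: "c \<longlonglongrightarrow> 0" and e: "e \<longlonglongrightarrow> 0" "\<And>n. e n > 0"
    and sub: "\<And>n x. x \<in> X \<Longrightarrow> ball (s n *\<^sub>R x + c n) (e n) \<subseteq> B"
  shows "L2_tendsto X (\<lambda>n. mollify B (e n) (s n) (c n) G) G"
proof -
  have bX: "bounded X" using B(2) X(2) bounded_subset by blast
  have sX: "X \<in> sets lebesgue" and sB: "B \<in> sets lebesgue" using X B by (auto simp: fmeasurableD)
  have GX: "L2 X G" by (rule L2_subset[OF G X(2) sX sB])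
  have Gi: "integrable (lebesgue_on B) G" by (rule L2_integrable[OF G B(1)])
  let ?M = "\<lambda>n. mollify B (e n) (s n) (c n)"
  have mL: "L2 X (?M n H)" if "integrable (lebesgue_on B) H" for n H
    by (rule L2_mollify[OF that e(2) bX X(1)])
  have "(\<lambda>n. \<integral>x. (?M n G x - G x)\<^sup>2 \<partial>lebesgue_on X) \<longlonglongrightarrow> 0"
  proof (rule LIMSEQ_I)
    fix r :: real assume r: "r > 0"
    \<comment> \<open>The tolerances \<open>r/80\<close> and \<open>r/16\<close> add up to
      \<open>r/2\<close> at the end: \<open>2 (8 r/80) + 2 (2 r/16 + 2 r/80)\<close>.\<close>
    obtain g where gc: "continuous_on UNIV g" and gL: "L2 B g" and gd: "(\<integral>x. (G x - g x)\<^sup>2 \<partial>lebesgue_on B) < r / 80"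
      using L2_approx_continuous[OF G B(1), of "r / 80"] r by auto
    have gX: "L2 X g" by (rule L2_subset[OF gL X(2) sX sB])
    have gi: "integrable (lebesgue_on B) g" by (rule L2_integrable[OF gL B(1)])
    \<comment> \<open>Chosen so that \<open>t^2\<close> times the measure of \<open>X\<close> is at
      most \<open>r/16\<close>; the \<open>+ 1\<close> covers null sets \<open>X\<close>.\<close>
    define t where "t = sqrt (r / (16 * (measure lebesgue X + 1)))"
    have pos: "measure lebesgue X + 1 > 0" by (simp add: add_nonneg_pos)
    have t: "t > 0" unfolding t_def using r pos by simp
    have t2: "t\<^sup>2 * measure lebesgue X \<le> r / 16"
    proof -
      have "t\<^sup>2 = r / (16 * (measure lebesgue X + 1))" using r pos unfolding t_def by simp
      then have "t\<^sup>2 * measure lebesgue X = r / 16 * (measure lebesgue X / (measure lebesgue X + 1))" by simp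
      also have "\<dots> \<le> r / 16 * 1" using r pos by (intro mult_left_mono) auto
      finally show ?thesis by simp
    qed
    have "uniformly_continuous_on (closure B) g"
      using B(2) by (intro compact_uniformly_continuous continuous_on_subset[OF gc]) auto
    then obtain d where d: "d > 0" "\<And>x y. x \<in> closure B \<Longrightarrow> y \<in> closure B \<Longrightarrow> dist x y < d \<Longrightarrow> dist (g x) (g y) < t"
      using t unfolding uniformly_continuous_on_def by metis
    obtain R where R: "\<And>x. x \<in> X \<Longrightarrow> norm x \<le> R" using bX by (auto simp: bounded_iff)
    \<comment> \<open>This quantity bounds the distance from \<open>x\<close> to any point of the
      kernel support around \<open>s x + c\<close>.\<close>
    have "(\<lambda>n. e n + (\<bar>s n - 1\<bar> * \<bar>R\<bar> + norm (c n))) \<longlonglongrightarrow> 0 + (\<bar>1 - 1\<bar> * \<bar>R\<bar> + norm (0::R3))"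
      by (intro tendsto_add tendsto_mult tendsto_rabs tendsto_diff tendsto_norm tendsto_const s(1) c e(1))
    then have "\<forall>\<^sub>F n in sequentially. e n + (\<bar>s n - 1\<bar> * \<bar>R\<bar> + norm (c n)) < d"
      by (rule order_tendstoD(2)) (use d(1) in simp)
    then obtain N where N: "\<And>n. n \<ge> N \<Longrightarrow> e n + (\<bar>s n - 1\<bar> * \<bar>R\<bar> + norm (c n)) < d"
      by (auto simp: eventually_sequentially)
    have "norm ((\<integral>x. (?M n G x - G x)\<^sup>2 \<partial>lebesgue_on X) - 0) < r" if n: "n \<ge> N" for n
    proof -
      let ?H = "\<lambda>z. G z - g z"
      have HL: "L2 B ?H" by (rule L2_diff[OF G gL])
      have Hi: "integrable (lebesgue_on B) ?H" by (rule L2_integrable[OF HL B(1)])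
      have close: "\<bar>?M n g x - g x\<bar> \<le> t" if x: "x \<in> X" for x
      proof (rule mollify_close[OF e(2) B(1) gi sub[OF x]])
        fix z assume z: "z \<in> ball (s n *\<^sub>R x + c n) (e n)"
        have "norm (z - x) = norm ((z - (s n *\<^sub>R x + c n)) + ((s n - 1) *\<^sub>R x + c n))" by (simp add: algebra_simps)
        also have "\<dots> \<le> norm (z - (s n *\<^sub>R x + c n)) + (norm ((s n - 1) *\<^sub>R x) + norm (c n))"
          by (intro norm_triangle_le add_left_mono norm_triangle_ineq)
        also have "\<dots> \<le> e n + (\<bar>s n - 1\<bar> * \<bar>R\<bar> + norm (c n))"
          using z R[OF x] by (intro add_mono order_refl) (auto simp: dist_norm norm_minus_commute intro!: mult_left_mono)
        also have "\<dots> < d" by (rule N[OF n])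
        finally have "dist z x < d" by (simp add: dist_norm)
        moreover have "z \<in> closure B" "x \<in> closure B" using z sub[OF x] x X(2) closure_subset by blast+
        ultimately show "\<bar>g z - g x\<bar> \<le> t" using d(2)[of z x] by (simp add: dist_real_def)
      qed (use t in simp)
      have L1: "L2 X (?M n ?H)" by (rule mL[OF Hi])
      have L2': "L2 X (\<lambda>x. ?M n g x - g x)" by (rule L2_diff[OF mL[OF gi] gX])
      have L3: "L2 X (\<lambda>x. g x - G x)" by (rule L2_diff[OF gX GX])
      have I1: "(\<integral>x. (?M n ?H x)\<^sup>2 \<partial>lebesgue_on X) \<le> 8 * (r / 80)"
      proof -
        have "ennreal (\<integral>x. (?M n ?H x)\<^sup>2 \<partial>lebesgue_on X) = (\<integral>\<^sup>+x. ennreal ((?M n ?H x)\<^sup>2) \<partial>lebesgue_on X)"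
          by (intro nn_integral_eq_integral[symmetric] L2_sq_integrable[OF L1]) auto
        also have "\<dots> \<le> ennreal ((1 / s n ^ 3) * (\<integral>z. (?H z)\<^sup>2 \<partial>lebesgue_on B))"
          using s(2)[of n] by (intro mollify_L2_bound X B HL e) auto
        finally have "(\<integral>x. (?M n ?H x)\<^sup>2 \<partial>lebesgue_on X) \<le> (1 / s n ^ 3) * (\<integral>z. (?H z)\<^sup>2 \<partial>lebesgue_on B)"
          using s(2)[of n] by (subst (asm) ennreal_le_iff) (auto intro!: mult_nonneg_nonneg integral_nonneg_AE)
        also have "\<dots> \<le> 8 * (r / 80)"
        proof (rule mult_mono)
          have "(1 / 2) ^ 3 \<le> s n ^ 3" using s(2)[of n] by (intro power_mono) auto
          moreover have "s n ^ 3 > 0" using s(2)[of n] by (intro zero_less_power) auto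
          ultimately show "1 / s n ^ 3 \<le> 8" by (simp add: divide_simps power_divide)
        qed (use gd in \<open>auto intro!: integral_nonneg_AE\<close>)
        finally show ?thesis .
      qed
      have I2: "(\<integral>x. (?M n g x - g x)\<^sup>2 \<partial>lebesgue_on X) \<le> r / 16"
      proof -
        have "(\<integral>x. (?M n g x - g x)\<^sup>2 \<partial>lebesgue_on X) \<le> (\<integral>x. t\<^sup>2 \<partial>lebesgue_on X)"
        proof (rule integral_mono)
          show "integrable (lebesgue_on X) (\<lambda>x. t\<^sup>2)"
            using finite_measure.integrable_const[OF finite_measure_lebesgue_on[OF X(1)]] by blast
          show "(?M n g x - g x)\<^sup>2 \<le> t\<^sup>2" if "x \<in> space (lebesgue_on X)" for x
            using close[of x] that t by (simp add: abs_le_square_iff[symmetric])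
        qed (rule L2_sq_integrable[OF L2'])
        also have "\<dots> = t\<^sup>2 * measure lebesgue X"
          using sX by (simp add: measure_restrict_space)
        finally show ?thesis using t2 by simp
      qed
      have I3: "(\<integral>x. (g x - G x)\<^sup>2 \<partial>lebesgue_on X) \<le> r / 80"
      proof -
        have "(\<integral>x. (g x - G x)\<^sup>2 \<partial>lebesgue_on X) \<le> (\<integral>x. (g x - G x)\<^sup>2 \<partial>lebesgue_on B)"
          by (intro integral_lebesgue_on_mono_set L2_sq_integrable L2_diff gL G X(2) sX sB) auto
        then show ?thesis using gd by (simp add: power2_commute)
      qed
      have "(\<integral>x. (?M n G x - G x)\<^sup>2 \<partial>lebesgue_on X)
        = (\<integral>x. (?M n ?H x + ((?M n g x - g x) + (g x - G x)))\<^sup>2 \<partial>lebesgue_on X)"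
        unfolding mollify_diff[OF Gi gi e(2)] by simp
      also have "\<dots> \<le> 2 * (\<integral>x. (?M n ?H x)\<^sup>2 \<partial>lebesgue_on X) + 2 * (\<integral>x. ((?M n g x - g x) + (g x - G x))\<^sup>2 \<partial>lebesgue_on X)"
        by (rule integral_power2_add_le[OF L1 L2_add[OF L2' L3]])
      finally have a: "(\<integral>x. (?M n G x - G x)\<^sup>2 \<partial>lebesgue_on X) \<le> \<dots>" .
      have b: "(\<integral>x. ((?M n g x - g x) + (g x - G x))\<^sup>2 \<partial>lebesgue_on X)
         \<le> 2 * (\<integral>x. (?M n g x - g x)\<^sup>2 \<partial>lebesgue_on X) + 2 * (\<integral>x. (g x - G x)\<^sup>2 \<partial>lebesgue_on X)"
        by (rule integral_power2_add_le[OF L2' L3])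
      have *: "A \<le> 2 * P + 2 * Q \<Longrightarrow> Q \<le> 2 * U + 2 * V \<Longrightarrow> P \<le> p \<Longrightarrow> U \<le> u \<Longrightarrow> V \<le> v
          \<Longrightarrow> A \<le> 2 * p + 2 * (2 * u + 2 * v)" for A P Q U V p u v :: real by argo
      have "(\<integral>x. (?M n G x - G x)\<^sup>2 \<partial>lebesgue_on X) \<le> 2 * (8 * (r / 80)) + 2 * (2 * (r / 16) + 2 * (r / 80))"
        by (rule *[OF a b I1 I2 I3])
      also have "\<dots> < r" using r by simp
      finally show ?thesis by (simp add: integral_nonneg_AE)
    qed
    then show "\<exists>N. \<forall>n\<ge>N. norm ((\<integral>x. (?M n G x - G x)\<^sup>2 \<partial>lebesgue_on X) - 0) < r" by blast
  qed
  then show ?thesis unfolding L2_tendsto_def using mL[OF Gi] GX by blast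
qed

section \<open>Weak derivatives\<close>

lemma integrable_lborel_bounded_support:
  fixes f :: "R3 \<Rightarrow> real"
  assumes "f \<in> borel_measurable borel" "\<And>x. \<bar>f x\<bar> \<le> K" "\<And>x. x \<notin> ball 0 R \<Longrightarrow> f x = 0"
  shows "integrable lborel f"
proof -
  have "integrable lborel (\<lambda>x. indicator (ball 0 R) x *\<^sub>R f x)"
    using assms(1,2) emeasure_lborel_ball_finite[of "0::R3" R]
    by (intro integrableI_bounded_set_indicator[where B = K]) auto
  moreover have "(\<lambda>x. indicator (ball 0 R) x *\<^sub>R f x) = f"
    using assms(3) by (auto simp: indicator_def fun_eq_iff)
  ultimately show ?thesis by (simp only:)
qed

lemma integral_lebesgue_on_eq_lborel:
  fixes f :: "R3 \<Rightarrow> real"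
  assumes "\<Omega> \<in> sets borel" "f \<in> borel_measurable borel" "\<And>x. x \<notin> \<Omega> \<Longrightarrow> f x = 0"
  shows "(\<integral>x. f x \<partial>lebesgue_on \<Omega>) = (\<integral>x. f x \<partial>lborel)"
proof -
  have "(\<integral>x. f x \<partial>lebesgue_on \<Omega>) = (\<integral>x. indicator \<Omega> x *\<^sub>R f x \<partial>lebesgue)"
    using assms(1) by (subst integral_restrict_space) auto
  also have "(\<lambda>x. indicator \<Omega> x *\<^sub>R f x) = f"
    using assms(3) by (auto simp: indicator_def fun_eq_iff)
  also have "(\<integral>x. f x \<partial>lebesgue) = (\<integral>x. f x \<partial>lborel)"
    using assms(2) by (intro integral_completion) simp
  finally show ?thesis .
qed

lemma lborel_integral_translation:
  fixes f :: "R3 \<Rightarrow> real"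
  assumes "f \<in> borel_measurable borel"
  shows "(\<integral>x. f (a + x) \<partial>lborel) = (\<integral>x. f x \<partial>lborel)"
  using integral_distr[of "(+) a" lborel borel f] assms by (simp add: lborel_distr_plus)

lemma directional_quotient_tendsto:
  fixes f :: "R3 \<Rightarrow> real"
  assumes "f differentiable (at x)" "t \<longlonglongrightarrow> 0" "\<And>n. t n \<noteq> 0"
  shows "(\<lambda>n. (f (x + t n *\<^sub>R axis i 1) - f x) / t n) \<longlonglongrightarrow> pd i f x"
proof -
  have "((\<lambda>s. f (x + s *\<^sub>R axis i 1)) has_derivative (\<lambda>s. frechet_derivative f (at x) (s *\<^sub>R axis i 1))) (at (0::real))"
  proof (rule has_derivative_compose[where f = "\<lambda>s. x + s *\<^sub>R axis i 1" and f' = "\<lambda>s. s *\<^sub>R axis i 1"])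
    show "((\<lambda>s. x + s *\<^sub>R axis i 1) has_derivative (\<lambda>s. s *\<^sub>R axis i 1)) (at (0::real))"
      by (auto intro!: derivative_eq_intros)
    show "(f has_derivative frechet_derivative f (at x)) (at (x + 0 *\<^sub>R axis i 1))"
      using assms(1) by (simp add: frechet_derivative_works)
  qed
  moreover have "(\<lambda>s. frechet_derivative f (at x) (s *\<^sub>R axis i 1)) = (*) (pd i f x)"
    using linear_scale[OF linear_frechet_derivative[OF assms(1)]] by (auto simp: pd_def fun_eq_iff mult.commute)
  ultimately have "((\<lambda>s. f (x + s *\<^sub>R axis i 1)) has_field_derivative pd i f x) (at 0)"
    unfolding has_field_derivative_def by simp
  then have l: "((\<lambda>s. (f (x + s *\<^sub>R axis i 1) - f x) / s) \<longlongrightarrow> pd i f x) (at 0)"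
    unfolding has_field_derivative_iff by simp
  have "filterlim t (at 0) sequentially" using assms(2,3) by (auto simp: filterlim_at)
  from filterlim_compose[OF l this] show ?thesis .
qed

text \<open>Integration by parts by passing to the limit in difference quotients.\<close>

lemma lipschitz_integration_by_parts:
  fixes v g :: "R3 \<Rightarrow> real"
  assumes L: "\<And>x y. \<bar>v x - v y\<bar> \<le> L * norm (x - y)" and v0: "\<And>x. x \<notin> ball 0 R \<Longrightarrow> v x = 0"
    and gm: "g \<in> borel_measurable borel"
    and gl: "AE x in lborel. (\<lambda>n. (v (x + (1 / real (Suc n)) *\<^sub>R axis i 1) - v x) / (1 / real (Suc n))) \<longlonglongrightarrow> g x"
    and \<psi>: "test_fun UNIV \<psi>"
  shows "(\<integral>x. v x * pd i \<psi> x \<partial>lborel) = - (\<integral>x. g x * \<psi> x \<partial>lborel)"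
proof -
  define h where "h n = 1 / real (Suc n)" for n
  define e :: R3 where "e = axis i 1"
  have h: "h n > 0" "h n \<le> 1" for n by (auto simp: h_def)
  have h0: "h \<longlonglongrightarrow> 0" unfolding h_def[abs_def] using LIMSEQ_inverse_real_of_nat by (simp add: inverse_eq_divide)
  have ne: "norm e = 1" by (simp add: e_def norm_axis_1)
  have L0: "L \<ge> 0" using L[of e 0] ne abs_ge_zero[of "v e - v 0"] by simp
  have vc: "continuous_on UNIV v"
    using L L0 by (intro lipschitz_on_continuous_on[of L] lipschitz_onI) (auto simp: dist_norm)
  have [measurable]: "v \<in> borel_measurable borel" by (rule borel_measurable_continuous_onI[OF vc])
  have [measurable]: "\<psi> \<in> borel_measurable borel" by (rule borel_measurable_continuous_onI[OF test_fun_continuous[OF \<psi>]])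
  have [measurable]: "pd i \<psi> \<in> borel_measurable borel"
    by (rule borel_measurable_continuous_onI[OF test_fun_continuous[OF test_fun_pd[OF \<psi>]]])
  obtain P where P: "P \<ge> 0" "\<And>x. \<bar>\<psi> x\<bar> \<le> P" using test_fun_bounded[OF \<psi>] by blast
  obtain Q where Q: "Q \<ge> 0" "\<And>x y. \<bar>\<psi> x - \<psi> y\<bar> \<le> Q * norm (x - y)" using test_fun_lipschitz[OF \<psi>] by blast
  obtain V where V: "\<And>x. \<bar>v x\<bar> \<le> V"
  proof -
    have "bounded (v ` cball 0 R)"
      by (intro compact_imp_bounded compact_continuous_image continuous_on_subset[OF vc]) auto
    then obtain V where "\<forall>y \<in> v ` cball 0 R. norm y \<le> V" unfolding bounded_iff by blast
    then have V: "\<And>x. x \<in> cball 0 R \<Longrightarrow> \<bar>v x\<bar> \<le> V" by simp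
    have "\<bar>v x\<bar> \<le> \<bar>V\<bar>" for x using V[of x] v0[of x] by (cases "x \<in> ball 0 R") auto
    then show ?thesis using that by blast
  qed
  have V0: "V \<ge> 0" using V[of 0] by linarith
  \<comment> \<open>As \<open>h n \<le> 1\<close>, the shifted function is still supported in the
    ball of radius \<open>R + 1\<close>, which carries all dominating functions.\<close>
  have vh0: "v (x + h n *\<^sub>R e) = 0" if "x \<notin> ball 0 (R + 1)" for x n
  proof (rule v0)
    have "norm x \<le> norm (x + h n *\<^sub>R e) + norm (h n *\<^sub>R e)" using norm_triangle_ineq4[of "x + h n *\<^sub>R e" "h n *\<^sub>R e"] by simp
    then show "x + h n *\<^sub>R e \<notin> ball 0 R" using that h[of n] ne by simp
  qed
  have v0': "v x = 0" if "x \<notin> ball 0 (R + 1)" for x using v0[of x] that by auto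
  have eq: "(\<integral>x. ((v (x + h n *\<^sub>R e) - v x) / h n) * \<psi> x \<partial>lborel) = (\<integral>x. v x * ((\<psi> (x + (- h n) *\<^sub>R e) - \<psi> x) / h n) \<partial>lborel)" for n
  proof -
    have i1: "integrable lborel (\<lambda>x. v (x + h n *\<^sub>R e) * \<psi> x)"
      by (rule integrable_lborel_bounded_support[of _ "V * P" "R + 1"])
        (use V P V0 vh0 in \<open>auto simp: abs_mult intro!: mult_mono\<close>)
    have i2: "integrable lborel (\<lambda>x. v x * \<psi> x)"
      by (rule integrable_lborel_bounded_support[of _ "V * P" "R + 1"])
        (use V P V0 v0' in \<open>auto simp: abs_mult intro!: mult_mono\<close>)
    have i3: "integrable lborel (\<lambda>x. v x * \<psi> (x + (- h n) *\<^sub>R e))"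
      by (rule integrable_lborel_bounded_support[of _ "V * P" "R + 1"])
        (use V P V0 v0' in \<open>auto simp: abs_mult intro!: mult_mono\<close>)
    \<comment> \<open>Translation invariance moves the shift from \<open>v\<close> to the test
      function and reverses its sign: discrete integration by parts.\<close>
    have tr: "(\<integral>x. v (x + h n *\<^sub>R e) * \<psi> x \<partial>lborel) = (\<integral>x. v x * \<psi> (x + (- h n) *\<^sub>R e) \<partial>lborel)"
      using lborel_integral_translation[of "\<lambda>x. v x * \<psi> (x + (- h n) *\<^sub>R e)" "h n *\<^sub>R e"] by (simp add: add.commute)
    have "(\<integral>x. ((v (x + h n *\<^sub>R e) - v x) / h n) * \<psi> x \<partial>lborel)
       = (\<integral>x. (v (x + h n *\<^sub>R e) * \<psi> x - v x * \<psi> x) / h n \<partial>lborel)"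
      by (simp add: left_diff_distrib)
    also have "\<dots> = ((\<integral>x. v x * \<psi> (x + (- h n) *\<^sub>R e) \<partial>lborel) - (\<integral>x. v x * \<psi> x \<partial>lborel)) / h n"
      using i1 i2 tr by simp
    also have "\<dots> = (\<integral>x. (v x * \<psi> (x + (- h n) *\<^sub>R e) - v x * \<psi> x) / h n \<partial>lborel)"
      using i3 i2 by simp
    also have "\<dots> = (\<integral>x. v x * ((\<psi> (x + (- h n) *\<^sub>R e) - \<psi> x) / h n) \<partial>lborel)"
      by (simp add: right_diff_distrib)
    finally show ?thesis .
  qed
  have w: "integrable lborel (\<lambda>x. K * indicator (ball (0::R3) (R + 1)) x :: real)" for K
    using emeasure_lborel_ball_finite[of "0::R3" "R + 1"] by simp
  \<comment> \<open>The Lipschitz constant bounds all quotients of \<open>v\<close>, which is why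
    almost everywhere convergence suffices.\<close>
  have l1: "(\<lambda>n. \<integral>x. ((v (x + h n *\<^sub>R e) - v x) / h n) * \<psi> x \<partial>lborel) \<longlonglongrightarrow> (\<integral>x. g x * \<psi> x \<partial>lborel)"
  proof (rule integral_dominated_convergence[where w = "\<lambda>x. L * P * indicator (ball 0 (R + 1)) x"])
    show "AE x in lborel. (\<lambda>n. ((v (x + h n *\<^sub>R e) - v x) / h n) * \<psi> x) \<longlonglongrightarrow> g x * \<psi> x"
      using gl unfolding h_def e_def by eventually_elim (rule tendsto_mult_right)
    show "AE x in lborel. norm (((v (x + h n *\<^sub>R e) - v x) / h n) * \<psi> x) \<le> L * P * indicator (ball 0 (R + 1)) x" for n
    proof (rule AE_I2)
      fix x
      have "\<bar>v (x + h n *\<^sub>R e) - v x\<bar> \<le> L * h n" using L[of "x + h n *\<^sub>R e" x] ne h[of n] by simp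
      then have "\<bar>(v (x + h n *\<^sub>R e) - v x) / h n\<bar> \<le> L" using h(1)[of n] by (simp add: abs_divide pos_divide_le_eq)
      then have "\<bar>((v (x + h n *\<^sub>R e) - v x) / h n) * \<psi> x\<bar> \<le> L * P"
        unfolding abs_mult using P L0 by (intro mult_mono) auto
      then show "norm (((v (x + h n *\<^sub>R e) - v x) / h n) * \<psi> x) \<le> L * P * indicator (ball 0 (R + 1)) x"
        using vh0[of x n] v0'[of x] by (cases "x \<in> ball 0 (R + 1)") auto
    qed
  qed (use gm w in measurable)
  have l2: "(\<lambda>n. \<integral>x. v x * ((\<psi> (x + (- h n) *\<^sub>R e) - \<psi> x) / h n) \<partial>lborel) \<longlonglongrightarrow> (\<integral>x. - (v x * pd i \<psi> x) \<partial>lborel)"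
  proof (rule integral_dominated_convergence[where w = "\<lambda>x. V * Q * indicator (ball 0 (R + 1)) x"])
    show "AE x in lborel. (\<lambda>n. v x * ((\<psi> (x + (- h n) *\<^sub>R e) - \<psi> x) / h n)) \<longlonglongrightarrow> - (v x * pd i \<psi> x)"
    proof (rule AE_I2)
      fix x
      have "(\<lambda>n. (\<psi> (x + (- h n) *\<^sub>R e) - \<psi> x) / (- h n)) \<longlonglongrightarrow> pd i \<psi> x"
        unfolding e_def
      proof (rule directional_quotient_tendsto)
        show "\<psi> differentiable (at x)" using \<psi> by (simp add: test_fun_def smooth_fun_differentiable)
        show "(\<lambda>n. - h n) \<longlonglongrightarrow> 0" using tendsto_minus[OF h0] by simp
        show "- h n \<noteq> 0" for n using h(1)[of n] by simp
      qed
      then have "(\<lambda>n. - v x * ((\<psi> (x + (- h n) *\<^sub>R e) - \<psi> x) / (- h n))) \<longlonglongrightarrow> - v x * pd i \<psi> x"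
        by (rule tendsto_mult_left)
      then show "(\<lambda>n. v x * ((\<psi> (x + (- h n) *\<^sub>R e) - \<psi> x) / h n)) \<longlonglongrightarrow> - (v x * pd i \<psi> x)"
        by simp
    qed
    show "AE x in lborel. norm (v x * ((\<psi> (x + (- h n) *\<^sub>R e) - \<psi> x) / h n)) \<le> V * Q * indicator (ball 0 (R + 1)) x" for n
    proof (rule AE_I2)
      fix x
      have "\<bar>\<psi> (x + (- h n) *\<^sub>R e) - \<psi> x\<bar> \<le> Q * h n" using Q(2)[of "x + (- h n) *\<^sub>R e" x] ne h[of n] by simp
      then have "\<bar>(\<psi> (x + (- h n) *\<^sub>R e) - \<psi> x) / h n\<bar> \<le> Q" using h(1)[of n] by (simp add: abs_divide pos_divide_le_eq)
      then have "\<bar>v x * ((\<psi> (x + (- h n) *\<^sub>R e) - \<psi> x) / h n)\<bar> \<le> V * Q"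
        unfolding abs_mult using V V0 by (intro mult_mono) auto
      then show "norm (v x * ((\<psi> (x + (- h n) *\<^sub>R e) - \<psi> x) / h n)) \<le> V * Q * indicator (ball 0 (R + 1)) x"
        using v0'[of x] by (cases "x \<in> ball 0 (R + 1)") auto
    qed
  qed (use w in measurable)
  have "(\<integral>x. g x * \<psi> x \<partial>lborel) = (\<integral>x. - (v x * pd i \<psi> x) \<partial>lborel)"
    using l1 l2 unfolding eq by (rule LIMSEQ_unique)
  then show ?thesis by simp
qed

lemma test_fun_integration_by_parts:
  assumes \<phi>: "test_fun UNIV \<phi>" and \<psi>: "test_fun UNIV \<psi>"
  shows "(\<integral>x. \<phi> x * pd i \<psi> x \<partial>lborel) = - (\<integral>x. pd i \<phi> x * \<psi> x \<partial>lborel)"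
proof -
  obtain L where "L \<ge> 0" and L: "\<And>x y. \<bar>\<phi> x - \<phi> y\<bar> \<le> L * norm (x - y)" using test_fun_lipschitz[OF \<phi>] by blast
  have "bounded (closure {x. \<phi> x \<noteq> 0})" using \<phi> by (simp add: test_fun_def bounded_closure)
  then obtain R where R: "\<And>x. x \<in> closure {x. \<phi> x \<noteq> 0} \<Longrightarrow> norm x \<le> R" by (auto simp: bounded_iff)
  have z: "\<phi> x = 0" if "x \<notin> ball 0 (R + 1)" for x
    using R[of x] that closure_subset[of "{x. \<phi> x \<noteq> 0}"] by force
  show ?thesis
  proof (rule lipschitz_integration_by_parts[OF L z _ _ \<psi>])
    show "pd i \<phi> \<in> borel_measurable borel"
      by (rule borel_measurable_continuous_onI[OF test_fun_continuous[OF test_fun_pd[OF \<phi>]]])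
    have "(\<lambda>n. 1 / real (Suc n)) \<longlonglongrightarrow> 0" using LIMSEQ_inverse_real_of_nat by (simp add: inverse_eq_divide)
    then show "AE x in lborel. (\<lambda>n. (\<phi> (x + (1 / real (Suc n)) *\<^sub>R axis i 1) - \<phi> x) / (1 / real (Suc n))) \<longlonglongrightarrow> pd i \<phi> x"
      using \<phi> by (intro AE_I2 directional_quotient_tendsto smooth_fun_differentiable) (auto simp: test_fun_def)
  qed auto
qed

lemma weak_deriv1_test_fun:
  assumes "test_fun \<Omega> \<phi>" "open \<Omega>"
  shows "weak_deriv1 \<Omega> \<phi> i (pd i \<phi>)"
  unfolding weak_deriv1_def
proof (intro allI impI)
  fix \<psi> assume \<psi>: "test_fun \<Omega> \<psi>"
  note U = test_fun_UNIV[OF assms(1)] test_fun_UNIV[OF \<psi>]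
  have [measurable]: "\<phi> \<in> borel_measurable borel" "\<psi> \<in> borel_measurable borel"
    "pd i \<phi> \<in> borel_measurable borel" "pd i \<psi> \<in> borel_measurable borel"
    by (intro borel_measurable_continuous_onI test_fun_continuous[OF U(1)] test_fun_continuous[OF U(2)]
        test_fun_continuous[OF test_fun_pd[OF U(1)]] test_fun_continuous[OF test_fun_pd[OF U(2)]])+
  have "(\<integral>x. \<phi> x * pd i \<psi> x \<partial>lebesgue_on \<Omega>) = (\<integral>x. \<phi> x * pd i \<psi> x \<partial>lborel)"
    by (rule integral_lebesgue_on_eq_lborel) (use assms test_fun_outside[OF assms(1)] in auto)
  moreover have "(\<integral>x. pd i \<phi> x * \<psi> x \<partial>lebesgue_on \<Omega>) = (\<integral>x. pd i \<phi> x * \<psi> x \<partial>lborel)"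
    by (rule integral_lebesgue_on_eq_lborel) (use assms test_fun_outside[OF \<psi>] in auto)
  ultimately show "(\<integral>x. \<phi> x * pd i \<psi> x \<partial>lebesgue_on \<Omega>) = - (\<integral>x. pd i \<phi> x * \<psi> x \<partial>lebesgue_on \<Omega>)"
    using test_fun_integration_by_parts[OF U] by simp
qed

lemma L2_test_fun: assumes "test_fun S f" "\<Omega> \<in> lmeasurable" shows "L2 \<Omega> f"
proof -
  obtain K where "\<And>x. \<bar>f x\<bar> \<le> K" using test_fun_bounded[OF assms(1)] by blast
  then show ?thesis
    using assms by (intro L2_bounded continuous_measurable_lebesgue_on test_fun_continuous) auto
qed

lemma weak_deriv1_diff:
  assumes "L2 \<Omega> f" "L2 \<Omega> f'" "L2 \<Omega> g" "L2 \<Omega> g'" "\<Omega> \<in> lmeasurable"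
    and "weak_deriv1 \<Omega> f i g" "weak_deriv1 \<Omega> f' i g'"
  shows "weak_deriv1 \<Omega> (\<lambda>x. f x - f' x) i (\<lambda>x. g x - g' x)"
  unfolding weak_deriv1_def
proof (intro allI impI)
  fix \<phi> assume t: "test_fun \<Omega> \<phi>"
  have "L2 \<Omega> \<phi>" "L2 \<Omega> (pd i \<phi>)" using L2_test_fun t test_fun_pd assms(5) by blast+
  then show "(\<integral>x. (f x - f' x) * pd i \<phi> x \<partial>lebesgue_on \<Omega>) = - (\<integral>x. (g x - g' x) * \<phi> x \<partial>lebesgue_on \<Omega>)"
    using assms t by (simp add: left_diff_distrib L2_mult_integrable weak_deriv1_def)
qed

lemma H1_wd1: assumes "H1 \<Omega> f" shows "L2 \<Omega> (wd1 \<Omega> f i)" "weak_deriv1 \<Omega> f i (wd1 \<Omega> f i)"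
  using assms someI_ex[of "\<lambda>g. L2 \<Omega> g \<and> weak_deriv1 \<Omega> f i g"] unfolding H1_def wd1_def by auto

lemma H2_wd2: assumes "H2 \<Omega> f" shows "L2 \<Omega> (wd2 \<Omega> f i j)" "weak_deriv2 \<Omega> f i j (wd2 \<Omega> f i j)"
  using assms someI_ex[of "\<lambda>g. L2 \<Omega> g \<and> weak_deriv2 \<Omega> f i j g"] unfolding H2_def wd2_def by auto

text \<open>\<open>wd2\<close> is defined by testing \<open>f\<close> with second derivatives.
  Inserting \<open>pd j \<phi>\<close> into the identity for \<open>wd1\<close> shows that it is
  also the iterated weak derivative, \<open>i\<close> then \<open>j\<close>, the form in which
  mollification consumes it.\<close>

lemma H2_wd2_weak_deriv1:
  assumes "H2 \<Omega> f" shows "weak_deriv1 \<Omega> (wd1 \<Omega> f i) j (wd2 \<Omega> f i j)"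
  unfolding weak_deriv1_def
proof (intro allI impI)
  fix \<phi> assume t: "test_fun \<Omega> \<phi>"
  have "(\<integral>x. f x * pd i (pd j \<phi>) x \<partial>lebesgue_on \<Omega>) = - (\<integral>x. wd1 \<Omega> f i x * pd j \<phi> x \<partial>lebesgue_on \<Omega>)"
    using H1_wd1(2)[of \<Omega> f i] assms test_fun_pd[OF t, of j] by (auto simp: H2_def weak_deriv1_def)
  moreover have "(\<integral>x. f x * pd i (pd j \<phi>) x \<partial>lebesgue_on \<Omega>) = (\<integral>x. wd2 \<Omega> f i j x * \<phi> x \<partial>lebesgue_on \<Omega>)"
    using H2_wd2(2)[OF assms] t by (auto simp: weak_deriv2_def)
  ultimately show "(\<integral>x. wd1 \<Omega> f i x * pd j \<phi> x \<partial>lebesgue_on \<Omega>) = - (\<integral>x. wd2 \<Omega> f i j x * \<phi> x \<partial>lebesgue_on \<Omega>)"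
    by simp
qed

section \<open>Convex domains\<close>

locale convex_domain =
  fixes \<Omega> :: "R3 set" and x0 :: R3 and r :: real
  assumes open_dom: "open \<Omega>" and bounded_dom: "bounded \<Omega>" and convex_dom: "convex \<Omega>"
    and r_pos: "r > 0" and ball_dom: "ball x0 r \<subseteq> \<Omega>"
begin

lemma lmeasurable_dom: "\<Omega> \<in> lmeasurable"
  using open_dom bounded_dom lmeasurable_open by blast

lemma sets_dom [measurable]: "\<Omega> \<in> sets lebesgue" using lmeasurable_dom by (simp add: fmeasurableD)

text \<open>The point is the convex combination of \<open>x\<close>, with weight \<open>s\<close>,
  and \<open>x0 + w / (1 - s)\<close>, which the bound on \<open>w\<close> puts into the ball; a
  segment from a closure point to an interior point is interior except possibly at the
  former.\<close>

lemma shrink_in_dom: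
  assumes "x \<in> closure \<Omega>" "0 \<le> s" "s < 1" "norm w < (1 - s) * r"
  shows "s *\<^sub>R x + (1 - s) *\<^sub>R x0 + w \<in> \<Omega>"
proof -
  let ?c = "x0 + (1 / (1 - s)) *\<^sub>R w"
  have "?c \<in> ball x0 r" using assms by (simp add: dist_norm divide_simps mult.commute)
  then have "?c \<in> interior \<Omega>" using ball_dom interior_open[OF open_dom] by auto
  then have "x - (1 - s) *\<^sub>R (x - ?c) \<in> interior \<Omega>"
    using assms by (intro mem_interior_closure_convex_shrink convex_dom) auto
  moreover have "x - (1 - s) *\<^sub>R (x - ?c) = s *\<^sub>R x + (1 - s) *\<^sub>R x0 + w"
    using assms by (simp add: algebra_simps)
  ultimately show ?thesis using interior_subset by auto
qed

text \<open>Mollification around the point contracted towards \<open>x0\<close> keeps the support of the kernel inside \<open>\<Omega>\<close>,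
  so the mollified function is smooth up to the boundary and no extension operator is needed.\<close>

definition sn :: "nat \<Rightarrow> real" where "sn n = 1 - 1 / (real n + 2)"
definition en :: "nat \<Rightarrow> real" where "en n = (1 - sn n) * r / 2"
definition cn :: "nat \<Rightarrow> R3" where "cn n = (1 - sn n) *\<^sub>R x0"
definition dom_mollify :: "nat \<Rightarrow> (R3 \<Rightarrow> real) \<Rightarrow> R3 \<Rightarrow> real" where
  "dom_mollify n = mollify \<Omega> (en n) (sn n) (cn n)"

text \<open>The offset 2 in \<open>sn\<close> gives the lower bound 1/2 already at
  \<open>n = 0\<close>; \<open>mollify_L2_tendsto\<close> asks for it.\<close>

lemma sn_bounds: "1 / 2 \<le> sn n" "sn n < 1" by (auto simp: sn_def field_simps)
lemma en_pos: "en n > 0" using sn_bounds[of n] r_pos by (simp add: en_def)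
lemma inv_tendsto: "(\<lambda>n. 1 / (real n + 2)) \<longlonglongrightarrow> 0"
  using LIMSEQ_ignore_initial_segment[OF lim_1_over_n, of 2] by (simp add: add.commute)
lemma sn_tendsto: "sn \<longlonglongrightarrow> 1"
  using tendsto_diff[OF tendsto_const inv_tendsto, of 1] by (simp add: sn_def[abs_def])
lemma en_tendsto: "en \<longlonglongrightarrow> 0"
proof -
  have "(\<lambda>n. (1 - sn n) * r / 2) \<longlonglongrightarrow> (1 - 1) * r / 2"
    by (intro tendsto_divide tendsto_mult tendsto_diff tendsto_const sn_tendsto) auto
  then show ?thesis by (simp add: en_def[abs_def])
qed
lemma cn_tendsto: "cn \<longlonglongrightarrow> 0"
proof -
  have "(\<lambda>n. (1 - sn n) *\<^sub>R x0) \<longlonglongrightarrow> (1 - 1) *\<^sub>R x0"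
    by (intro tendsto_scaleR tendsto_diff tendsto_const sn_tendsto)
  then show ?thesis by (simp add: cn_def[abs_def])
qed

lemma cball_shrunk: assumes "x \<in> closure \<Omega>" shows "cball (sn n *\<^sub>R x + cn n) (en n) \<subseteq> \<Omega>"
proof
  fix z assume z: "z \<in> cball (sn n *\<^sub>R x + cn n) (en n)"
  let ?w = "z - (sn n *\<^sub>R x + cn n)"
  have "norm ?w \<le> en n" using z by (simp add: dist_norm norm_minus_commute)
  also have "\<dots> < (1 - sn n) * r" using en_pos[of n] unfolding en_def by linarith
  finally have "sn n *\<^sub>R x + (1 - sn n) *\<^sub>R x0 + ?w \<in> \<Omega>"
    using sn_bounds[of n] by (intro shrink_in_dom assms) auto
  then show "z \<in> \<Omega>" by (simp add: cn_def)
qed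

lemma dom_mollify_tendsto: assumes "L2 \<Omega> G" shows "L2_tendsto \<Omega> (\<lambda>n. dom_mollify n G) G"
  unfolding dom_mollify_def
proof (rule mollify_L2_tendsto)
  show "ball (sn n *\<^sub>R x + cn n) (en n) \<subseteq> \<Omega>" if "x \<in> \<Omega>" for n x
    using cball_shrunk[of x n] that closure_subset ball_subset_cball by blast
qed (use assms lmeasurable_dom bounded_dom sn_tendsto sn_bounds cn_tendsto en_tendsto en_pos in auto)

lemma dom_mollify_smooth: "L2 \<Omega> G \<Longrightarrow> smooth_fun (dom_mollify n G)"
  unfolding dom_mollify_def by (intro smooth_fun_mollify L2_integrable lmeasurable_dom en_pos)

lemma test_fun_shifted_bump:
  assumes "x \<in> closure \<Omega>" shows "test_fun \<Omega> (\<lambda>z. bump (en n) (z - (sn n *\<^sub>R x + cn n)))"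
proof (rule test_funI)
  show "bump (en n) (z - (sn n *\<^sub>R x + cn n)) = 0" if "z \<notin> cball (sn n *\<^sub>R x + cn n) (en n)" for z
    using that en_pos by (intro bump_eq_0) (auto simp: dist_norm norm_minus_commute)
qed (use cball_shrunk[OF assms] in \<open>auto intro: smooth_fun_translate bump_smooth\<close>)

lemma pd_dom_mollify:
  assumes "L2 \<Omega> G" "weak_deriv1 \<Omega> G i g" "x \<in> closure \<Omega>"
  shows "pd i (dom_mollify n G) x = sn n * dom_mollify n g x"
  unfolding dom_mollify_def
  using assms test_fun_shifted_bump[OF assms(3), of n]
  by (intro pd_mollify L2_integrable lmeasurable_dom en_pos) (auto simp: weak_deriv1_def)

lemma pd_pd_dom_mollify:
  assumes "L2 \<Omega> G" "weak_deriv1 \<Omega> G i g" "L2 \<Omega> g" "weak_deriv1 \<Omega> g j g'" "x \<in> \<Omega>"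
  shows "pd j (pd i (dom_mollify n G)) x = sn n * (sn n * dom_mollify n g' x)"
proof -
  \<comment> \<open>Differentiating the first-order formula again requires it in a neighbourhood of
    \<open>x\<close>, hence \<open>x\<close> in the open domain here.\<close>
  have "pd j (pd i (dom_mollify n G)) x = pd j (\<lambda>x. sn n * dom_mollify n g x) x"
    by (rule pd_cong_open[OF open_dom assms(5)], rule pd_dom_mollify[OF assms(1,2)]) (use closure_subset in auto)
  also have "\<dots> = sn n * pd j (dom_mollify n g) x"
    by (intro pd_cmult smooth_fun_differentiable dom_mollify_smooth assms)
  also have "pd j (dom_mollify n g) x = sn n * dom_mollify n g' x"
    using assms(5) closure_subset by (intro pd_dom_mollify assms) auto
  finally show ?thesis .
qed

text \<open>Fundamental lemma of the calculus of variations: mollifying means testing with a shifted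
  bump, so all mollifications of \<open>g\<close> vanish on \<Omega> while they converge to
  \<open>g\<close>.\<close>

lemma weak_zero_AE:
  assumes g: "L2 \<Omega> g" and z: "\<And>\<phi>. test_fun \<Omega> \<phi> \<Longrightarrow> (\<integral>x. g x * \<phi> x \<partial>lebesgue_on \<Omega>) = 0"
  shows "AE x in lebesgue_on \<Omega>. g x = 0"
proof -
  have "dom_mollify n g x = 0" if "x \<in> \<Omega>" for n x
    using z[OF test_fun_shifted_bump[of x n]] that closure_subset
    by (auto simp: dom_mollify_def mollify_def kernel_integral_def)
  then have "L2_tendsto \<Omega> (\<lambda>n x. 0) g"
    by (intro L2_tendsto_cong[OF dom_mollify_tendsto[OF g]])
  from L2_tendsto_unique_AE[OF this L2_tendsto_const[OF L2_zero]] show ?thesis .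
qed

lemma weak_deriv1_unique:
  assumes "L2 \<Omega> g" "L2 \<Omega> g'" "weak_deriv1 \<Omega> f i g" "weak_deriv1 \<Omega> f i g'"
  shows "AE x in lebesgue_on \<Omega>. g x = g' x"
proof -
  have "AE x in lebesgue_on \<Omega>. g x - g' x = 0"
  proof (rule weak_zero_AE)
    show "L2 \<Omega> (\<lambda>x. g x - g' x)" by (rule L2_diff[OF assms(1,2)])
    fix \<phi> assume t: "test_fun \<Omega> \<phi>"
    have "L2 \<Omega> \<phi>" by (rule L2_test_fun[OF t lmeasurable_dom])
    moreover have "(\<integral>x. g x * \<phi> x \<partial>lebesgue_on \<Omega>) = (\<integral>x. g' x * \<phi> x \<partial>lebesgue_on \<Omega>)"
      using assms(3,4) t by (simp add: weak_deriv1_def)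
    ultimately show "(\<integral>x. (g x - g' x) * \<phi> x \<partial>lebesgue_on \<Omega>) = 0"
      using assms by (simp add: left_diff_distrib L2_mult_integrable)
  qed
  then show ?thesis by eventually_elim simp
qed

text \<open>\<open>wd1\<close> is an arbitrary choice; every concrete candidate agrees with it
  almost everywhere, which is all that integrals see.\<close>

lemma wd1_AE_eq:
  assumes "L2 \<Omega> g" "weak_deriv1 \<Omega> f i g"
  shows "L2 \<Omega> (wd1 \<Omega> f i)" "AE x in lebesgue_on \<Omega>. wd1 \<Omega> f i x = g x"
proof -
  have *: "L2 \<Omega> (wd1 \<Omega> f i) \<and> weak_deriv1 \<Omega> f i (wd1 \<Omega> f i)"
    unfolding wd1_def by (rule someI[of "\<lambda>g. L2 \<Omega> g \<and> weak_deriv1 \<Omega> f i g" g]) (use assms in auto)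
  then show "L2 \<Omega> (wd1 \<Omega> f i)" by simp
  show "AE x in lebesgue_on \<Omega>. wd1 \<Omega> f i x = g x"
    using weak_deriv1_unique * assms by blast
qed

lemma L2_norm_wd1:
  assumes "L2 \<Omega> g" "weak_deriv1 \<Omega> f i g"
  shows "(L2_norm \<Omega> (wd1 \<Omega> f i))\<^sup>2 = (\<integral>x. (g x)\<^sup>2 \<partial>lebesgue_on \<Omega>)"
  unfolding L2_norm_power2
proof (rule integral_cong_AE)
  show "AE x in lebesgue_on \<Omega>. (wd1 \<Omega> f i x)\<^sup>2 = (g x)\<^sup>2"
    using wd1_AE_eq(2)[OF assms] by eventually_elim simp
qed (use wd1_AE_eq(1)[OF assms] assms(1) in \<open>auto simp: L2_def\<close>)

text \<open>Turns the definition of \<open>H10\<close> into L2 limits. The H1 norm there involves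
  \<open>wd1\<close> of a difference, whose L2 norm is first computed from \<open>wd1\<close> of
  \<open>f\<close> and the classical derivative of the test function.\<close>

lemma H10_approx:
  assumes "H10 \<Omega> f"
  obtains \<phi> where "\<And>n. test_fun \<Omega> (\<phi> n)" "L2_tendsto \<Omega> \<phi> f" "\<And>i. L2_tendsto \<Omega> (\<lambda>n. pd i (\<phi> n)) (wd1 \<Omega> f i)"
proof -
  have H: "H1 \<Omega> f" using assms by (simp add: H10_def)
  then have fL: "L2 \<Omega> f" by (simp add: H1_def)
  have "\<exists>\<phi>. test_fun \<Omega> \<phi> \<and> H1_norm \<Omega> (\<lambda>x. f x - \<phi> x) < 1 / (real n + 2)" for n
    using assms unfolding H10_def by (meson add_nonneg_pos divide_pos_pos of_nat_0_le_iff zero_less_numeral zero_less_one)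
  then obtain \<phi> where t: "\<And>n. test_fun \<Omega> (\<phi> n)" and h: "\<And>n. H1_norm \<Omega> (\<lambda>x. f x - \<phi> n x) < 1 / (real n + 2)"
    by metis
  have \<phi>L: "L2 \<Omega> (\<phi> n)" "L2 \<Omega> (pd i (\<phi> n))" for n i
    using L2_test_fun[OF t lmeasurable_dom] L2_test_fun[OF test_fun_pd[OF t] lmeasurable_dom] by auto
  have eq: "(H1_norm \<Omega> (\<lambda>x. f x - \<phi> n x))\<^sup>2 = (\<integral>x. (f x - \<phi> n x)\<^sup>2 \<partial>lebesgue_on \<Omega>)
      + (\<Sum>i\<in>UNIV. \<integral>x. (wd1 \<Omega> f i x - pd i (\<phi> n) x)\<^sup>2 \<partial>lebesgue_on \<Omega>)" for n
  proof -
    have "(L2_norm \<Omega> (wd1 \<Omega> (\<lambda>x. f x - \<phi> n x) i))\<^sup>2 = (\<integral>x. (wd1 \<Omega> f i x - pd i (\<phi> n) x)\<^sup>2 \<partial>lebesgue_on \<Omega>)" for i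
      by (intro L2_norm_wd1 L2_diff weak_deriv1_diff H1_wd1[OF H] \<phi>L fL lmeasurable_dom weak_deriv1_test_fun t open_dom)
    then show ?thesis
      by (simp add: H1_norm_def grad_norm_sq_def add_nonneg_nonneg sum_nonneg L2_norm_power2[of _ "\<lambda>x. f x - \<phi> n x"] integral_nonneg_AE)
  qed
  have lim: "(\<lambda>n. (1 / (real n + 2))\<^sup>2) \<longlonglongrightarrow> 0"
    using tendsto_power[OF inv_tendsto, of 2] by simp
  have le: "(H1_norm \<Omega> (\<lambda>x. f x - \<phi> n x))\<^sup>2 \<le> (1 / (real n + 2))\<^sup>2" for n
    using h[of n] by (intro power_mono) (auto simp: H1_norm_def grad_norm_sq_def add_nonneg_nonneg sum_nonneg)
  have s0: "(\<Sum>i\<in>UNIV. \<integral>x. (wd1 \<Omega> f i x - pd i (\<phi> n) x)\<^sup>2 \<partial>lebesgue_on \<Omega>) \<ge> 0" for n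
    by (simp add: sum_nonneg integral_nonneg_AE)
  have a: "(\<lambda>n. \<integral>x. (\<phi> n x - f x)\<^sup>2 \<partial>lebesgue_on \<Omega>) \<longlonglongrightarrow> 0"
  proof (rule tendsto_zero_squeeze[OF _ _ lim])
    show "(\<integral>x. (\<phi> n x - f x)\<^sup>2 \<partial>lebesgue_on \<Omega>) \<le> (1 / (real n + 2))\<^sup>2" for n
      using le[of n] s0[of n] unfolding eq by (simp add: power2_commute[of "f _"])
  qed (simp add: integral_nonneg_AE)
  have b: "(\<lambda>n. \<integral>x. (pd i (\<phi> n) x - wd1 \<Omega> f i x)\<^sup>2 \<partial>lebesgue_on \<Omega>) \<longlonglongrightarrow> 0" for i
  proof (rule tendsto_zero_squeeze[OF _ _ lim])
    show "(\<integral>x. (pd i (\<phi> n) x - wd1 \<Omega> f i x)\<^sup>2 \<partial>lebesgue_on \<Omega>) \<le> (1 / (real n + 2))\<^sup>2" for n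
    proof -
      have "(\<integral>x. (wd1 \<Omega> f i x - pd i (\<phi> n) x)\<^sup>2 \<partial>lebesgue_on \<Omega>)
        \<le> (\<Sum>i\<in>UNIV. \<integral>x. (wd1 \<Omega> f i x - pd i (\<phi> n) x)\<^sup>2 \<partial>lebesgue_on \<Omega>)"
        by (rule member_le_sum[of i UNIV "\<lambda>i. \<integral>x. (wd1 \<Omega> f i x - pd i (\<phi> n) x)\<^sup>2 \<partial>lebesgue_on \<Omega>"])
          (auto simp: integral_nonneg_AE)
      moreover have "(\<integral>x. (f x - \<phi> n x)\<^sup>2 \<partial>lebesgue_on \<Omega>) \<ge> 0" by (simp add: integral_nonneg_AE)
      moreover have "A \<le> S \<Longrightarrow> 0 \<le> F \<Longrightarrow> F + S \<le> b \<Longrightarrow> A \<le> b" for A S F b :: real by argo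
      ultimately show ?thesis
        using le[of n] unfolding eq power2_commute[of "pd _ _ _"] by blast
    qed
  qed (simp add: integral_nonneg_AE)
  show ?thesis using that[of \<phi>] t a b \<phi>L fL H1_wd1[OF H] by (auto simp: L2_tendsto_def)
qed

text \<open>A function vanishing outside \<open>\<Omega>\<close> with a weak derivative on the whole space is a limit of test
  functions: compress it towards \<open>x0\<close>, then mollify.\<close>

lemma weak_deriv_against_zero_extension:
  assumes v: "continuous_on UNIV v" "\<And>x. x \<notin> \<Omega> \<Longrightarrow> v x = 0"
    and V: "V \<in> borel_measurable borel" "\<And>x. \<bar>V x\<bar> \<le> K" "\<And>x. x \<notin> \<Omega> \<Longrightarrow> V x = 0"
    and vV: "\<And>\<psi>. test_fun UNIV \<psi> \<Longrightarrow> (\<integral>x. v x * pd i \<psi> x \<partial>lborel) = - (\<integral>x. V x * \<psi> x \<partial>lborel)"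
    and w: "L2 \<Omega> w" "L2 \<Omega> g" "weak_deriv1 \<Omega> w i g"
  shows "(\<integral>x. w x * V x \<partial>lebesgue_on \<Omega>) = - (\<integral>x. g x * v x \<partial>lebesgue_on \<Omega>)"
proof -
  obtain R where R: "R > 0" "\<Omega> \<subseteq> ball x0 R"
    using bounded_dom bounded_subset_ballD[of \<Omega> x0] by blast
  \<comment> \<open>Large enough for every kernel support: since \<open>s n \<le> 3 / 2\<close>, the
    expansion keeps \<Omega> within radius \<open>2 R\<close> of \<open>x0\<close>, and
    \<open>e n < r\<close> is added.\<close>
  define B where "B = ball x0 (2 * R + r)"
  have B: "B \<in> lmeasurable" "bounded B" "\<Omega> \<subseteq> B" using R r_pos by (auto simp: B_def)
  have Bb: "B \<in> sets borel" by (simp add: B_def)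
  \<comment> \<open>Evaluating at an expanded point, \<open>s n > 1\<close>, compresses the function
    towards \<open>x0\<close>; this is opposite to \<open>sn\<close>.\<close>
  define s where "s n = 1 + 1 / (real n + 2)" for n
  define e where "e n = (s n - 1) * r / 2" for n
  define c where "c n = (1 - s n) *\<^sub>R x0" for n
  have s: "1 < s n" "s n \<le> 3 / 2" for n by (auto simp: s_def field_simps)
  have e: "e n > 0" "e n < r" for n using s[of n] r_pos by (auto simp: e_def field_simps)
  have sl: "s \<longlonglongrightarrow> 1" using tendsto_add[OF tendsto_const inv_tendsto, of 1] by (simp add: s_def[abs_def])
  have el: "e \<longlonglongrightarrow> 0"
  proof -
    have "(\<lambda>n. (s n - 1) * r / 2) \<longlonglongrightarrow> (1 - 1) * r / 2"
      by (intro tendsto_divide tendsto_mult tendsto_diff tendsto_const sl) auto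
    then show ?thesis by (simp add: e_def[abs_def])
  qed
  have cl: "c \<longlonglongrightarrow> 0"
  proof -
    have "(\<lambda>n. (1 - s n) *\<^sub>R x0) \<longlonglongrightarrow> (1 - 1) *\<^sub>R x0"
      by (intro tendsto_scaleR tendsto_diff tendsto_const sl)
    then show ?thesis by (simp add: c_def[abs_def])
  qed
  obtain K' where K': "\<And>x. \<bar>v x\<bar> \<le> K'"
  proof -
    have "bounded (v ` closure \<Omega>)"
      using bounded_dom by (intro compact_imp_bounded compact_continuous_image continuous_on_subset[OF v(1)]) auto
    then obtain K' where "\<forall>y \<in> v ` closure \<Omega>. norm y \<le> K'" unfolding bounded_iff by blast
    then have "\<bar>v x\<bar> \<le> \<bar>K'\<bar>" for x using v(2)[of x] closure_subset[of \<Omega>] by (cases "x \<in> \<Omega>") force+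
    then show ?thesis using that by blast
  qed
  have vm: "v \<in> borel_measurable borel" by (rule borel_measurable_continuous_onI[OF v(1)])
  have vL: "L2 B v" by (rule L2_bounded[OF borel_measurable_lebesgue_on[OF vm] B(1) K'])
  have VL: "L2 B V" by (rule L2_bounded[OF borel_measurable_lebesgue_on[OF V(1)] B(1) V(2)])
  have vi: "integrable (lebesgue_on B) v" by (rule L2_integrable[OF vL B(1)])
  have sub: "ball (s n *\<^sub>R x + c n) (e n) \<subseteq> B" if "x \<in> \<Omega>" for n x
  proof
    fix z assume z: "z \<in> ball (s n *\<^sub>R x + c n) (e n)"
    have "z - x0 = (z - (s n *\<^sub>R x + c n)) + s n *\<^sub>R (x - x0)" by (simp add: c_def algebra_simps)
    then have "norm (z - x0) \<le> norm (z - (s n *\<^sub>R x + c n)) + s n * norm (x - x0)"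
      using norm_triangle_ineq[of "z - (s n *\<^sub>R x + c n)" "s n *\<^sub>R (x - x0)"] s[of n]
      by (simp only: norm_scaleR)
    also have "\<dots> < r + 2 * R"
    proof (rule add_less_le_mono)
      show "norm (z - (s n *\<^sub>R x + c n)) < r" using z e[of n] by (simp add: dist_norm norm_minus_commute)
      have "norm (x - x0) \<le> R" using R(2) that by (auto simp: dist_norm norm_minus_commute)
      then show "s n * norm (x - x0) \<le> 2 * R" using s[of n] by (intro mult_mono) auto
    qed
    finally show "z \<in> B" by (simp add: B_def dist_norm norm_minus_commute)
  qed
  let ?M = "\<lambda>n. mollify B (e n) (s n) (c n)"
  have half: "1 / 2 \<le> s n" for n using s[of n] by simp
  have l1: "L2_tendsto \<Omega> (\<lambda>n. ?M n v) v"
    by (rule mollify_L2_tendsto[OF lmeasurable_dom B(3) B(1) B(2) vL sl half cl el e(1) sub])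
  have l2: "L2_tendsto \<Omega> (\<lambda>n. ?M n V) V"
    by (rule mollify_L2_tendsto[OF lmeasurable_dom B(3) B(1) B(2) VL sl half cl el e(1) sub])
  have l2': "L2_tendsto \<Omega> (\<lambda>n x. s n * ?M n V x) V"
    by (rule L2_tendsto_scaled[OF l2 sl])
  \<comment> \<open>The kernel may stick out of \<Omega> here, so the identity for \<open>v\<close>
    on the whole space is used.\<close>
  have pdM: "pd i (?M n v) x = s n * ?M n V x" for n x
  proof (rule pd_mollify[OF vi e(1)])
    let ?\<psi> = "\<lambda>z. bump (e n) (z - (s n *\<^sub>R x + c n))"
    have t: "test_fun UNIV ?\<psi>" by (rule test_fun_translate[OF test_fun_bump[OF e(1)]])
    have m: "?\<psi> \<in> borel_measurable borel" "pd i ?\<psi> \<in> borel_measurable borel"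
      by (intro borel_measurable_continuous_onI test_fun_continuous[OF t] test_fun_continuous[OF test_fun_pd[OF t]])+
    have z: "v x = 0" "V x = 0" if "x \<notin> B" for x using v(2) V(3) that B(3) by blast+
    have "(\<integral>z. v z * pd i ?\<psi> z \<partial>lebesgue_on B) = (\<integral>z. v z * pd i ?\<psi> z \<partial>lborel)"
      by (rule integral_lebesgue_on_eq_lborel[OF Bb]) (use vm m z in auto)
    moreover have "(\<integral>z. V z * ?\<psi> z \<partial>lebesgue_on B) = (\<integral>z. V z * ?\<psi> z \<partial>lborel)"
      by (rule integral_lebesgue_on_eq_lborel[OF Bb]) (use V(1) m z in auto)
    ultimately show "(\<integral>z. v z * pd i ?\<psi> z \<partial>lebesgue_on B) = - (\<integral>z. V z * ?\<psi> z \<partial>lebesgue_on B)"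
      using vV[OF t] by simp
  qed
  have tM: "test_fun \<Omega> (?M n v)" for n
  proof (rule test_funI)
    \<comment> \<open>A compact superset of the support: the closed domain contracted by
      \<open>1 / s n\<close> and thickened by \<open>e n / s n\<close>. The latter equals
      \<open>(1 - 1 / s n) * (r / 2)\<close>, half the margin of
      \<open>shrink_in_dom\<close>.\<close>
    let ?f = "\<lambda>(q, w). (1 / s n) *\<^sub>R q + (1 - 1 / s n) *\<^sub>R x0 + w"
    let ?K = "?f ` (closure \<Omega> \<times> cball 0 ((1 - 1 / s n) * (r / 2)))"
    show "smooth_fun (?M n v)" by (rule smooth_fun_mollify[OF vi e(1)])
    show "compact ?K"
      using bounded_dom unfolding split_beta' 
      by (intro compact_continuous_image compact_Times continuous_intros) auto
    show "?K \<subseteq> \<Omega>"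
    proof clarify
      fix q w :: R3 assume q: "q \<in> closure \<Omega>" and w: "w \<in> cball 0 ((1 - 1 / s n) * (r / 2))"
      have "1 - 1 / s n > 0" using s[of n] by simp
      then have "(1 - 1 / s n) * (r / 2) < (1 - 1 / s n) * r" using r_pos by (intro mult_strict_left_mono) auto
      moreover have "norm w \<le> (1 - 1 / s n) * (r / 2)" using w by simp
      ultimately have "norm w < (1 - 1 / s n) * r" by argo
      then show "(1 / s n) *\<^sub>R q + (1 - 1 / s n) *\<^sub>R x0 + w \<in> \<Omega>"
        using s[of n] by (intro shrink_in_dom q) auto
    qed
    show "?M n v x = 0" if x: "x \<notin> ?K" for x
    proof -
      have "v z * bump (e n) (z - (s n *\<^sub>R x + c n)) = 0" for z
      proof (rule ccontr)
        assume "v z * bump (e n) (z - (s n *\<^sub>R x + c n)) \<noteq> 0"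
        then have z: "z \<in> \<Omega>" and "bump (e n) (z - (s n *\<^sub>R x + c n)) \<noteq> 0" using v(2) by force+
        then have nz: "norm (z - (s n *\<^sub>R x + c n)) < e n" using bump_eq_0[OF e(1)] not_less by blast
        let ?w = "- (1 / s n) *\<^sub>R (z - (s n *\<^sub>R x + c n))"
        have "norm ?w = (1 / s n) * norm (z - (s n *\<^sub>R x + c n))" using s[of n] by simp
        also have "\<dots> \<le> (1 / s n) * e n" using nz s[of n] by (intro mult_left_mono) auto
        also have "\<dots> = (1 - 1 / s n) * (r / 2)" using s[of n] by (simp add: e_def field_simps)
        finally have "?w \<in> cball 0 ((1 - 1 / s n) * (r / 2))" by simp
        moreover have "x = (1 / s n) *\<^sub>R z + (1 - 1 / s n) *\<^sub>R x0 + ?w"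
        proof -
          have "(1 / s n) *\<^sub>R (s n *\<^sub>R x) = x" using s[of n] by simp
          moreover have "(1 / s n) *\<^sub>R c n = (1 / s n - 1) *\<^sub>R x0"
          proof -
            have "(1 / s n) * (1 - s n) = 1 / s n - 1" using s[of n] by (simp add: field_simps)
            then show ?thesis by (simp only: c_def scaleR_scaleR)
          qed
          ultimately show ?thesis by (simp add: scaleR_diff_right scaleR_add_right scaleR_diff_left)
        qed
        ultimately have "x \<in> ?K" using z closure_subset[of \<Omega>]
          by (intro image_eqI[where x = "(z, ?w)"]) auto
        then show False using x by simp
      qed
      then have "kernel_integral B (bump (e n)) (s n) (c n) v x = 0" unfolding kernel_integral_def by (simp only: integral_zero)
      then show ?thesis by (simp add: mollify_def)
    qed
  qed
  \<comment> \<open>The compressed mollification is a test function, so the weak identity of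
    \<open>w\<close> applies to it; both sides then pass to the limit.\<close>
  have "(\<integral>x. w x * pd i (?M n v) x \<partial>lebesgue_on \<Omega>) = - (\<integral>x. g x * ?M n v x \<partial>lebesgue_on \<Omega>)" for n
    using w(3) tM unfolding weak_deriv1_def by blast
  then have eqn: "(\<integral>x. (s n * ?M n V x) * w x \<partial>lebesgue_on \<Omega>) = - (\<integral>x. ?M n v x * g x \<partial>lebesgue_on \<Omega>)" for n
    unfolding pdM by (simp only: mult.commute[of "w _"] mult.commute[of "g _"])
  have "(\<lambda>n. - (\<integral>x. ?M n v x * g x \<partial>lebesgue_on \<Omega>)) \<longlonglongrightarrow> - (\<integral>x. v x * g x \<partial>lebesgue_on \<Omega>)"
    by (rule tendsto_minus[OF L2_tendsto_integral_mult[OF l1 w(2)]])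
  moreover have "(\<lambda>n. - (\<integral>x. ?M n v x * g x \<partial>lebesgue_on \<Omega>)) \<longlonglongrightarrow> (\<integral>x. V x * w x \<partial>lebesgue_on \<Omega>)"
    using L2_tendsto_integral_mult[OF l2' w(1)] unfolding eqn .
  ultimately have "(\<integral>x. V x * w x \<partial>lebesgue_on \<Omega>) = - (\<integral>x. v x * g x \<partial>lebesgue_on \<Omega>)"
    using LIMSEQ_unique by blast
  then show ?thesis by (simp only: mult.commute[of "w _"] mult.commute[of "g _"])
qed

end

section \<open>Taylor remainder\<close>

text \<open>Exchange the integrals and substitute in \<open>x\<close>: the Jacobian
  \<open>\<rho>^3\<close> of the dilation absorbs the weight. The alternative \<open>w t = 0\<close>
  admits parameters at which the dilation degenerates. Used with \<open>\<rho> = t^2\<close>,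
  \<open>w = t^6\<close> for the Taylor remainder and with \<open>\<rho> \<ge> 1\<close>,
  \<open>w = 1\<close> at the boundary.\<close>

lemma dilation_tonelli:
  fixes Q :: "R3 \<Rightarrow> ennreal" and a :: R3 and \<rho> w :: "real \<Rightarrow> real"
  assumes Q[measurable]: "Q \<in> borel_measurable borel" and S[measurable]: "S \<in> sets borel" "S' \<in> sets borel"
    and m[measurable]: "\<rho> \<in> borel_measurable borel" "w \<in> borel_measurable borel"
    and w: "\<And>t. t \<in> {0..1} \<Longrightarrow> 0 \<le> w t \<and> (w t = 0 \<or> \<rho> t > 0 \<and> w t \<le> \<rho> t ^ 3 \<and> (\<forall>x\<in>S. a + \<rho> t *\<^sub>R (x - a) \<in> S'))"
  shows "(\<integral>\<^sup>+x. indicator S x * (\<integral>\<^sup>+t. indicator {0..1} t * (ennreal (w t) * Q (a + \<rho> t *\<^sub>R (x - a))) \<partial>lborel) \<partial>lborel)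
    \<le> (\<integral>\<^sup>+x. indicator S' x * Q x \<partial>lborel)"
proof -
  have le: "indicator {0..1} t * ennreal (w t) * (\<integral>\<^sup>+x. indicator S x * Q (a + \<rho> t *\<^sub>R (x - a)) \<partial>lborel)
     \<le> indicator {0..1} t * (\<integral>\<^sup>+x. indicator S' x * Q x \<partial>lborel)" for t
  proof (cases "t \<in> {0..1} \<and> w t \<noteq> 0")
    case True
    then have t: "\<rho> t > 0" "0 \<le> w t" "w t \<le> \<rho> t ^ 3" "\<forall>x\<in>S. a + \<rho> t *\<^sub>R (x - a) \<in> S'" using w[of t] by auto
    have "ennreal (w t) * (\<integral>\<^sup>+x. indicator S x * Q (a + \<rho> t *\<^sub>R (x - a)) \<partial>lborel)
      \<le> ennreal (\<rho> t ^ 3) * (\<integral>\<^sup>+x. indicator S' (a + \<rho> t *\<^sub>R (x - a)) * Q (a + \<rho> t *\<^sub>R (x - a)) \<partial>lborel)"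
      using t by (intro mult_mono ennreal_leI nn_integral_mono) (auto simp: indicator_def)
    also have "\<dots> = (\<integral>\<^sup>+x. indicator S' x * Q x \<partial>lborel)"
      using nn_integral_lborel_dilation[of "\<lambda>x. indicator S' x * Q x" "\<rho> t" "a - \<rho> t *\<^sub>R a"] t(1)
      by (simp add: algebra_simps)
    finally show ?thesis using True by simp
  qed auto
  have "(\<integral>\<^sup>+x. indicator S x * (\<integral>\<^sup>+t. indicator {0..1} t * (ennreal (w t) * Q (a + \<rho> t *\<^sub>R (x - a))) \<partial>lborel) \<partial>lborel)
    = (\<integral>\<^sup>+x. (\<integral>\<^sup>+t. indicator {0..1} t * ennreal (w t) * (indicator S x * Q (a + \<rho> t *\<^sub>R (x - a))) \<partial>lborel) \<partial>lborel)"
    by (intro nn_integral_cong, subst nn_integral_cmult[symmetric]) (auto simp: mult_ac)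
  also have "\<dots> = (\<integral>\<^sup>+t. (\<integral>\<^sup>+x. indicator {0..1} t * ennreal (w t) * (indicator S x * Q (a + \<rho> t *\<^sub>R (x - a))) \<partial>lborel) \<partial>lborel)"
    by (rule lborel_pair.Fubini'[symmetric]) (simp add: split_beta')
  also have "\<dots> = (\<integral>\<^sup>+t. indicator {0..1} t * ennreal (w t) * (\<integral>\<^sup>+x. indicator S x * Q (a + \<rho> t *\<^sub>R (x - a)) \<partial>lborel) \<partial>lborel)"
    by (intro nn_integral_cong nn_integral_cmult) simp
  also have "\<dots> \<le> (\<integral>\<^sup>+t. indicator {0..1::real} t * (\<integral>\<^sup>+x. indicator S' x * Q x \<partial>lborel) \<partial>lborel)"
    by (intro nn_integral_mono le)
  also have "\<dots> = (\<integral>\<^sup>+x. indicator S' x * Q x \<partial>lborel)"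
    by (subst nn_integral_multc) auto
  finally show ?thesis .
qed

text \<open>Cauchy-Schwarz on the unit interval, read off from the nonnegative integral of
  \<open>(k' - m)^2\<close>, whose mixed term is \<open>- 2 m^2\<close> by the fundamental theorem
  of calculus.\<close>

lemma increment_square_le:
  fixes k k' :: "real \<Rightarrow> real"
  assumes d: "\<And>t. (k has_real_derivative k' t) (at t)" and c: "continuous_on UNIV k'"
  shows "ennreal ((k 1 - k 0)\<^sup>2) \<le> (\<integral>\<^sup>+t. indicator {0..1} t * ennreal ((k' t)\<^sup>2) \<partial>lborel)"
proof -
  define m where "m = k 1 - k 0"
  have ic: "isCont k' t" for t using c by (simp add: continuous_on_eq_continuous_at)
  have I1: "(\<integral>t. k' t * indicator {0..1} t \<partial>lborel) = m"
    unfolding m_def by (rule integral_FTC_Icc_real) (use d ic in auto)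
  have i1: "integrable lborel (\<lambda>t. k' t * indicator {0..1} t)"
    using borel_integrable_atLeastAtMost[of 0 1 k'] ic by (simp add: mult.commute[of "indicator _ _"])
  have i2: "integrable lborel (\<lambda>t. (k' t)\<^sup>2 * indicator {0..1} t)"
    using borel_integrable_atLeastAtMost[of 0 1 "\<lambda>t. (k' t)\<^sup>2"] ic by (simp add: mult.commute[of "indicator _ _"])
  have i3: "integrable lborel (\<lambda>t. indicator {0..1::real} t :: real)" by simp
  have "0 \<le> (\<integral>t. (k' t - m)\<^sup>2 * indicator {0..1} t \<partial>lborel)" by (intro integral_nonneg_AE) auto
  also have "(\<lambda>t. (k' t - m)\<^sup>2 * indicator {0..1} t)
    = (\<lambda>t. (k' t)\<^sup>2 * indicator {0..1} t - (2 * m) * (k' t * indicator {0..1} t) + m\<^sup>2 * indicator {0..1} t)"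
    by (auto simp: fun_eq_iff power2_diff indicator_def)
  also have "(\<integral>t. (k' t)\<^sup>2 * indicator {0..1} t - (2 * m) * (k' t * indicator {0..1} t) + m\<^sup>2 * indicator {0..1} t \<partial>lborel)
     = (\<integral>t. (k' t)\<^sup>2 * indicator {0..1} t \<partial>lborel) - (2 * m) * (\<integral>t. k' t * indicator {0..1} t \<partial>lborel)
       + m\<^sup>2 * (\<integral>t. indicator {0..1::real} t \<partial>lborel)"
    using i1 i2 i3 by (subst Bochner_Integration.integral_add) auto
  also have "\<dots> = (\<integral>t. (k' t)\<^sup>2 * indicator {0..1} t \<partial>lborel) - m\<^sup>2"
    unfolding I1 by (simp add: power2_eq_square)
  finally have "ennreal (m\<^sup>2) \<le> ennreal (\<integral>t. (k' t)\<^sup>2 * indicator {0..1} t \<partial>lborel)" by (intro ennreal_leI) simp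
  also have "\<dots> = (\<integral>\<^sup>+t. ennreal ((k' t)\<^sup>2 * indicator {0..1} t) \<partial>lborel)"
    by (rule nn_integral_eq_integral[symmetric, OF i2]) auto
  also have "\<dots> = (\<integral>\<^sup>+t. indicator {0..1} t * ennreal ((k' t)\<^sup>2) \<partial>lborel)"
    by (intro nn_integral_cong) (auto simp: indicator_def)
  finally show ?thesis unfolding m_def .
qed

lemma smooth_fun_along_line:
  assumes "smooth_fun u" "(g has_real_derivative g') (at t)"
  shows "((\<lambda>t. u (a + g t *\<^sub>R y)) has_real_derivative g' * (\<Sum>i\<in>UNIV. y $ i * pd i u (a + g t *\<^sub>R y))) (at t)"
proof -
  have "((\<lambda>t. a + g t *\<^sub>R y) has_derivative (\<lambda>h. (g' * h) *\<^sub>R y)) (at t)"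
    using assms(2) unfolding has_field_derivative_def by (auto intro!: derivative_eq_intros)
  moreover have "(u has_derivative (\<lambda>v. \<Sum>i\<in>UNIV. v $ i * pd i u (a + g t *\<^sub>R y))) (at (a + g t *\<^sub>R y))"
    by (rule has_derivative_pd[OF smooth_fun_differentiable[OF assms(1)]])
  ultimately have "((\<lambda>t. u (a + g t *\<^sub>R y)) has_derivative (\<lambda>h. \<Sum>i\<in>UNIV. ((g' * h) *\<^sub>R y) $ i * pd i u (a + g t *\<^sub>R y))) (at t)"
    by (rule has_derivative_compose)
  moreover have "(\<lambda>h. \<Sum>i\<in>UNIV. ((g' * h) *\<^sub>R y) $ i * pd i u (a + g t *\<^sub>R y))
     = (*) (g' * (\<Sum>i\<in>UNIV. y $ i * pd i u (a + g t *\<^sub>R y)))"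
    by (auto simp: fun_eq_iff sum_distrib_left sum_distrib_right mult_ac)
  ultimately show ?thesis unfolding has_field_derivative_def by simp
qed

lemma sum_coord_square_le:
  fixes y :: R3 shows "(\<Sum>i\<in>UNIV. y $ i * c i)\<^sup>2 \<le> (norm y)\<^sup>2 * (\<Sum>i\<in>UNIV. (c i)\<^sup>2)"
proof -
  have "(norm y)\<^sup>2 = (\<Sum>i\<in>UNIV. (y $ i)\<^sup>2)"
    by (simp add: norm_eq_sqrt_inner inner_vec_def power2_eq_square sum_nonneg)
  then show ?thesis using Cauchy_Schwarz_ineq_sum[of "\<lambda>i. y $ i" c UNIV] by simp
qed

definition hess_sq :: "(R3 \<Rightarrow> real) \<Rightarrow> R3 \<Rightarrow> real" where
  "hess_sq u y = (\<Sum>i\<in>UNIV. \<Sum>j\<in>UNIV. (pd j (pd i u) y)\<^sup>2)"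

text \<open>Nodal value and gradient are separate arguments: for an H2 function the first comes from
  the continuous representative, the second is the weak gradient. The base point of the expansion is
  the variable \<open>x\<close>; \<open>a\<close> stays fixed.\<close>

definition taylor_rem :: "R3 \<Rightarrow> real \<Rightarrow> (R3 \<Rightarrow> real) \<Rightarrow> (3 \<Rightarrow> R3 \<Rightarrow> real) \<Rightarrow> R3 \<Rightarrow> real" where
  "taylor_rem a c u D x = c - u x - (\<Sum>i\<in>UNIV. (a - x) $ i * D i x)"

text \<open>The substitution \<open>\<sigma> = t\<^sup>2\<close> in the integral remainder \<open>\<integral>\<sigma> F''(\<sigma>) d\<sigma>\<close> produces the weight \<open>t\<^sup>6\<close>, which
  cancels exactly the Jacobian of the dilation by \<open>t\<^sup>2\<close> in dimension three.\<close>

lemma taylor_rem_pointwise: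
  assumes u: "smooth_fun u"
  shows "ennreal ((taylor_rem a (u a) u (\<lambda>i. pd i u) x)\<^sup>2)
     \<le> ennreal (4 * norm (x - a) ^ 4) * (\<integral>\<^sup>+t. indicator {0..1} t * (ennreal (t ^ 6) * ennreal (hess_sq u (a + t\<^sup>2 *\<^sub>R (x - a)))) \<partial>lborel)"
proof -
  define y where "y = x - a"
  define p where "p t = a + t\<^sup>2 *\<^sub>R y" for t :: real
  define F1 where "F1 t = (\<Sum>i\<in>UNIV. y $ i * pd i u (p t))" for t
  define F2 where "F2 t = (\<Sum>i\<in>UNIV. y $ i * (\<Sum>j\<in>UNIV. y $ j * pd j (pd i u) (p t)))" for t
  \<comment> \<open>In the derivative of \<open>k\<close> the first order terms cancel and
    \<open>2 t^3 F2\<close> remains, while \<open>k 1 - k 0\<close> is the remainder; squaring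
    yields the factor 4 and the weight \<open>t^6\<close>.\<close>
  define k where "k t = t\<^sup>2 * F1 t - u (p t)" for t
  have sq: "((\<lambda>t::real. t\<^sup>2) has_real_derivative 2 * t) (at t)" for t by (auto intro!: derivative_eq_intros)
  have d0: "((\<lambda>t. u (p t)) has_real_derivative 2 * t * F1 t) (at t)" for t
    unfolding p_def F1_def by (rule smooth_fun_along_line[OF u sq])
  have d1: "(F1 has_real_derivative (\<Sum>i\<in>UNIV. y $ i * (2 * t * (\<Sum>j\<in>UNIV. y $ j * pd j (pd i u) (p t))))) (at t)" for t
    unfolding F1_def[abs_def] p_def
    by (intro DERIV_sum DERIV_cmult smooth_fun_along_line smooth_fun_pd u sq)
  have d1': "(\<Sum>i\<in>UNIV. y $ i * (2 * t * (\<Sum>j\<in>UNIV. y $ j * pd j (pd i u) (p t)))) = 2 * t * F2 t" for t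
    unfolding F2_def by (simp add: sum_distrib_left mult_ac)
  have dk: "(k has_real_derivative 2 * t ^ 3 * F2 t) (at t)" for t
  proof -
    have "(k has_real_derivative (2 * t * F1 t + (2 * t * F2 t) * t\<^sup>2) - 2 * t * F1 t) (at t)"
      unfolding k_def[abs_def] using DERIV_diff[OF DERIV_mult[OF sq d1[unfolded d1']] d0] by simp
    moreover have "(2 * t * F1 t + (2 * t * F2 t) * t\<^sup>2) - 2 * t * F1 t = 2 * t ^ 3 * F2 t"
      by (simp add: power2_eq_square power3_eq_cube)
    ultimately show ?thesis by (simp only:)
  qed
  have pc: "continuous_on UNIV p" unfolding p_def by (intro continuous_intros)
  have cf: "continuous_on UNIV (\<lambda>t. pd j (pd i u) (p t))" for i j
    using continuous_on_compose2[OF smooth_fun_continuous[OF smooth_fun_pd[OF smooth_fun_pd[OF u]]] pc] by auto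
  have kc: "continuous_on UNIV (\<lambda>t. 2 * t ^ 3 * F2 t)"
    unfolding F2_def by (intro continuous_intros cf)
  have R: "taylor_rem a (u a) u (\<lambda>i. pd i u) x = k 1 - k 0"
    by (simp add: taylor_rem_def k_def F1_def p_def y_def sum_negf[symmetric] algebra_simps sum_subtractf)
  have F2b: "(F2 t)\<^sup>2 \<le> norm y ^ 4 * hess_sq u (p t)" for t
  proof -
    have "(F2 t)\<^sup>2 \<le> (norm y)\<^sup>2 * (\<Sum>i\<in>UNIV. (\<Sum>j\<in>UNIV. y $ j * pd j (pd i u) (p t))\<^sup>2)"
      unfolding F2_def by (rule sum_coord_square_le)
    also have "\<dots> \<le> (norm y)\<^sup>2 * (\<Sum>i\<in>UNIV. (norm y)\<^sup>2 * (\<Sum>j\<in>UNIV. (pd j (pd i u) (p t))\<^sup>2))"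
      by (intro mult_left_mono sum_mono sum_coord_square_le) auto
    also have "\<dots> = norm y ^ 4 * hess_sq u (p t)"
      by (simp add: hess_sq_def sum_distrib_left power4_eq_xxxx power2_eq_square mult_ac)
    finally show ?thesis .
  qed
  have h0: "hess_sq u z \<ge> 0" for z by (simp add: hess_sq_def sum_nonneg)
  have [measurable]: "hess_sq u \<in> borel_measurable borel"
    unfolding hess_sq_def[abs_def]
    by (intro borel_measurable_continuous_onI continuous_intros smooth_fun_continuous smooth_fun_pd u)
  have "ennreal ((taylor_rem a (u a) u (\<lambda>i. pd i u) x)\<^sup>2) \<le> (\<integral>\<^sup>+t. indicator {0..1} t * ennreal ((2 * t ^ 3 * F2 t)\<^sup>2) \<partial>lborel)"
    unfolding R by (rule increment_square_le[OF dk kc])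
  also have "\<dots> \<le> (\<integral>\<^sup>+t. ennreal (4 * norm y ^ 4) * (indicator {0..1} t * (ennreal (t ^ 6) * ennreal (hess_sq u (p t)))) \<partial>lborel)"
  proof (rule nn_integral_mono)
    fix t :: real
    have "(2 * t ^ 3 * F2 t)\<^sup>2 = 4 * t ^ 6 * (F2 t)\<^sup>2" by (simp add: power_mult_distrib flip: power_mult)
    also have "\<dots> \<le> 4 * t ^ 6 * (norm y ^ 4 * hess_sq u (p t))"
      by (intro mult_left_mono F2b) (auto simp: zero_le_even_power)
    finally have "ennreal ((2 * t ^ 3 * F2 t)\<^sup>2) \<le> ennreal ((4 * norm y ^ 4) * (t ^ 6 * hess_sq u (p t)))"
      by (intro ennreal_leI) (simp add: mult_ac)
    also have "\<dots> = ennreal (4 * norm y ^ 4) * (ennreal (t ^ 6) * ennreal (hess_sq u (p t)))"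
      using h0 by (simp add: ennreal_mult zero_le_even_power)
    finally show "indicator {0..1} t * ennreal ((2 * t ^ 3 * F2 t)\<^sup>2)
      \<le> ennreal (4 * norm y ^ 4) * (indicator {0..1} t * (ennreal (t ^ 6) * ennreal (hess_sq u (p t))))"
      by (auto simp: indicator_def)
  qed
  also have "\<dots> = ennreal (4 * norm y ^ 4) * (\<integral>\<^sup>+t. indicator {0..1} t * (ennreal (t ^ 6) * ennreal (hess_sq u (p t))) \<partial>lborel)"
    unfolding p_def by (rule nn_integral_cmult) measurable
  finally show ?thesis unfolding y_def p_def .
qed

text \<open>Contractions towards a point of its closure map an open convex set into itself, so the
  Hessian is integrated over \<open>S\<close> only and the estimate can later be summed over
  elements.\<close>

lemma taylor_rem_nn_integral:
  assumes u: "smooth_fun u" and S: "open S" "convex S" "a \<in> closure S" and d: "\<And>x. x \<in> S \<Longrightarrow> norm (x - a) \<le> d"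
  shows "(\<integral>\<^sup>+x. ennreal ((taylor_rem a (u a) u (\<lambda>i. pd i u) x)\<^sup>2) \<partial>lebesgue_on S)
    \<le> ennreal (4 * d ^ 4) * (\<integral>\<^sup>+x. ennreal (hess_sq u x) \<partial>lebesgue_on S)"
proof -
  have [measurable]: "hess_sq u \<in> borel_measurable borel"
    unfolding hess_sq_def[abs_def]
    by (intro borel_measurable_continuous_onI continuous_intros smooth_fun_continuous smooth_fun_pd u)
  have Sb[measurable]: "S \<in> sets borel" using S(1) by simp
  define I where "I x = (\<integral>\<^sup>+t. indicator {0..1} t * (ennreal (t ^ 6) * ennreal (hess_sq u (a + t\<^sup>2 *\<^sub>R (x - a)))) \<partial>lborel)" for x
  have cv: "(\<integral>\<^sup>+x. f x \<partial>lebesgue_on S) = (\<integral>\<^sup>+x. indicator S x * f x \<partial>lborel)" for f :: "R3 \<Rightarrow> ennreal"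
    using Sb by (subst nn_integral_restrict_space) (auto simp: nn_integral_completion mult.commute)
  have "(\<integral>\<^sup>+x. ennreal ((taylor_rem a (u a) u (\<lambda>i. pd i u) x)\<^sup>2) \<partial>lebesgue_on S)
     \<le> (\<integral>\<^sup>+x. ennreal (4 * d ^ 4) * (indicator S x * I x) \<partial>lborel)"
    unfolding cv
  proof (rule nn_integral_mono)
    fix x
    show "indicator S x * ennreal ((taylor_rem a (u a) u (\<lambda>i. pd i u) x)\<^sup>2) \<le> ennreal (4 * d ^ 4) * (indicator S x * I x)"
    proof (cases "x \<in> S")
      case True
      have "ennreal ((taylor_rem a (u a) u (\<lambda>i. pd i u) x)\<^sup>2) \<le> ennreal (4 * norm (x - a) ^ 4) * I x"
        unfolding I_def by (rule taylor_rem_pointwise[OF u])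
      also have "\<dots> \<le> ennreal (4 * d ^ 4) * I x"
        using d[OF True] by (intro mult_right_mono ennreal_leI mult_left_mono power_mono) auto
      finally show ?thesis using True by simp
    qed simp
  qed
  also have "\<dots> = ennreal (4 * d ^ 4) * (\<integral>\<^sup>+x. indicator S x * I x \<partial>lborel)"
    unfolding I_def by (rule nn_integral_cmult) measurable
  also have "(\<integral>\<^sup>+x. indicator S x * I x \<partial>lborel) \<le> (\<integral>\<^sup>+x. indicator S x * ennreal (hess_sq u x) \<partial>lborel)"
    unfolding I_def
  proof (rule dilation_tonelli)
    fix t :: real assume t: "t \<in> {0..1}"
    have "a + t\<^sup>2 *\<^sub>R (x - a) \<in> S" if "x \<in> S" "t \<noteq> 0" for x
    proof -
      have "t\<^sup>2 \<le> 1" using t by (simp add: power_le_one)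
      then have "a - t\<^sup>2 *\<^sub>R (a - x) \<in> interior S"
        using that t S by (intro mem_interior_closure_convex_shrink S) (auto simp: interior_open)
      then show ?thesis using interior_subset by (auto simp: algebra_simps)
    qed
    then show "0 \<le> t ^ 6 \<and> (t ^ 6 = 0 \<or> t\<^sup>2 > 0 \<and> t ^ 6 \<le> (t\<^sup>2) ^ 3 \<and> (\<forall>x\<in>S. a + t\<^sup>2 *\<^sub>R (x - a) \<in> S))"
      by (auto simp: zero_le_even_power simp flip: power_mult)
  qed measurable
  finally show ?thesis unfolding cv by (simp add: mult_left_mono)
qed

section \<open>Continuous representatives\<close>

lemma pd_diff:
  assumes "f differentiable (at x)" "g differentiable (at x)"
  shows "pd i (\<lambda>x. f x - g x) x = pd i f x - pd i g x"
proof -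
  have "((\<lambda>x. f x - g x) has_derivative (\<lambda>v. frechet_derivative f (at x) v - frechet_derivative g (at x) v)) (at x)"
    using assms by (intro has_derivative_diff) (simp_all add: frechet_derivative_works)
  from pd_eqI[OF this] show ?thesis by (simp only: pd_def)
qed

lemma smooth_fun_diff:
  assumes f: "smooth_fun f" and g: "smooth_fun g" shows "smooth_fun (\<lambda>x. f x - g x)"
proof -
  have "iter_pd is (\<lambda>x. f x - g x) = (\<lambda>x. iter_pd is f x - iter_pd is g x)" for "is"
  proof (induction "is")
    case (Cons i "is")
    show ?case unfolding iter_pd.simps Cons
      using assms by (intro ext pd_diff) (auto simp: smooth_fun_def)
  qed simp
  then show ?thesis using assms unfolding smooth_fun_def by simp
qed

lemma L2_continuous:
  assumes f: "continuous_on UNIV f" and S: "bounded S" "S \<in> lmeasurable"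
  shows "L2 S f"
proof -
  have "bounded (f ` closure S)"
    using S(1) by (intro compact_imp_bounded compact_continuous_image continuous_on_subset[OF f]) auto
  then obtain K where "\<forall>y \<in> f ` closure S. norm y \<le> K" unfolding bounded_iff by blast
  then have "\<bar>f x\<bar> \<le> K" if "x \<in> S" for x using that closure_subset[of S] by auto
  then show ?thesis by (intro L2_bounded[OF continuous_measurable_lebesgue_on[OF f] S(2)])
qed

lemma L2_tendsto_const_seq:
  assumes "c \<longlonglongrightarrow> l" "S \<in> lmeasurable" shows "L2_tendsto S (\<lambda>n x. c n) (\<lambda>x. l)"
proof -
  interpret finite_measure "lebesgue_on S" using assms(2) by (rule finite_measure_lebesgue_on)
  have "(\<lambda>n. (c n - l)\<^sup>2 * measure (lebesgue_on S) S) \<longlonglongrightarrow> (l - l)\<^sup>2 * measure (lebesgue_on S) S"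
    by (intro tendsto_mult tendsto_power tendsto_diff tendsto_const assms(1))
  then show ?thesis by (simp add: L2_tendsto_def L2_def mult.commute)
qed

lemma coord_measurable: "(\<lambda>x::R3. (a - x) $ i) \<in> borel_measurable (lebesgue_on S)"
  by (intro continuous_measurable_lebesgue_on continuous_intros)

lemma L2_taylor_rem:
  assumes S: "S \<in> lmeasurable" and u: "L2 S u" and D: "\<And>i. L2 S (D i)" and d: "\<And>x. x \<in> S \<Longrightarrow> norm (x - a) \<le> d"
  shows "L2 S (taylor_rem a c u D)"
proof -
  have "\<bar>(a - x) $ i\<bar> \<le> d" if "x \<in> S" for x i
    using component_le_norm_cart[of "a - x" i] d[OF that] by (simp add: norm_minus_commute)
  then have "L2 S (\<lambda>x. \<Sum>i\<in>UNIV. (a - x) $ i * D i x)"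
    by (intro L2_sum L2_bounded_mult[where B = d] D coord_measurable) auto
  moreover have "L2 S (\<lambda>x. c)" by (rule L2_bounded[OF _ S order_refl]) simp
  ultimately show ?thesis unfolding taylor_rem_def[abs_def] using u by (intro L2_diff)
qed

lemma L2_tendsto_taylor_rem:
  assumes S: "S \<in> lmeasurable" and c: "c \<longlonglongrightarrow> l" and u: "L2_tendsto S U u" and D: "\<And>i. L2_tendsto S (\<lambda>n. E n i) (D i)"
    and d: "\<And>x. x \<in> S \<Longrightarrow> norm (x - a) \<le> d"
  shows "L2_tendsto S (\<lambda>n. taylor_rem a (c n) (U n) (E n)) (taylor_rem a l u D)"
proof -
  have "\<bar>(a - x) $ i\<bar> \<le> d" if "x \<in> S" for x i
    using component_le_norm_cart[of "a - x" i] d[OF that] by (simp add: norm_minus_commute)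
  then have "L2_tendsto S (\<lambda>n x. \<Sum>i\<in>UNIV. (a - x) $ i * E n i x) (\<lambda>x. \<Sum>i\<in>UNIV. (a - x) $ i * D i x)"
    by (intro L2_tendsto_sum L2_tendsto_bounded_mult[where B = d] D coord_measurable) auto
  then show ?thesis unfolding taylor_rem_def[abs_def]
    by (intro L2_tendsto_diff L2_tendsto_const_seq[OF c S] u)
qed

context convex_domain
begin

lemma taylor_rem_smooth_integral:
  assumes u: "smooth_fun u" and S: "open S" "convex S" "S \<subseteq> \<Omega>" "a \<in> closure S" and d: "\<And>x. x \<in> S \<Longrightarrow> norm (x - a) \<le> d"
  shows "(\<integral>x. (taylor_rem a (u a) u (\<lambda>i. pd i u) x)\<^sup>2 \<partial>lebesgue_on S)
    \<le> 4 * d ^ 4 * (\<Sum>i\<in>UNIV. \<Sum>j\<in>UNIV. \<integral>x. (pd j (pd i u) x)\<^sup>2 \<partial>lebesgue_on S)"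
proof -
  have bS: "bounded S" using S(3) bounded_dom bounded_subset by blast
  have mS: "S \<in> lmeasurable" using bS S(1) lmeasurable_open by blast
  have L: "L2 S u" "L2 S (pd i u)" "L2 S (pd j (pd i u))" for i j
    by (intro L2_continuous smooth_fun_continuous smooth_fun_pd u bS mS)+
  have LR: "L2 S (taylor_rem a (u a) u (\<lambda>i. pd i u))" by (rule L2_taylor_rem[OF mS L(1,2) d])
  have hi: "integrable (lebesgue_on S) (hess_sq u)"
    unfolding hess_sq_def[abs_def] using L(3) by (intro Bochner_Integration.integrable_sum L2_sq_integrable)
  have hI: "(\<integral>x. hess_sq u x \<partial>lebesgue_on S) = (\<Sum>i\<in>UNIV. \<Sum>j\<in>UNIV. \<integral>x. (pd j (pd i u) x)\<^sup>2 \<partial>lebesgue_on S)"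
    unfolding hess_sq_def using L(3) by (simp add: Bochner_Integration.integral_sum L2_sq_integrable)
  have h0: "hess_sq u z \<ge> 0" for z by (simp add: hess_sq_def sum_nonneg)
  have "ennreal (\<integral>x. (taylor_rem a (u a) u (\<lambda>i. pd i u) x)\<^sup>2 \<partial>lebesgue_on S)
     = (\<integral>\<^sup>+x. ennreal ((taylor_rem a (u a) u (\<lambda>i. pd i u) x)\<^sup>2) \<partial>lebesgue_on S)"
    by (intro nn_integral_eq_integral[symmetric] L2_sq_integrable LR) auto
  also have "\<dots> \<le> ennreal (4 * d ^ 4) * (\<integral>\<^sup>+x. ennreal (hess_sq u x) \<partial>lebesgue_on S)"
    by (rule taylor_rem_nn_integral[OF u S(1,2,4) d])
  also have "(\<integral>\<^sup>+x. ennreal (hess_sq u x) \<partial>lebesgue_on S) = ennreal (\<integral>x. hess_sq u x \<partial>lebesgue_on S)"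
    by (intro nn_integral_eq_integral hi) (auto simp: h0)
  also have "ennreal (4 * d ^ 4) * ennreal (\<integral>x. hess_sq u x \<partial>lebesgue_on S) = ennreal (4 * d ^ 4 * (\<integral>x. hess_sq u x \<partial>lebesgue_on S))"
    using h0 by (intro ennreal_mult[symmetric]) (auto intro!: integral_nonneg_AE simp: zero_le_even_power)
  finally have "(\<integral>x. (taylor_rem a (u a) u (\<lambda>i. pd i u) x)\<^sup>2 \<partial>lebesgue_on S) \<le> 4 * d ^ 4 * (\<integral>x. hess_sq u x \<partial>lebesgue_on S)"
    using h0 by (subst (asm) ennreal_le_iff) (auto intro!: mult_nonneg_nonneg integral_nonneg_AE simp: zero_le_even_power)
  then show ?thesis unfolding hI .
qed

definition H2_sq_int :: "(R3 \<Rightarrow> real) \<Rightarrow> real" where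
  "H2_sq_int f = (\<integral>x. (f x)\<^sup>2 \<partial>lebesgue_on \<Omega>) + (\<Sum>i\<in>UNIV. \<integral>x. (pd i f x)\<^sup>2 \<partial>lebesgue_on \<Omega>)
     + (\<Sum>i\<in>UNIV. \<Sum>j\<in>UNIV. \<integral>x. (pd j (pd i f) x)\<^sup>2 \<partial>lebesgue_on \<Omega>)"

lemma measure_dom_pos: "measure lebesgue \<Omega> > 0"
proof -
  have "\<not> negligible \<Omega>" using open_not_negligible[OF open_dom] ball_dom r_pos centre_in_ball by blast
  then show ?thesis
    using lmeasurable_dom negligible_iff_measure by (metis measure_nonneg order_le_less)
qed

text \<open>Sobolev embedding up to the boundary: the Taylor estimate asks for \<open>a\<close> in
  the closure only, so boundary points are covered.\<close>

lemma sup_bound_smooth: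
  obtains C where "C > 0" "\<And>f a. smooth_fun f \<Longrightarrow> a \<in> closure \<Omega> \<Longrightarrow> (f a)\<^sup>2 \<le> C * H2_sq_int f"
proof -
  define d where "d = diameter \<Omega>"
  define m where "m = measure lebesgue \<Omega>"
  have m: "m > 0" unfolding m_def by (rule measure_dom_pos)
  have d0: "d \<ge> 0" unfolding d_def by (rule diameter_ge_0[OF bounded_dom])
  \<comment> \<open>The 3 comes from squaring three summands, the terms \<open>1\<close>,
    \<open>d^2\<close>, \<open>4 d^4\<close> from value, gradient and remainder, and
    \<open>m\<close> from averaging over \<Omega>.\<close>
  define C where "C = 3 * (1 + d\<^sup>2 + 4 * d ^ 4) / m"
  have "(f a)\<^sup>2 \<le> C * H2_sq_int f" if f: "smooth_fun f" and a: "a \<in> closure \<Omega>" for f a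
  proof -
    have dd: "norm (x - a) \<le> d" if "x \<in> \<Omega>" for x
      using diameter_bounded_bound[of "closure \<Omega>" x a] that a closure_subset bounded_dom
      by (auto simp: d_def dist_norm diameter_closure)
    have L: "L2 \<Omega> f" "L2 \<Omega> (pd i f)" "L2 \<Omega> (pd j (pd i f))" for i j
      by (intro L2_continuous smooth_fun_continuous smooth_fun_pd f bounded_dom lmeasurable_dom)+
    let ?R = "taylor_rem a (f a) f (\<lambda>i. pd i f)"
    have LR: "L2 \<Omega> ?R" by (rule L2_taylor_rem[OF lmeasurable_dom L(1,2) dd])
    note i = L2_sq_integrable[OF L(1)] L2_sq_integrable[OF L(2)] L2_sq_integrable[OF LR]
    define P where "P x = d\<^sup>2 * (\<Sum>i\<in>UNIV. (pd i f x)\<^sup>2)" for x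
    have iP: "integrable (lebesgue_on \<Omega>) P"
      unfolding P_def[abs_def] by (intro integrable_mult_right Bochner_Integration.integrable_sum i)
    have IP: "(\<integral>x. P x \<partial>lebesgue_on \<Omega>) = d\<^sup>2 * (\<Sum>i\<in>UNIV. \<integral>x. (pd i f x)\<^sup>2 \<partial>lebesgue_on \<Omega>)"
      unfolding P_def using i by simp
    have pt: "(f a)\<^sup>2 \<le> 3 * ((f x)\<^sup>2 + P x + (?R x)\<^sup>2)" if "x \<in> \<Omega>" for x
    proof -
      let ?q = "\<Sum>i\<in>UNIV. (a - x) $ i * pd i f x"
      have "f a = f x + ?q + ?R x" by (simp add: taylor_rem_def)
      moreover have "(\<alpha> + \<beta> + \<gamma>)\<^sup>2 \<le> 3 * (\<alpha>\<^sup>2 + \<beta>\<^sup>2 + \<gamma>\<^sup>2)" for \<alpha> \<beta> \<gamma> :: real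
        using sum_squares_bound[of \<alpha> \<beta>] sum_squares_bound[of \<alpha> \<gamma>] sum_squares_bound[of \<beta> \<gamma>]
        by (simp add: power2_eq_square algebra_simps)
      ultimately have "(f a)\<^sup>2 \<le> 3 * ((f x)\<^sup>2 + ?q\<^sup>2 + (?R x)\<^sup>2)" by metis
      moreover have "?q\<^sup>2 \<le> (norm (a - x))\<^sup>2 * (\<Sum>i\<in>UNIV. (pd i f x)\<^sup>2)" by (rule sum_coord_square_le)
      moreover have "\<dots> \<le> P x"
        unfolding P_def using dd[OF that] by (intro mult_right_mono power_mono sum_nonneg) (auto simp: norm_minus_commute)
      moreover have "F \<le> 3 * (\<alpha> + q + \<gamma>) \<Longrightarrow> q \<le> p' \<Longrightarrow> p' \<le> p \<Longrightarrow> F \<le> 3 * (\<alpha> + p + \<gamma>)" for F \<alpha> q \<gamma> p' p :: real by argo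
      ultimately show ?thesis by blast
    qed
    have "m * (f a)\<^sup>2 = (\<integral>x. (f a)\<^sup>2 \<partial>lebesgue_on \<Omega>)" by (simp add: m_def measure_restrict_space)
    also have "\<dots> \<le> (\<integral>x. 3 * ((f x)\<^sup>2 + P x + (?R x)\<^sup>2) \<partial>lebesgue_on \<Omega>)"
    proof (rule integral_mono)
      show "integrable (lebesgue_on \<Omega>) (\<lambda>x. (f a)\<^sup>2)"
        using finite_measure.integrable_const[OF finite_measure_lebesgue_on[OF lmeasurable_dom]] by blast
      show "integrable (lebesgue_on \<Omega>) (\<lambda>x. 3 * ((f x)\<^sup>2 + P x + (?R x)\<^sup>2))" using i iP by simp
      show "(f a)\<^sup>2 \<le> 3 * ((f x)\<^sup>2 + P x + (?R x)\<^sup>2)" if "x \<in> space (lebesgue_on \<Omega>)" for x using pt that by simp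
    qed
    also have "\<dots> = 3 * ((\<integral>x. (f x)\<^sup>2 \<partial>lebesgue_on \<Omega>) + (\<integral>x. P x \<partial>lebesgue_on \<Omega>) + (\<integral>x. (?R x)\<^sup>2 \<partial>lebesgue_on \<Omega>))"
      using i iP by simp
    also have "\<dots> \<le> 3 * ((1 + d\<^sup>2 + 4 * d ^ 4) * H2_sq_int f)"
    proof -
      define A1 A2 A3 where "A1 = (\<integral>x. (f x)\<^sup>2 \<partial>lebesgue_on \<Omega>)"
        and "A2 = (\<Sum>i\<in>UNIV. \<integral>x. (pd i f x)\<^sup>2 \<partial>lebesgue_on \<Omega>)"
        and "A3 = (\<Sum>i\<in>UNIV. \<Sum>j\<in>UNIV. \<integral>x. (pd j (pd i f) x)\<^sup>2 \<partial>lebesgue_on \<Omega>)"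
      have A: "A1 \<ge> 0" "A2 \<ge> 0" "A3 \<ge> 0" unfolding A1_def A2_def A3_def
        by (auto intro!: sum_nonneg integral_nonneg_AE)
      have R: "(\<integral>x. (?R x)\<^sup>2 \<partial>lebesgue_on \<Omega>) \<le> 4 * d ^ 4 * A3"
        unfolding A3_def by (rule taylor_rem_smooth_integral[OF f open_dom convex_dom order_refl a dd])
      have "A1 + d\<^sup>2 * A2 + 4 * d ^ 4 * A3 \<le> (1 + d\<^sup>2 + 4 * d ^ 4) * (A1 + A2 + A3)"
        using A d0 by (simp add: algebra_simps)
      then show ?thesis using R unfolding IP H2_sq_int_def A1_def[symmetric] A2_def[symmetric] A3_def[symmetric]
        by argo
    qed
    finally show ?thesis using m by (simp add: C_def field_simps)
  qed
  moreover have "C > 0" unfolding C_def using m d0 by (intro divide_pos_pos mult_pos_pos add_pos_nonneg) auto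
  ultimately show ?thesis using that by blast
qed

lemma H2_approx:
  assumes u: "H2 \<Omega> u"
  shows "smooth_fun (dom_mollify n u)" "L2_tendsto \<Omega> (\<lambda>n. dom_mollify n u) u"
    "L2_tendsto \<Omega> (\<lambda>n. pd i (dom_mollify n u)) (wd1 \<Omega> u i)"
    "L2_tendsto \<Omega> (\<lambda>n. pd j (pd i (dom_mollify n u))) (wd2 \<Omega> u i j)"
proof -
  have H1u: "H1 \<Omega> u" and uL: "L2 \<Omega> u" using u by (auto simp: H2_def H1_def)
  note w1 = H1_wd1[OF H1u] and w2 = H2_wd2(1)[OF u] H2_wd2_weak_deriv1[OF u]
  show "smooth_fun (dom_mollify n u)" by (rule dom_mollify_smooth[OF uL])
  show "L2_tendsto \<Omega> (\<lambda>n. dom_mollify n u) u" by (rule dom_mollify_tendsto[OF uL])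
  show "L2_tendsto \<Omega> (\<lambda>n. pd i (dom_mollify n u)) (wd1 \<Omega> u i)"
    by (rule L2_tendsto_cong[OF L2_tendsto_scaled[OF dom_mollify_tendsto[OF w1(1)] sn_tendsto]])
      (use pd_dom_mollify[OF uL w1(2)] closure_subset[of \<Omega>] in auto)
  show "L2_tendsto \<Omega> (\<lambda>n. pd j (pd i (dom_mollify n u))) (wd2 \<Omega> u i j)"
    by (rule L2_tendsto_cong[OF L2_tendsto_scaled[OF L2_tendsto_scaled[OF dom_mollify_tendsto[OF w2(1)] sn_tendsto] sn_tendsto]])
      (use pd_pd_dom_mollify[OF uL w1(2) w1(1) w2(2)] in auto)
qed

lemma L2_Cauchy_bound:
  assumes F: "L2_tendsto S F f"
  shows "(\<integral>x. (F n x - F m x)\<^sup>2 \<partial>lebesgue_on S)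
     \<le> 2 * (\<integral>x. (F n x - f x)\<^sup>2 \<partial>lebesgue_on S) + 2 * (\<integral>x. (F m x - f x)\<^sup>2 \<partial>lebesgue_on S)"
proof -
  note FD = L2_tendstoD[OF F]
  have "(\<integral>x. (F n x - F m x)\<^sup>2 \<partial>lebesgue_on S) = (\<integral>x. ((F n x - f x) + (f x - F m x))\<^sup>2 \<partial>lebesgue_on S)" by simp
  also have "\<dots> \<le> 2 * (\<integral>x. (F n x - f x)\<^sup>2 \<partial>lebesgue_on S) + 2 * (\<integral>x. (f x - F m x)\<^sup>2 \<partial>lebesgue_on S)"
    by (rule integral_power2_add_le[OF L2_diff[OF FD(1,2)] L2_diff[OF FD(2,1)]])
  finally show ?thesis by (simp only: power2_commute[of "f _"])
qed

text \<open>Stated for all subdomains and all nodes at once, so that a single representative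
  \<open>ut\<close> serves every vertex of every element.\<close>

definition taylor_estimate :: "(R3 \<Rightarrow> real) \<Rightarrow> (R3 \<Rightarrow> real) \<Rightarrow> bool" where
  "taylor_estimate u ut \<longleftrightarrow> (\<forall>S a d. open S \<and> convex S \<and> S \<subseteq> \<Omega> \<and> a \<in> closure S \<and> (\<forall>x\<in>S. norm (x - a) \<le> d)
     \<longrightarrow> (\<integral>x. (taylor_rem a (ut a) u (wd1 \<Omega> u) x)\<^sup>2 \<partial>lebesgue_on S)
       \<le> 4 * d ^ 4 * (\<Sum>i\<in>UNIV. \<Sum>j\<in>UNIV. \<integral>x. (wd2 \<Omega> u i j x)\<^sup>2 \<partial>lebesgue_on S))"

lemma H2_continuous_representative:
  assumes u: "H2 \<Omega> u"
  obtains ut where "continuous_on (closure \<Omega>) ut" "AE x in lebesgue_on \<Omega>. ut x = u x" "taylor_estimate u ut"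
proof -
  define U where "U n = dom_mollify n u" for n
  note A = H2_approx[OF u, folded U_def]
  obtain C where C: "C > 0" "\<And>f a. smooth_fun f \<Longrightarrow> a \<in> closure \<Omega> \<Longrightarrow> (f a)\<^sup>2 \<le> C * H2_sq_int f"
    using sup_bound_smooth by blast
  define \<delta> where "\<delta> n = (\<integral>x. (U n x - u x)\<^sup>2 \<partial>lebesgue_on \<Omega>)
     + (\<Sum>i\<in>UNIV. \<integral>x. (pd i (U n) x - wd1 \<Omega> u i x)\<^sup>2 \<partial>lebesgue_on \<Omega>)
     + (\<Sum>i\<in>UNIV. \<Sum>j\<in>UNIV. \<integral>x. (pd j (pd i (U n)) x - wd2 \<Omega> u i j x)\<^sup>2 \<partial>lebesgue_on \<Omega>)" for n
  have \<delta>0: "\<delta> \<longlonglongrightarrow> 0"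
    unfolding \<delta>_def[abs_def]
    by (intro tendsto_add_zero tendsto_null_sum L2_tendstoD(3)[OF A(2)] L2_tendstoD(3)[OF A(3)] L2_tendstoD(3)[OF A(4)])
  \<comment> \<open>The sup bound applied to \<open>U n - U m\<close> makes the approximants
    uniformly Cauchy on the closed domain.\<close>
  have cb: "(U n a - U m a)\<^sup>2 \<le> C * (2 * \<delta> n + 2 * \<delta> m)" if a: "a \<in> closure \<Omega>" for n m a
  proof -
    let ?f = "\<lambda>x. U n x - U m x"
    have sm: "smooth_fun ?f" by (rule smooth_fun_diff[OF A(1) A(1)])
    have p1: "pd i ?f = (\<lambda>x. pd i (U n) x - pd i (U m) x)" for i
      by (intro ext pd_diff smooth_fun_differentiable A(1))
    have p2: "pd j (pd i ?f) = (\<lambda>x. pd j (pd i (U n)) x - pd j (pd i (U m)) x)" for i j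
      unfolding p1 by (intro ext pd_diff smooth_fun_differentiable smooth_fun_pd A(1))
    have "H2_sq_int ?f \<le> 2 * \<delta> n + 2 * \<delta> m"
    proof -
      have s1: "(\<Sum>i\<in>UNIV. \<integral>x. (pd i ?f x)\<^sup>2 \<partial>lebesgue_on \<Omega>) \<le>
        (\<Sum>i\<in>UNIV. 2 * (\<integral>x. (pd i (U n) x - wd1 \<Omega> u i x)\<^sup>2 \<partial>lebesgue_on \<Omega>) + 2 * (\<integral>x. (pd i (U m) x - wd1 \<Omega> u i x)\<^sup>2 \<partial>lebesgue_on \<Omega>))"
        unfolding p1 by (intro sum_mono L2_Cauchy_bound A(3))
      have s2: "(\<Sum>i\<in>UNIV. \<Sum>j\<in>UNIV. \<integral>x. (pd j (pd i ?f) x)\<^sup>2 \<partial>lebesgue_on \<Omega>) \<le>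
        (\<Sum>i\<in>UNIV. \<Sum>j\<in>UNIV. 2 * (\<integral>x. (pd j (pd i (U n)) x - wd2 \<Omega> u i j x)\<^sup>2 \<partial>lebesgue_on \<Omega>)
           + 2 * (\<integral>x. (pd j (pd i (U m)) x - wd2 \<Omega> u i j x)\<^sup>2 \<partial>lebesgue_on \<Omega>))"
        unfolding p2 by (intro sum_mono L2_Cauchy_bound A(4))
      note s0 = L2_Cauchy_bound[OF A(2), of n m]
      show ?thesis
        using add_mono[OF add_mono[OF s0 s1] s2] unfolding H2_sq_int_def \<delta>_def
        by (simp only: sum.distrib sum_distrib_left[symmetric] distrib_left)
    qed
    then show ?thesis using C(2)[OF sm a] C(1) mult_left_mono[of "H2_sq_int ?f" "2 * \<delta> n + 2 * \<delta> m" C] by linarith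
  qed
  have "uniformly_Cauchy_on (closure \<Omega>) U"
    unfolding uniformly_Cauchy_on_def
  proof (intro allI impI)
    fix e :: real assume e: "e > 0"
    have "\<forall>\<^sub>F n in sequentially. \<delta> n < e\<^sup>2 / (4 * C)"
      using order_tendstoD(2)[OF \<delta>0, of "e\<^sup>2 / (4 * C)"] e C(1) by simp
    then obtain N where N: "\<And>n. n \<ge> N \<Longrightarrow> \<delta> n < e\<^sup>2 / (4 * C)" by (auto simp: eventually_sequentially)
    have "dist (U m a) (U n a) < e" if "a \<in> closure \<Omega>" "m \<ge> N" "n \<ge> N" for a m n
    proof -
      have "C * (2 * \<delta> m + 2 * \<delta> n) < C * (e\<^sup>2 / C)"
      proof (rule mult_strict_left_mono[OF _ C(1)])
        have "e\<^sup>2 / C = 4 * (e\<^sup>2 / (4 * C))" using C(1) by simp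
        then show "2 * \<delta> m + 2 * \<delta> n < e\<^sup>2 / C" using N[OF that(2)] N[OF that(3)] by argo
      qed
      then have "(U m a - U n a)\<^sup>2 < e\<^sup>2" using cb[OF that(1), of m n] C(1) by simp
      then have "\<bar>U m a - U n a\<bar> < e" using power2_less_imp_less[of "\<bar>U m a - U n a\<bar>" e] e by simp
      then show ?thesis by (simp add: dist_real_def)
    qed
    then show "\<exists>M. \<forall>x\<in>closure \<Omega>. \<forall>m\<ge>M. \<forall>n\<ge>M. dist (U m x) (U n x) < e" by blast
  qed
  then have "uniformly_convergent_on (closure \<Omega>) U"
    by (simp add: uniformly_convergent_eq_Cauchy)
  then obtain ut where ut: "uniform_limit (closure \<Omega>) U ut sequentially"
    unfolding uniformly_convergent_on_def by blast
  have cont: "continuous_on (closure \<Omega>) ut"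
    by (rule uniform_limit_theorem[OF _ ut])
      (auto intro!: always_eventually continuous_on_subset[OF smooth_fun_continuous[OF A(1)]])
  have lim: "(\<lambda>n. U n a) \<longlonglongrightarrow> ut a" if "a \<in> closure \<Omega>" for a
    by (rule tendsto_uniform_limitI[OF ut that])
  have utm: "ut \<in> borel_measurable (lebesgue_on \<Omega>)"
    using continuous_on_subset[OF cont closure_subset] sets_dom by (rule continuous_imp_measurable_on_sets_lebesgue)
  \<comment> \<open>Uniform convergence on a set of finite measure gives L2 convergence; the two L2
    limits \<open>ut\<close> and \<open>u\<close> then agree almost everywhere.\<close>
  have "L2_tendsto \<Omega> U ut"
    unfolding L2_tendsto_def
  proof (intro conjI allI)
    interpret finite_measure "lebesgue_on \<Omega>" by (rule finite_measure_lebesgue_on[OF lmeasurable_dom])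
    show "L2 \<Omega> (U n)" for n by (rule L2_tendstoD(1)[OF A(2)])
    have "bounded (ut ` closure \<Omega>)" using bounded_dom by (intro compact_imp_bounded compact_continuous_image cont) auto
    then obtain K where "\<forall>y \<in> ut ` closure \<Omega>. norm y \<le> K" unfolding bounded_iff by blast
    then show utL: "L2 \<Omega> ut" using closure_subset by (intro L2_bounded[OF utm lmeasurable_dom, of K]) auto
    show "(\<lambda>n. \<integral>x. (U n x - ut x)\<^sup>2 \<partial>lebesgue_on \<Omega>) \<longlonglongrightarrow> 0"
    proof (rule LIMSEQ_I)
      fix e :: real assume e: "e > 0"
      define t where "t = sqrt (e / (2 * measure lebesgue \<Omega>))"
      have t: "t > 0" "t\<^sup>2 * measure lebesgue \<Omega> = e / 2" unfolding t_def using e measure_dom_pos by auto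
      have "\<forall>\<^sub>F n in sequentially. \<forall>x\<in>closure \<Omega>. dist (U n x) (ut x) < t"
        using ut t(1) unfolding uniform_limit_iff by blast
      then obtain N where N: "\<And>n x. n \<ge> N \<Longrightarrow> x \<in> closure \<Omega> \<Longrightarrow> dist (U n x) (ut x) < t"
        unfolding eventually_sequentially by blast
      have "norm ((\<integral>x. (U n x - ut x)\<^sup>2 \<partial>lebesgue_on \<Omega>) - 0) < e" if "n \<ge> N" for n
      proof -
        have "(\<integral>x. (U n x - ut x)\<^sup>2 \<partial>lebesgue_on \<Omega>) \<le> (\<integral>x. t\<^sup>2 \<partial>lebesgue_on \<Omega>)"
        proof (rule integral_mono)
          show "integrable (lebesgue_on \<Omega>) (\<lambda>x. (U n x - ut x)\<^sup>2)"
            by (intro L2_sq_integrable L2_diff utL L2_tendstoD(1)[OF A(2)])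
          show "(U n x - ut x)\<^sup>2 \<le> t\<^sup>2" if "x \<in> space (lebesgue_on \<Omega>)" for x
            using N[OF \<open>n \<ge> N\<close>, of x] that closure_subset[of \<Omega>] t(1)
            by (auto simp: abs_le_square_iff[symmetric] dist_real_def intro: less_imp_le)
        qed simp
        also have "\<dots> = e / 2" using t(2) by (simp add: measure_restrict_space mult.commute)
        finally show ?thesis using e by (simp add: integral_nonneg_AE)
      qed
      then show "\<exists>N. \<forall>n\<ge>N. norm ((\<integral>x. (U n x - ut x)\<^sup>2 \<partial>lebesgue_on \<Omega>) - 0) < e" by blast
    qed
  qed
  from L2_tendsto_unique_AE[OF this A(2)] have ae: "AE x in lebesgue_on \<Omega>. ut x = u x" .
  \<comment> \<open>The point values \<open>U n a\<close> converge and all other ingredients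
    converge in L2, so the smooth estimate passes to the limit.\<close>
  have rem: "(\<integral>x. (taylor_rem a (ut a) u (wd1 \<Omega> u) x)\<^sup>2 \<partial>lebesgue_on S)
         \<le> 4 * d ^ 4 * (\<Sum>i\<in>UNIV. \<Sum>j\<in>UNIV. \<integral>x. (wd2 \<Omega> u i j x)\<^sup>2 \<partial>lebesgue_on S)"
    if S: "open S" "convex S" "S \<subseteq> \<Omega>" "a \<in> closure S" and d: "\<And>x. x \<in> S \<Longrightarrow> norm (x - a) \<le> d" for S a d
  proof -
    have mS: "S \<in> lmeasurable" using bounded_subset[OF bounded_dom S(3)] S(1) lmeasurable_open by blast
    have sS: "S \<in> sets lebesgue" using mS by (simp add: fmeasurableD)
    have aO: "a \<in> closure \<Omega>" using S(3,4) closure_mono by blast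
    note sub = L2_tendsto_subset[OF _ S(3) sS sets_dom]
    have "L2_tendsto S (\<lambda>n. taylor_rem a (U n a) (U n) (\<lambda>i. pd i (U n))) (taylor_rem a (ut a) u (wd1 \<Omega> u))"
      by (rule L2_tendsto_taylor_rem[OF mS lim[OF aO] sub[OF A(2)] sub[OF A(3)] d])
    then have l1: "(\<lambda>n. \<integral>x. (taylor_rem a (U n a) (U n) (\<lambda>i. pd i (U n)) x)\<^sup>2 \<partial>lebesgue_on S)
       \<longlonglongrightarrow> (\<integral>x. (taylor_rem a (ut a) u (wd1 \<Omega> u) x)\<^sup>2 \<partial>lebesgue_on S)"
      by (rule L2_tendsto_integral_power2)
    have l2: "(\<lambda>n. 4 * d ^ 4 * (\<Sum>i\<in>UNIV. \<Sum>j\<in>UNIV. \<integral>x. (pd j (pd i (U n)) x)\<^sup>2 \<partial>lebesgue_on S))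
      \<longlonglongrightarrow> 4 * d ^ 4 * (\<Sum>i\<in>UNIV. \<Sum>j\<in>UNIV. \<integral>x. (wd2 \<Omega> u i j x)\<^sup>2 \<partial>lebesgue_on S)"
      by (intro tendsto_mult tendsto_const tendsto_sum L2_tendsto_integral_power2 sub A(4))
    show ?thesis
      by (rule LIMSEQ_le[OF l1 l2]) (use taylor_rem_smooth_integral[OF A(1) S d] in blast)
  qed
  have "taylor_estimate u ut" unfolding taylor_estimate_def using rem by blast
  with cont ae show ?thesis by (rule that)
qed

end

section \<open>Boundary values\<close>

definition grad_sq :: "(R3 \<Rightarrow> real) \<Rightarrow> R3 \<Rightarrow> real" where
  "grad_sq u y = (\<Sum>i\<in>UNIV. (pd i u y)\<^sup>2)"

text \<open>Increment along the ray from \<open>x\<close> to its dilated image; the chain rule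
  contributes \<open>t - 1\<close>. The trivial weight 1 brings the integral into the shape of
  \<open>dilation_tonelli\<close>.\<close>

lemma dilation_difference_pointwise:
  assumes u: "smooth_fun u" and t: "t \<ge> 1"
  shows "ennreal ((u (x0 + t *\<^sub>R (x - x0)) - u x)\<^sup>2)
     \<le> ennreal ((t - 1)\<^sup>2 * (norm (x - x0))\<^sup>2)
       * (\<integral>\<^sup>+s. indicator {0..1} s * (ennreal 1 * ennreal (grad_sq u (x0 + (1 + s * (t - 1)) *\<^sub>R (x - x0)))) \<partial>lborel)"
proof -
  define y where "y = x - x0"
  define p where "p s = x0 + (1 + s * (t - 1)) *\<^sub>R y" for s :: real
  define F where "F s = (t - 1) * (\<Sum>i\<in>UNIV. y $ i * pd i u (p s))" for s
  have sq: "((\<lambda>s::real. 1 + s * (t - 1)) has_real_derivative (t - 1)) (at s)" for s by (auto intro!: derivative_eq_intros)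
  have d0: "((\<lambda>s. u (p s)) has_real_derivative F s) (at s)" for s
    unfolding p_def F_def by (rule smooth_fun_along_line[OF u sq])
  have pc: "continuous_on UNIV p" unfolding p_def by (intro continuous_intros)
  have cf: "continuous_on UNIV (\<lambda>s. pd i u (p s))" for i
    using continuous_on_compose2[OF smooth_fun_continuous[OF smooth_fun_pd[OF u]] pc] by auto
  have kc: "continuous_on UNIV F" unfolding F_def[abs_def] by (intro continuous_intros cf)
  have Fb: "(F s)\<^sup>2 \<le> (t - 1)\<^sup>2 * (norm y)\<^sup>2 * grad_sq u (p s)" for s
    unfolding F_def power_mult_distrib grad_sq_def mult.assoc by (intro mult_left_mono sum_coord_square_le) auto
  have h0: "grad_sq u z \<ge> 0" for z by (simp add: grad_sq_def sum_nonneg)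
  have [measurable]: "grad_sq u \<in> borel_measurable borel"
    unfolding grad_sq_def[abs_def]
    by (intro borel_measurable_continuous_onI continuous_intros smooth_fun_continuous smooth_fun_pd u)
  have "ennreal ((u (x0 + t *\<^sub>R (x - x0)) - u x)\<^sup>2) = ennreal ((u (p 1) - u (p 0))\<^sup>2)"
    by (simp add: p_def y_def)
  also have "\<dots> \<le> (\<integral>\<^sup>+s. indicator {0..1} s * ennreal ((F s)\<^sup>2) \<partial>lborel)"
    by (rule increment_square_le[OF d0 kc])
  also have "\<dots> \<le> (\<integral>\<^sup>+s. ennreal ((t - 1)\<^sup>2 * (norm y)\<^sup>2) * (indicator {0..1} s * (ennreal 1 * ennreal (grad_sq u (p s)))) \<partial>lborel)"
  proof (rule nn_integral_mono)
    fix s :: real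
    have "ennreal ((F s)\<^sup>2) \<le> ennreal ((t - 1)\<^sup>2 * (norm y)\<^sup>2 * grad_sq u (p s))"
      by (intro ennreal_leI Fb)
    also have "\<dots> = ennreal ((t - 1)\<^sup>2 * (norm y)\<^sup>2) * (ennreal 1 * ennreal (grad_sq u (p s)))"
      using h0 by (simp add: ennreal_mult)
    finally show "indicator {0..1} s * ennreal ((F s)\<^sup>2)
      \<le> ennreal ((t - 1)\<^sup>2 * (norm y)\<^sup>2) * (indicator {0..1} s * (ennreal 1 * ennreal (grad_sq u (p s))))"
      by (auto simp: indicator_def)
  qed
  also have "\<dots> = ennreal ((t - 1)\<^sup>2 * (norm y)\<^sup>2) * (\<integral>\<^sup>+s. indicator {0..1} s * (ennreal 1 * ennreal (grad_sq u (p s))) \<partial>lborel)"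
    unfolding p_def by (rule nn_integral_cmult) measurable
  finally show ?thesis unfolding y_def p_def .
qed

text \<open>On \<open>E\<close> the dilated point lies outside \<Omega>, where \<open>u\<close>
  vanishes, so \<open>u x\<close> is up to sign the whole increment along the ray and is of order
  \<open>t - 1\<close>.\<close>

lemma (in convex_domain) test_fun_boundary_layer:
  assumes u: "test_fun \<Omega> u" and t: "t \<ge> 1" and d: "\<And>x. x \<in> \<Omega> \<Longrightarrow> norm (x - x0) \<le> d"
    and E: "E \<in> sets borel" "E \<subseteq> \<Omega>" "\<And>x. x \<in> E \<Longrightarrow> x0 + t *\<^sub>R (x - x0) \<notin> \<Omega>"
  shows "(\<integral>x. (u x)\<^sup>2 \<partial>lebesgue_on E) \<le> (t - 1)\<^sup>2 * d\<^sup>2 * (\<Sum>i\<in>UNIV. \<integral>x. (pd i u x)\<^sup>2 \<partial>lebesgue_on \<Omega>)"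
proof -
  have sm: "smooth_fun u" using u by (simp add: test_fun_def)
  have [measurable]: "grad_sq u \<in> borel_measurable borel"
    unfolding grad_sq_def[abs_def]
    by (intro borel_measurable_continuous_onI continuous_intros smooth_fun_continuous smooth_fun_pd sm)
  have h0: "grad_sq u z \<ge> 0" for z by (simp add: grad_sq_def sum_nonneg)
  have hz: "grad_sq u z = 0" if "z \<notin> \<Omega>" for z
    using test_fun_outside[OF test_fun_pd[OF u] that] by (simp add: grad_sq_def)
  have Ob: "\<Omega> \<in> sets borel" using open_dom by simp
  have sE: "E \<in> sets lebesgue" using E(1) by simp
  note E(1)[measurable]
  define I where "I x = (\<integral>\<^sup>+s. indicator {0..1} s * (ennreal 1 * ennreal (grad_sq u (x0 + (1 + s * (t - 1)) *\<^sub>R (x - x0)))) \<partial>lborel)" for x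
  have cv: "(\<integral>\<^sup>+x. f x \<partial>lebesgue_on A) = (\<integral>\<^sup>+x. indicator A x * f x \<partial>lborel)" if "A \<in> sets borel" for A and f :: "R3 \<Rightarrow> ennreal"
    using that by (subst nn_integral_restrict_space) (auto simp: nn_integral_completion mult.commute)
  have L: "L2 \<Omega> u" "L2 \<Omega> (pd i u)" for i
    using L2_test_fun[OF u lmeasurable_dom] L2_test_fun[OF test_fun_pd[OF u] lmeasurable_dom] by auto
  have LE: "L2 E u" by (rule L2_subset[OF L(1) E(2) sE sets_dom])
  have hi: "integrable (lebesgue_on \<Omega>) (grad_sq u)"
    unfolding grad_sq_def[abs_def] using L(2) by (intro Bochner_Integration.integrable_sum L2_sq_integrable)
  have hI: "(\<integral>x. grad_sq u x \<partial>lebesgue_on \<Omega>) = (\<Sum>i\<in>UNIV. \<integral>x. (pd i u x)\<^sup>2 \<partial>lebesgue_on \<Omega>)"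
    unfolding grad_sq_def using L(2) by (simp add: Bochner_Integration.integral_sum L2_sq_integrable)
  have "ennreal (\<integral>x. (u x)\<^sup>2 \<partial>lebesgue_on E) = (\<integral>\<^sup>+x. ennreal ((u x)\<^sup>2) \<partial>lebesgue_on E)"
    by (intro nn_integral_eq_integral[symmetric] L2_sq_integrable LE) auto
  also have "\<dots> \<le> (\<integral>\<^sup>+x. ennreal ((t - 1)\<^sup>2 * d\<^sup>2) * (indicator E x * I x) \<partial>lborel)"
    unfolding cv[OF E(1)]
  proof (rule nn_integral_mono)
    fix x
    show "indicator E x * ennreal ((u x)\<^sup>2) \<le> ennreal ((t - 1)\<^sup>2 * d\<^sup>2) * (indicator E x * I x)"
    proof (cases "x \<in> E")
      case True
      have "u (x0 + t *\<^sub>R (x - x0)) = 0" by (rule test_fun_outside[OF u E(3)[OF True]])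
      then have "ennreal ((u x)\<^sup>2) \<le> ennreal ((t - 1)\<^sup>2 * (norm (x - x0))\<^sup>2) * I x"
        using dilation_difference_pointwise[OF sm t, of x0 x] unfolding I_def by simp
      also have "\<dots> \<le> ennreal ((t - 1)\<^sup>2 * d\<^sup>2) * I x"
        using d[of x] True E(2) by (intro mult_right_mono ennreal_leI mult_left_mono power_mono) auto
      finally show ?thesis using True by simp
    qed simp
  qed
  also have "\<dots> = ennreal ((t - 1)\<^sup>2 * d\<^sup>2) * (\<integral>\<^sup>+x. indicator E x * I x \<partial>lborel)"
    unfolding I_def by (rule nn_integral_cmult) measurable
  \<comment> \<open>Dilated points may leave \<Omega>, so the target set is the whole space; the
    gradient vanishes outside \<Omega>, so nothing is added.\<close>
  also have "\<dots> \<le> ennreal ((t - 1)\<^sup>2 * d\<^sup>2) * (\<integral>\<^sup>+x. indicator UNIV x * ennreal (grad_sq u x) \<partial>lborel)"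
    unfolding I_def
  proof (intro mult_left_mono dilation_tonelli)
    fix s :: real assume s: "s \<in> {0..1}"
    have "1 \<le> 1 + s * (t - 1)" using s t by simp
    moreover from this have "1 \<le> (1 + s * (t - 1)) ^ 3" by (rule one_le_power)
    ultimately show "0 \<le> (1::real) \<and> ((1::real) = 0 \<or> 1 + s * (t - 1) > 0 \<and> 1 \<le> (1 + s * (t - 1)) ^ 3
        \<and> (\<forall>x\<in>E. x0 + (1 + s * (t - 1)) *\<^sub>R (x - x0) \<in> UNIV))"
      by auto
  qed (use E(1) in measurable)
  also have "(\<integral>\<^sup>+x. indicator UNIV x * ennreal (grad_sq u x) \<partial>lborel) = (\<integral>\<^sup>+x. ennreal (grad_sq u x) \<partial>lebesgue_on \<Omega>)"
    unfolding cv[OF Ob] using hz by (intro nn_integral_cong) (auto simp: indicator_def)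
  also have "\<dots> = ennreal (\<integral>x. grad_sq u x \<partial>lebesgue_on \<Omega>)"
    by (intro nn_integral_eq_integral hi) (auto simp: h0)
  also have "ennreal ((t - 1)\<^sup>2 * d\<^sup>2) * \<dots> = ennreal ((t - 1)\<^sup>2 * d\<^sup>2 * (\<integral>x. grad_sq u x \<partial>lebesgue_on \<Omega>))"
    using h0 by (intro ennreal_mult[symmetric]) (auto intro!: integral_nonneg_AE)
  finally have "(\<integral>x. (u x)\<^sup>2 \<partial>lebesgue_on E) \<le> (t - 1)\<^sup>2 * d\<^sup>2 * (\<integral>x. grad_sq u x \<partial>lebesgue_on \<Omega>)"
    using h0 by (subst (asm) ennreal_le_iff) (auto intro!: mult_nonneg_nonneg integral_nonneg_AE)
  then show ?thesis unfolding hI .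
qed

lemma (in convex_domain) H10_boundary_layer:
  assumes u: "H10 \<Omega> u" and t: "t \<ge> 1" and d: "\<And>x. x \<in> \<Omega> \<Longrightarrow> norm (x - x0) \<le> d"
    and E: "E \<in> sets borel" "E \<subseteq> \<Omega>" "\<And>x. x \<in> E \<Longrightarrow> x0 + t *\<^sub>R (x - x0) \<notin> \<Omega>"
  shows "(\<integral>x. (u x)\<^sup>2 \<partial>lebesgue_on E) \<le> (t - 1)\<^sup>2 * d\<^sup>2 * (\<Sum>i\<in>UNIV. \<integral>x. (wd1 \<Omega> u i x)\<^sup>2 \<partial>lebesgue_on \<Omega>)"
proof -
  obtain \<phi> where \<phi>: "\<And>n. test_fun \<Omega> (\<phi> n)" "L2_tendsto \<Omega> \<phi> u" "\<And>i. L2_tendsto \<Omega> (\<lambda>n. pd i (\<phi> n)) (wd1 \<Omega> u i)"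
    using H10_approx[OF u] by blast
  have sE: "E \<in> sets lebesgue" using E(1) by simp
  have l1: "(\<lambda>n. \<integral>x. (\<phi> n x)\<^sup>2 \<partial>lebesgue_on E) \<longlonglongrightarrow> (\<integral>x. (u x)\<^sup>2 \<partial>lebesgue_on E)"
    by (rule L2_tendsto_integral_power2[OF L2_tendsto_subset[OF \<phi>(2) E(2) sE sets_dom]])
  have l2: "(\<lambda>n. (t - 1)\<^sup>2 * d\<^sup>2 * (\<Sum>i\<in>UNIV. \<integral>x. (pd i (\<phi> n) x)\<^sup>2 \<partial>lebesgue_on \<Omega>))
     \<longlonglongrightarrow> (t - 1)\<^sup>2 * d\<^sup>2 * (\<Sum>i\<in>UNIV. \<integral>x. (wd1 \<Omega> u i x)\<^sup>2 \<partial>lebesgue_on \<Omega>)"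
    by (intro tendsto_mult tendsto_const tendsto_sum L2_tendsto_integral_power2 \<phi>(3))
  show ?thesis
    by (rule LIMSEQ_le[OF l1 l2]) (use test_fun_boundary_layer[OF \<phi>(1) t d E] in blast)
qed

lemma measure_dilation_preimage:
  fixes x0 :: R3
  assumes A: "open A" "bounded A" and t: "t > 0"
  shows "measure lebesgue {x. x0 + t *\<^sub>R (x - x0) \<in> A} = measure lebesgue A / t ^ 3"
    "open {x. x0 + t *\<^sub>R (x - x0) \<in> A}"
proof -
  let ?B = "{x. x0 + t *\<^sub>R (x - x0) \<in> A}"
  have "?B = (\<lambda>x. x0 + t *\<^sub>R (x - x0)) -` A" by auto
  then show o: "open ?B" using A(1) by (auto intro!: open_vimage continuous_intros)
  have "emeasure lborel A = (\<integral>\<^sup>+x. indicator A x \<partial>lborel)" using A(1) by simp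
  also have "\<dots> = ennreal (t ^ 3) * (\<integral>\<^sup>+x. indicator A ((x0 - t *\<^sub>R x0) + t *\<^sub>R x) \<partial>lborel)"
    using nn_integral_lborel_dilation[of "indicator A" t "x0 - t *\<^sub>R x0"] A(1) t by simp
  also have "(\<lambda>x. indicator A ((x0 - t *\<^sub>R x0) + t *\<^sub>R x) :: ennreal) = indicator ?B"
    by (auto simp: indicator_def fun_eq_iff algebra_simps)
  also have "(\<integral>\<^sup>+x. indicator ?B x \<partial>lborel) = emeasure lborel ?B" using o by simp
  finally have eq: "emeasure lborel A = ennreal (t ^ 3) * emeasure lborel ?B" .
  then have "measure lborel A = t ^ 3 * measure lborel ?B"
    unfolding measure_def using t by (simp add: enn2real_mult)
  then show "measure lebesgue ?B = measure lebesgue A / t ^ 3"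
    using t A(1) o by simp
qed

text \<open>In the cone of rays from \<open>x0\<close> meeting a small ball around a boundary point \<open>b\<close>, the points that
  a dilation with factor \<open>t\<close> throws out of \<open>\<Omega>\<close> have volume proportional to \<open>t - 1\<close>, whereas their
  contribution to the square integral is at most quadratic in \<open>t - 1\<close>.\<close>

lemma (in convex_domain) H10_boundary_zero:
  assumes u: "H10 \<Omega> u" and ut: "continuous_on (closure \<Omega>) ut" "AE x in lebesgue_on \<Omega>. ut x = u x"
    and b: "b \<in> closure \<Omega>" "b \<notin> \<Omega>"
  shows "ut b = 0"
proof (rule ccontr)
  assume nz: "ut b \<noteq> 0"
  define c where "c = \<bar>ut b\<bar> / 2"
  have c: "c > 0" using nz by (simp add: c_def)
  obtain \<eta> where \<eta>: "\<eta> > 0" "\<And>x. x \<in> closure \<Omega> \<Longrightarrow> dist x b < \<eta> \<Longrightarrow> dist (ut x) (ut b) < c"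
    using ut(1) b(1) c unfolding continuous_on_iff by blast
  have utc: "c \<le> \<bar>ut x\<bar>" if "x \<in> closure \<Omega>" "dist x b < \<eta>" for x
    using \<eta>(2)[OF that] unfolding c_def dist_real_def by linarith
  define d where "d = diameter \<Omega>"
  have d0: "d \<ge> 0" unfolding d_def by (rule diameter_ge_0[OF bounded_dom])
  have x0: "x0 \<in> \<Omega>" using ball_dom r_pos centre_in_ball by blast
  have dd: "norm (x - x0) \<le> d" if "x \<in> \<Omega>" for x
    using diameter_bounded_bound[OF bounded_dom that x0] by (simp add: d_def dist_norm)
  \<comment> \<open>\<open>q * (3 * d + r)\<close> will bound the distance of the layer points from
    \<open>b\<close>; the factor 2 makes it strictly smaller than \<open>\<eta>\<close>.\<close>
  define q where "q = min 1 (\<eta> / (2 * (3 * d + r)))"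
  have dr: "3 * d + r > 0" using d0 r_pos by simp
  have q: "0 < q" "q \<le> 1" using \<eta>(1) dr by (auto simp: q_def)
  have q\<eta>: "q * (3 * d + r) < \<eta>"
  proof -
    have "q * (3 * d + r) \<le> \<eta> / (2 * (3 * d + r)) * (3 * d + r)"
      using dr by (intro mult_right_mono) (auto simp: q_def)
    also have "\<dots> = \<eta> / 2" using dr by (simp add: field_simps)
    finally show ?thesis using \<eta>(1) by simp
  qed
  define \<theta> where "\<theta> = q * r"
  have \<theta>: "\<theta> > 0" using q r_pos by (simp add: \<theta>_def)
  \<comment> \<open>The open cone with apex \<open>x0\<close> over a small ball around
    \<open>b\<close>; dilations about \<open>x0\<close> preserve it.\<close>
  define K where "K = {x. \<exists>s>0. x0 + s *\<^sub>R (x - x0) \<in> ball b \<theta>}"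
  have K: "open K"
  proof -
    have "K = (\<Union>s\<in>{0<..}. (\<lambda>x. x0 + s *\<^sub>R (x - x0)) -` ball b \<theta>)" by (auto simp: K_def)
    then show ?thesis by (auto intro!: open_UN open_vimage continuous_intros)
  qed
  have Kt: "x0 + t *\<^sub>R (x - x0) \<in> K" if "x \<in> K" "t > 0" for x t
  proof -
    have "\<exists>s>0. x0 + s *\<^sub>R (x - x0) \<in> ball b \<theta>" using that(1) by (simp only: K_def mem_Collect_eq)
    then obtain s where "s > 0" "x0 + s *\<^sub>R (x - x0) \<in> ball b \<theta>" by (elim exE conjE)
    then have "s / t > 0 \<and> x0 + (s / t) *\<^sub>R (x0 + t *\<^sub>R (x - x0) - x0) \<in> ball b \<theta>" using that(2) by simp
    then show ?thesis unfolding K_def mem_Collect_eq by (rule exI)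
  qed
  define A where "A = K \<inter> \<Omega>"
  have A: "open A" "bounded A" "A \<subseteq> \<Omega>" using K open_dom bounded_dom by (auto simp: A_def)
  have mA: "A \<in> lmeasurable" by (rule lmeasurable_open[OF A(2,1)])
  define m where "m = measure lebesgue A"
  have m: "m > 0"
  proof -
    obtain z where "z \<in> \<Omega>" "dist z b < \<theta>" using b(1) \<theta> unfolding closure_approachable by blast
    then have "ball b \<theta> \<inter> \<Omega> \<noteq> {}" by (auto simp: dist_commute)
    moreover have "ball b \<theta> \<subseteq> K" unfolding K_def by (auto intro: exI[of _ 1])
    ultimately have "A \<noteq> {}" unfolding A_def by blast
    then have "\<not> negligible A" using open_not_negligible A(1) by blast
    then show ?thesis unfolding m_def using mA negligible_iff_measure by (metis measure_nonneg order_le_less)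
  qed
  define G where "G = (\<Sum>i\<in>UNIV. \<integral>x. (wd1 \<Omega> u i x)\<^sup>2 \<partial>lebesgue_on \<Omega>)"
  have G0: "G \<ge> 0" unfolding G_def by (auto intro!: sum_nonneg integral_nonneg_AE)
  \<comment> \<open>The lower bound is \<open>c^2\<close> times the volume of the layer, the upper
    one comes from \<open>H10_boundary_layer\<close>; after cancelling one factor
    \<open>t - 1\<close>, letting \<open>t\<close> approach 1 is contradictory.\<close>
  have main: "c\<^sup>2 * m / 2 \<le> (t - 1) * (d\<^sup>2 * G)" if t: "1 < t" "t \<le> 1 + q" for t
  proof -
    define P where "P = {x. x0 + t *\<^sub>R (x - x0) \<in> A}"
    define E where "E = A - P"
    have mP: "measure lebesgue P = m / t ^ 3" and oP: "open P"
      using measure_dilation_preimage[OF A(1,2), of t x0] t by (auto simp: P_def m_def)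
    have Eb: "E \<in> sets borel" "E \<subseteq> \<Omega>" using A oP by (auto simp: E_def)
    have sE: "E \<in> sets lebesgue" using Eb by simp
    have PA: "P \<subseteq> A"
    proof
      fix x assume x: "x \<in> P"
      let ?z = "x0 + t *\<^sub>R (x - x0)"
      have z: "?z \<in> K" "?z \<in> \<Omega>" using x by (auto simp: P_def A_def)
      have "(1 / t) *\<^sub>R ?z + (1 - 1 / t) *\<^sub>R x0 + 0 \<in> \<Omega>"
        using z(2) closure_subset[of \<Omega>] t r_pos by (intro shrink_in_dom) auto
      moreover have "(1 / t) *\<^sub>R ?z + (1 - 1 / t) *\<^sub>R x0 + 0 = x" using t by (simp add: algebra_simps)
      moreover have "x0 + (1 / t) *\<^sub>R (?z - x0) \<in> K" using Kt[OF z(1), of "1 / t"] t by simp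
      moreover have "x0 + (1 / t) *\<^sub>R (?z - x0) = x" using t by simp
      ultimately show "x \<in> A" by (simp add: A_def)
    qed
    have E3: "x0 + t *\<^sub>R (x - x0) \<notin> \<Omega>" if "x \<in> E" for x
      using that Kt[of x t] t by (auto simp: E_def A_def P_def)
    have close: "dist x b < \<eta>" if x: "x \<in> E" for x
    proof -
      have xO: "x \<in> \<Omega>" using x Eb by blast
      obtain s where s: "s > 0" "x0 + s *\<^sub>R (x - x0) \<in> ball b \<theta>" using x by (auto simp: E_def A_def K_def)
      define \<beta> where "\<beta> = (x0 + s *\<^sub>R (x - x0)) - b"
      have \<beta>: "norm \<beta> < \<theta>" using s(2) by (simp add: \<beta>_def dist_norm norm_minus_commute)
      \<comment> \<open>If \<open>s\<close> were smaller, \<open>b\<close> would be a contraction of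
        \<open>x\<close> towards \<open>x0\<close> up to an error below \<open>(1 - s) * r\<close>,
        hence a point of \<Omega>.\<close>
      have low: "1 - q \<le> s"
      proof (rule ccontr)
        assume n: "\<not> 1 - q \<le> s"
        then have "\<theta> \<le> (1 - s) * r" unfolding \<theta>_def using r_pos by (intro mult_right_mono) auto
        then have "norm (- \<beta>) < (1 - s) * r" using \<beta> by simp
        then have "s *\<^sub>R x + (1 - s) *\<^sub>R x0 + (- \<beta>) \<in> \<Omega>"
          using xO closure_subset n s(1) q by (intro shrink_in_dom) auto
        then show False using b(2) by (simp add: \<beta>_def algebra_simps)
      qed
      \<comment> \<open>If \<open>s\<close> were larger, the dilated image of \<open>x\<close> would
        be a contraction of \<open>b\<close> towards \<open>x0\<close> up to a small error, hence a
        point of \<Omega>, against \<open>E3\<close>.\<close>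
      have up: "s \<le> t * (1 + q)"
      proof (rule ccontr)
        assume n: "\<not> s \<le> t * (1 + q)"
        have ts: "t / s < 1"
        proof -
          have "t \<le> t * (1 + q)" using t q by simp
          then show ?thesis using n s(1) by simp
        qed
        have "(t / s) * \<theta> \<le> (1 - t / s) * r"
        proof -
          have "(t / s) * (1 + q) \<le> 1" using n s(1) by (simp add: field_simps)
          then have "(t / s) * q \<le> 1 - t / s" unfolding distrib_left by linarith
          then have "(t / s) * q * r \<le> (1 - t / s) * r" using r_pos by (intro mult_right_mono) auto
          then show ?thesis by (simp add: \<theta>_def mult.assoc)
        qed
        moreover have "norm ((t / s) *\<^sub>R \<beta>) < (t / s) * \<theta>"
          using \<beta> t s(1) by (simp add: divide_strict_right_mono)
        ultimately have "norm ((t / s) *\<^sub>R \<beta>) < (1 - t / s) * r" by linarith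
        then have "(t / s) *\<^sub>R b + (1 - t / s) *\<^sub>R x0 + (t / s) *\<^sub>R \<beta> \<in> \<Omega>"
          using ts t s(1) by (intro shrink_in_dom b(1)) auto
        moreover have "(t / s) *\<^sub>R b + (1 - t / s) *\<^sub>R x0 + (t / s) *\<^sub>R \<beta> = x0 + t *\<^sub>R (x - x0)"
        proof -
          have "(t / s) *\<^sub>R b + (t / s) *\<^sub>R \<beta> = (t / s) *\<^sub>R x0 + (t / s) *\<^sub>R (s *\<^sub>R (x - x0))"
            unfolding scaleR_add_right[symmetric] by (simp add: \<beta>_def)
          moreover have "(t / s) *\<^sub>R (s *\<^sub>R (x - x0)) = t *\<^sub>R (x - x0)" using s(1) by simp
          moreover have "(1 - t / s) *\<^sub>R x0 = x0 - (t / s) *\<^sub>R x0" by (simp add: scaleR_diff_left)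
          moreover have "p + w = X + Y \<Longrightarrow> Y = Z \<Longrightarrow> O' = x0 - X \<Longrightarrow> p + O' + w = x0 + Z" for p w X Y Z O' :: R3
            by (metis add.assoc add.commute add_diff_cancel_left' diff_add_cancel)
          ultimately show ?thesis by blast
        qed
        ultimately show False using E3[OF x] by simp
      qed
      have "t * (1 + q) \<le> (1 + q) * (1 + q)" using t q by (intro mult_right_mono) auto
      also have "\<dots> \<le> 1 + 3 * q" using q mult_right_mono[of q 1 q] by (simp add: algebra_simps)
      finally have sb: "\<bar>1 - s\<bar> \<le> 3 * q" using low up q by linarith
      have "norm (x - b) = norm ((1 - s) *\<^sub>R (x - x0) + \<beta>)" by (simp add: \<beta>_def algebra_simps)
      also have "\<dots> \<le> \<bar>1 - s\<bar> * norm (x - x0) + norm \<beta>"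
        using norm_triangle_ineq[of "(1 - s) *\<^sub>R (x - x0)" \<beta>] by simp
      also have "\<dots> \<le> (3 * q) * d + \<theta>"
        using sb dd[OF xO] q \<beta> by (intro add_mono mult_mono) auto
      also have "\<dots> = q * (3 * d + r)" by (simp add: \<theta>_def algebra_simps)
      finally show ?thesis using q\<eta> by (simp add: dist_norm)
    qed
    have mE: "measure lebesgue E = m - m / t ^ 3"
    proof -
      have "P \<in> lmeasurable" by (rule lmeasurable_open[OF bounded_subset[OF A(2) PA] oP])
      then show ?thesis
        using measurable_measure_Diff[OF mA _ PA] mP by (simp add: fmeasurableD E_def m_def)
    qed
    have ElM: "E \<in> lmeasurable"
      unfolding E_def by (rule fmeasurable.Diff[OF mA lmeasurable_open[OF bounded_subset[OF A(2) PA] oP]])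
    have uL: "L2 E u"
      using u by (intro L2_subset[OF _ Eb(2) sE sets_dom]) (simp add: H10_def H1_def)
    have aeE: "AE x in lebesgue_on E. c\<^sup>2 \<le> (u x)\<^sup>2"
    proof -
      have "AE x in lebesgue. x \<in> \<Omega> \<longrightarrow> ut x = u x"
        using ut(2) sets_dom by (subst (asm) AE_restrict_space_iff) auto
      then have "AE x in lebesgue. x \<in> E \<longrightarrow> c\<^sup>2 \<le> (u x)\<^sup>2"
      proof eventually_elim
        case (elim x)
        show ?case
        proof
          assume x: "x \<in> E"
          then have "ut x = u x" using elim Eb(2) by blast
          moreover have "c \<le> \<bar>ut x\<bar>" using utc[OF _ close[OF x]] x Eb(2) closure_subset by blast
          ultimately show "c\<^sup>2 \<le> (u x)\<^sup>2" using c by (simp add: abs_le_square_iff[symmetric])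
        qed
      qed
      then show ?thesis using sE by (subst AE_restrict_space_iff) auto
    qed
    interpret fE: finite_measure "lebesgue_on E" by (rule finite_measure_lebesgue_on[OF ElM])
    have "c\<^sup>2 * (m - m / t ^ 3) = (\<integral>x. c\<^sup>2 \<partial>lebesgue_on E)"
      using sE by (simp add: measure_restrict_space mE[symmetric] mult.commute)
    also have "\<dots> \<le> (\<integral>x. (u x)\<^sup>2 \<partial>lebesgue_on E)"
      by (rule integral_mono_AE[OF _ L2_sq_integrable[OF uL] aeE]) simp
    also have "\<dots> \<le> (t - 1)\<^sup>2 * d\<^sup>2 * G"
      unfolding G_def using t by (intro H10_boundary_layer[OF u _ dd Eb E3]) auto
    finally have 1: "c\<^sup>2 * (m - m / t ^ 3) \<le> (t - 1)\<^sup>2 * d\<^sup>2 * G" .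
    \<comment> \<open>The relative volume of the layer is at least linear in \<open>t - 1\<close>,
      as \<open>t \<le> 2\<close>.\<close>
    have "(t - 1) / 2 \<le> 1 - 1 / t ^ 3"
    proof -
      have t2: "t \<le> 2" using t q by simp
      have "(t - 1) / 2 \<le> (t - 1) / t" using t t2 by (intro divide_left_mono) auto
      also have "\<dots> = 1 - 1 / t" using t by (simp add: field_simps)
      also have "\<dots> \<le> 1 - 1 / t ^ 3"
        using t power_increasing[of 1 3 t] by (intro diff_left_mono divide_left_mono) auto
      finally show ?thesis .
    qed
    then have "(c\<^sup>2 * m) * ((t - 1) / 2) \<le> (c\<^sup>2 * m) * (1 - 1 / t ^ 3)"
      using m by (intro mult_left_mono) auto
    also have "\<dots> = c\<^sup>2 * (m - m / t ^ 3)" by (simp add: algebra_simps)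
    also note 1
    also have "(t - 1)\<^sup>2 * d\<^sup>2 * G = (t - 1) * ((t - 1) * (d\<^sup>2 * G))" by (simp add: power2_eq_square)
    also have "c\<^sup>2 * m * ((t - 1) / 2) = (t - 1) * (c\<^sup>2 * m / 2)" by simp
    finally have "(t - 1) * (c\<^sup>2 * m / 2) \<le> (t - 1) * ((t - 1) * (d\<^sup>2 * G))" .
    then show ?thesis using t by simp
  qed
  \<comment> \<open>Small enough that the right-hand side of \<open>main\<close> is at most half of
    its left-hand side; the \<open>+ 1\<close> covers \<open>G = 0\<close>.\<close>
  define \<epsilon> where "\<epsilon> = min q (c\<^sup>2 * m / (4 * (d\<^sup>2 * G + 1)))"
  have dG: "d\<^sup>2 * G + 1 > 0" using G0 by (simp add: add_nonneg_pos)
  have cm: "c\<^sup>2 * m > 0" using c m by simp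
  have \<epsilon>: "\<epsilon> > 0" "\<epsilon> \<le> q" using q cm dG by (auto simp: \<epsilon>_def)
  have "c\<^sup>2 * m / 2 \<le> \<epsilon> * (d\<^sup>2 * G)" using main[of "1 + \<epsilon>"] \<epsilon> by simp
  also have "\<dots> \<le> c\<^sup>2 * m / (4 * (d\<^sup>2 * G + 1)) * (d\<^sup>2 * G + 1)"
    using G0 cm dG by (intro mult_mono) (auto simp: \<epsilon>_def)
  also have "\<dots> = c\<^sup>2 * m / 4" using dG by (simp add: field_simps)
  finally show False using cm by argo
qed

section \<open>Meshes and nodal interpolation\<close>

lemma simplex3_interior_nonempty:
  fixes T :: "R3 set" assumes "3 simplex T" shows "interior T \<noteq> {}"
proof -
  have "aff_dim T = int DIM(R3)" using aff_dim_simplex[OF assms] by simp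
  then have "interior T = rel_interior T" by (simp add: interior_rel_interior_gen)
  moreover have "T \<noteq> {}" using assms by auto
  ultimately show ?thesis using convex_simplex[OF assms] by (simp add: rel_interior_eq_empty)
qed

lemma simplex3_extreme_points:
  fixes T :: "R3 set" assumes "3 simplex T"
  shows "finite {x. x extreme_point_of T}" "card {x. x extreme_point_of T} = 4"
    "\<not> affine_dependent {x. x extreme_point_of T}"
proof -
  obtain C where C: "\<not> affine_dependent C" "int (card C) = 3 + 1" "T = convex hull C"
    using assms unfolding simplex_def by blast
  have "{x. x extreme_point_of T} = C"
    using C extreme_point_of_convex_hull_affine_independent[OF C(1)] by auto
  then show "finite {x. x extreme_point_of T}" "card {x. x extreme_point_of T} = 4"
    "\<not> affine_dependent {x. x extreme_point_of T}"
    using C aff_independent_finite by auto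
qed

text \<open>After one point is translated to the origin the others are linearly independent, so the
  prescribed increments extend to a linear map; its adjoint gives the slope vector.\<close>

lemma affine_interpolation:
  fixes C :: "R3 set" and f :: "R3 \<Rightarrow> real"
  assumes "\<not> affine_dependent C"
  shows "\<exists>a b. \<forall>x\<in>C. a \<bullet> x + b = f x"
proof (cases "C = {}")
  case False
  then obtain c0 where c0: "c0 \<in> C" by blast
  let ?B = "(\<lambda>x. - c0 + x) ` (C - {c0})"
  have "independent ?B" using assms affine_dependent_iff_dependent2[OF c0] by simp
  then obtain g :: "R3 \<Rightarrow> real" where g: "linear g" "\<forall>y\<in>?B. g y = f (c0 + y) - f c0"
    using linear_independent_extend[of ?B "\<lambda>y. f (c0 + y) - f c0"] by blast
  define a where "a = adjoint g 1"
  have ga: "g x = a \<bullet> x" for x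
    using adjoint_works[OF g(1), of x 1] by (simp add: a_def inner_commute)
  have "a \<bullet> x + (f c0 - a \<bullet> c0) = f x" if x: "x \<in> C" for x
  proof (cases "x = c0")
    case False
    then have "g (- c0 + x) = f x - f c0" using g(2) x by force
    then show ?thesis unfolding ga by (simp add: inner_diff_right)
  qed simp
  then show ?thesis by blast
qed auto

text \<open>The agreement set of two affine functions is convex, and a compact convex set is the
  hull of its extreme points. Applied to faces of elements, whose extreme points are
  vertices.\<close>

lemma affine_eq_on_compact_convex:
  fixes F :: "R3 set"
  assumes "compact F" "convex F" "\<And>y. y extreme_point_of F \<Longrightarrow> a \<bullet> y + b = a' \<bullet> y + b'" "x \<in> F"
  shows "a \<bullet> x + b = a' \<bullet> x + b'"
proof -
  have "{x. x extreme_point_of F} \<subseteq> {x. (a - a') \<bullet> x = b' - b}"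
    using assms(3) by (auto simp: inner_diff_left algebra_simps)
  then have "convex hull {x. x extreme_point_of F} \<subseteq> {x. (a - a') \<bullet> x = b' - b}"
    by (intro hull_minimal convex_hyperplane)
  then have "(a - a') \<bullet> x = b' - b"
    using Krein_Milman_Minkowski[OF assms(1,2)] assms(4) by blast
  then show ?thesis by (simp add: inner_diff_left algebra_simps)
qed

locale mesh_domain = convex_domain +
  fixes M :: "R3 set set"
  assumes mesh: "admissible_mesh \<Omega> M"
begin

lemma meshD:
  "finite M" "M \<noteq> {}" "\<And>T. T \<in> M \<Longrightarrow> 3 simplex T" "\<Union>M = closure \<Omega>"
  "\<And>T1 T2. T1 \<in> M \<Longrightarrow> T2 \<in> M \<Longrightarrow> (T1 \<inter> T2) face_of T1"
  "\<And>T1 T2. T1 \<in> M \<Longrightarrow> T2 \<in> M \<Longrightarrow> (T1 \<inter> T2) face_of T2"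
  using mesh unfolding admissible_mesh_def by auto

lemma element:
  assumes "T \<in> M"
  shows "compact T" "convex T" "closed T" "T \<subseteq> closure \<Omega>" "interior T \<noteq> {}" "interior T \<subseteq> \<Omega>" "closure (interior T) = T"
proof -
  have s: "3 simplex T" using meshD assms by blast
  show c: "compact T" "convex T" "closed T" using compact_simplex[OF s] convex_simplex[OF s] closed_simplex[OF s] .
  show sub: "T \<subseteq> closure \<Omega>" using meshD(4) assms by blast
  show i: "interior T \<noteq> {}" by (rule simplex3_interior_nonempty[OF s])
  \<comment> \<open>An open convex set is the interior of its closure, so elements, known to lie in
    the closure, have their interiors in \<Omega>.\<close>
  have "interior T \<subseteq> interior (closure \<Omega>)" by (rule interior_mono[OF sub])
  then show "interior T \<subseteq> \<Omega>" using convex_interior_closure[OF convex_dom] interior_open[OF open_dom] by simp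
  show "closure (interior T) = T" using convex_closure_interior[OF c(2) i] c(3) by simp
qed

text \<open>A face that meets the interior of a convex set is the whole set; the intersection of two
  elements is a face of both.\<close>

lemma interiors_disjoint:
  assumes "T1 \<in> M" "T2 \<in> M" "x \<in> interior T1" "x \<in> interior T2" shows "T1 = T2"
proof -
  have x: "x \<in> T1 \<inter> T2" using assms(3,4) interior_subset by blast
  have "T1 \<inter> T2 = T1"
    using face_of_disjoint_interior[OF meshD(5)[OF assms(1,2)]] x assms(3) by blast
  moreover have "T1 \<inter> T2 = T2"
    using face_of_disjoint_interior[OF meshD(6)[OF assms(1,2)]] x assms(4) by blast
  ultimately show ?thesis by simp
qed

section \<open>Piecewise constant gradients and Green's formula for finite element functions\<close>

definition skeleton :: "R3 set" where "skeleton = (\<Union>T\<in>M. frontier T)"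

lemma skeleton_null: "skeleton \<in> null_sets lborel"
proof -
  have "frontier T \<in> null_sets lborel" if "T \<in> M" for T
    using negligible_convex_frontier[OF element(2)[OF that]]
    by (simp add: negligible_iff_null_sets null_sets_completion_iff)
  then show ?thesis unfolding skeleton_def using meshD(1) by (intro null_sets_UN' countable_finite) auto
qed

lemma off_skeleton:
  assumes "x \<notin> skeleton" "x \<in> closure \<Omega>"
  obtains T where "T \<in> M" "x \<in> interior T"
proof -
  obtain T where T: "T \<in> M" "x \<in> T" using assms(2) meshD(4) by blast
  then have "x \<notin> frontier T" using assms(1) by (auto simp: skeleton_def)
  then have "x \<in> interior T" using T element(3)[OF T(1)] by (simp add: frontier_def)
  then show ?thesis using that T by blast
qed

text \<open>A sum of indicators of open interiors instead of a case distinction: Borel measurability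
  and the global bound are immediate, and the values on the null set \<open>skeleton\<close> do not
  matter.\<close>

definition pw_const :: "(R3 set \<Rightarrow> real) \<Rightarrow> R3 \<Rightarrow> real" where
  "pw_const c x = (\<Sum>T\<in>M. indicator (interior T) x * c T)"

lemma pw_const_eq: assumes "T \<in> M" "x \<in> interior T" shows "pw_const c x = c T"
proof -
  have "pw_const c x = (\<Sum>T'\<in>M. if T' = T then c T else 0)"
    unfolding pw_const_def
  proof (rule sum.cong[OF refl])
    fix T' assume "T' \<in> M"
    then have "x \<in> interior T' \<longleftrightarrow> T' = T" using interiors_disjoint[OF _ assms(1) _ assms(2)] assms(2) by blast
    then show "indicator (interior T') x * c T' = (if T' = T then c T else 0)" by (simp add: indicator_def)
  qed
  then show ?thesis using assms meshD(1) by simp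
qed

lemma pw_const_measurable: "pw_const c \<in> borel_measurable borel"
  unfolding pw_const_def[abs_def]
  by (intro borel_measurable_sum borel_measurable_times borel_measurable_indicator borel_measurable_const borel_open open_interior)

lemma pw_const_outside: "x \<notin> \<Omega> \<Longrightarrow> pw_const c x = 0"
  unfolding pw_const_def using element(6) by (intro sum.neutral) (auto simp: indicator_def)

lemma pw_const_bound: "\<bar>pw_const c x\<bar> \<le> (\<Sum>T\<in>M. \<bar>c T\<bar>)"
  unfolding pw_const_def by (intro order_trans[OF sum_abs] sum_mono) (auto simp: indicator_def)

lemma L2_pw_const: "L2 \<Omega> (pw_const c)"
  by (rule L2_bounded[OF borel_measurable_lebesgue_on[OF pw_const_measurable] lmeasurable_dom pw_const_bound])

lemma Vh_coeffs:
  assumes "v \<in> Vh \<Omega> M"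
  obtains a b where "\<And>T x. T \<in> M \<Longrightarrow> x \<in> T \<Longrightarrow> v x = a T \<bullet> x + b T"
proof -
  have "\<forall>T\<in>M. \<exists>a b. \<forall>x\<in>T. v x = a \<bullet> x + b" using assms by (simp add: Vh_def)
  then show ?thesis using that by metis
qed

text \<open>Restrict to the segment from \<open>y\<close> to \<open>x\<close>: the preimages of the
  elements and of the complement of \<Omega> are finitely many closed sets covering it,
  \<open>v\<close> has the same Lipschitz constant on each, and on an interval such bounds can be
  glued.\<close>

lemma Vh_lipschitz:
  assumes v: "v \<in> Vh \<Omega> M" and ab: "\<And>T x. T \<in> M \<Longrightarrow> x \<in> T \<Longrightarrow> v x = a T \<bullet> x + b T"
  shows "\<bar>v x - v y\<bar> \<le> (\<Sum>T\<in>M. norm (a T)) * norm (x - y)"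
proof -
  define L where "L = (\<Sum>T\<in>M. norm (a T))"
  have L0: "L \<ge> 0" unfolding L_def by (simp add: sum_nonneg)
  define p where "p t = y + t *\<^sub>R (x - y)" for t :: real
  have pc: "continuous_on UNIV p" unfolding p_def by (intro continuous_intros)
  have pd: "p s - p t = (s - t) *\<^sub>R (x - y)" for s t by (simp add: p_def algebra_simps)
  have out: "v z = 0" if "z \<notin> \<Omega>" for z using v that by (simp add: Vh_def)
  have "(L * norm (x - y))-lipschitz_on {0..1} (\<lambda>t. v (p t))"
  proof (rule lipschitz_on_closed_Union[where I = "insert (- \<Omega>) M" and U = "\<lambda>S. p -` S"])
    fix S assume S: "S \<in> insert (- \<Omega>) M"
    show "closed (p -` S)" using S element(3) open_dom by (intro closed_vimage pc) auto
    show "(L * norm (x - y))-lipschitz_on (p -` S) (\<lambda>t. v (p t))"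
    proof (rule lipschitz_onI)
      fix s t assume st: "s \<in> p -` S" "t \<in> p -` S"
      show "dist (v (p s)) (v (p t)) \<le> L * norm (x - y) * dist s t"
      proof (cases "S \<in> M")
        case True
        have "v (p s) - v (p t) = a S \<bullet> (p s - p t)" using ab[OF True] st by (simp add: inner_diff_right)
        also have "\<bar>\<dots>\<bar> \<le> norm (a S) * norm (p s - p t)" by (rule Cauchy_Schwarz_ineq2)
        also have "\<dots> \<le> L * norm (p s - p t)"
          unfolding L_def using True meshD(1) by (intro mult_right_mono member_le_sum) auto
        also have "\<dots> = L * norm (x - y) * dist s t" unfolding pd by (simp add: dist_real_def)
        finally show ?thesis by (simp add: dist_real_def)
      next
        case False
        then have "S = - \<Omega>" using S by simp
        then have "v (p s) = 0" "v (p t) = 0" using st out by auto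
        then show ?thesis using L0 by simp
      qed
    qed (use L0 in simp)
  next
    show "{0..1} \<subseteq> (\<Union>S\<in>insert (- \<Omega>) M. p -` S)"
    proof
      fix t
      have "p t \<in> \<Omega> \<Longrightarrow> p t \<in> \<Union>M" using meshD(4) closure_subset by blast
      then show "t \<in> (\<Union>S\<in>insert (- \<Omega>) M. p -` S)" by auto
    qed
  qed (use L0 meshD(1) in auto)
  from lipschitz_onD[OF this, of 1 0] show ?thesis by (simp add: p_def dist_real_def L_def)
qed

text \<open>Off the skeleton a point lies in the interior of an element or outside the closed
  domain, and there the quotients are eventually constant.\<close>

lemma Vh_difference_quotient:
  assumes v: "v \<in> Vh \<Omega> M" and ab: "\<And>T x. T \<in> M \<Longrightarrow> x \<in> T \<Longrightarrow> v x = a T \<bullet> x + b T"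
  shows "AE x in lborel. (\<lambda>n. (v (x + (1 / real (Suc n)) *\<^sub>R axis i 1) - v x) / (1 / real (Suc n))) \<longlonglongrightarrow> pw_const (\<lambda>T. a T $ i) x"
proof -
  have out: "v z = 0" if "z \<notin> \<Omega>" for z using v that by (simp add: Vh_def)
  have "AE x in lborel. x \<notin> skeleton" by (rule AE_not_in[OF skeleton_null])
  then show ?thesis
  proof eventually_elim
    case (elim x)
    let ?h = "\<lambda>n. 1 / real (Suc n)"
    have hl: "(\<lambda>n. x + ?h n *\<^sub>R axis i 1) \<longlonglongrightarrow> x"
    proof -
      have "?h \<longlonglongrightarrow> 0" using LIMSEQ_inverse_real_of_nat by (simp add: inverse_eq_divide)
      then have "(\<lambda>n. x + ?h n *\<^sub>R axis i 1) \<longlonglongrightarrow> x + 0 *\<^sub>R axis i 1" by (intro tendsto_add tendsto_scaleR tendsto_const)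
      then show ?thesis by simp
    qed
    show ?case
    proof (cases "x \<in> closure \<Omega>")
      case True
      obtain T where T: "T \<in> M" "x \<in> interior T" using off_skeleton[OF elim True] by blast
      have "\<forall>\<^sub>F n in sequentially. x + ?h n *\<^sub>R axis i 1 \<in> interior T"
        by (rule topological_tendstoD[OF hl open_interior T(2)])
      then have "\<forall>\<^sub>F n in sequentially. (v (x + ?h n *\<^sub>R axis i 1) - v x) / ?h n = pw_const (\<lambda>T. a T $ i) x"
      proof eventually_elim
        case (elim n)
        have "v (x + ?h n *\<^sub>R axis i 1) - v x = ?h n * (a T $ i)"
          using ab[OF T(1)] elim T(2) interior_subset[of T]
          by (auto simp: inner_add_right inner_axis subset_iff)
        then show ?case using pw_const_eq[OF T] by simp
      qed
      then show ?thesis by (rule tendsto_eventually)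
    next
      case False
      have "\<forall>\<^sub>F n in sequentially. x + ?h n *\<^sub>R axis i 1 \<in> - closure \<Omega>"
        by (rule topological_tendstoD[OF hl]) (use False in auto)
      then have "\<forall>\<^sub>F n in sequentially. (v (x + ?h n *\<^sub>R axis i 1) - v x) / ?h n = pw_const (\<lambda>T. a T $ i) x"
      proof eventually_elim
        case (elim n)
        have "x \<notin> \<Omega>" "x + ?h n *\<^sub>R axis i 1 \<notin> \<Omega>" using False elim closure_subset by blast+
        then show ?case using out pw_const_outside by simp
      qed
      then show ?thesis by (rule tendsto_eventually)
    qed
  qed
qed

lemma Vh_integration_by_parts:
  assumes v: "v \<in> Vh \<Omega> M" and ab: "\<And>T x. T \<in> M \<Longrightarrow> x \<in> T \<Longrightarrow> v x = a T \<bullet> x + b T"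
    and \<psi>: "test_fun UNIV \<psi>"
  shows "(\<integral>x. v x * pd i \<psi> x \<partial>lborel) = - (\<integral>x. pw_const (\<lambda>T. a T $ i) x * \<psi> x \<partial>lborel)"
proof -
  obtain R where R: "\<Omega> \<subseteq> ball 0 R" using bounded_dom bounded_subset_ballD[of \<Omega> 0] by blast
  have out: "v z = 0" if "z \<notin> ball 0 R" for z using v that R by (auto simp: Vh_def)
  show ?thesis
    by (rule lipschitz_integration_by_parts[OF Vh_lipschitz[OF v ab] out pw_const_measurable Vh_difference_quotient[OF v ab] \<psi>])
qed

lemma Vh_continuous:
  assumes v: "v \<in> Vh \<Omega> M" shows "continuous_on UNIV v"
proof -
  obtain a b where ab: "\<And>T x. T \<in> M \<Longrightarrow> x \<in> T \<Longrightarrow> v x = a T \<bullet> x + b T" using Vh_coeffs[OF v] by blast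
  show ?thesis
    by (rule lipschitz_on_continuous_on[where L = "\<Sum>T\<in>M. norm (a T)"], rule lipschitz_onI)
      (use Vh_lipschitz[OF v ab] in \<open>auto simp: dist_norm sum_nonneg\<close>)
qed

lemma Vh_L2: "v \<in> Vh \<Omega> M \<Longrightarrow> L2 \<Omega> v"
  by (rule L2_continuous[OF Vh_continuous bounded_dom lmeasurable_dom])

lemma Vh_weak_deriv1:
  assumes v: "v \<in> Vh \<Omega> M" and ab: "\<And>T x. T \<in> M \<Longrightarrow> x \<in> T \<Longrightarrow> v x = a T \<bullet> x + b T"
  shows "weak_deriv1 \<Omega> v i (pw_const (\<lambda>T. a T $ i))"
  unfolding weak_deriv1_def
proof (intro allI impI)
  fix \<phi> assume t: "test_fun \<Omega> \<phi>"
  note U = test_fun_UNIV[OF t]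
  have m: "v \<in> borel_measurable borel" "\<phi> \<in> borel_measurable borel" "pd i \<phi> \<in> borel_measurable borel"
    by (intro borel_measurable_continuous_onI Vh_continuous[OF v] test_fun_continuous[OF t] test_fun_continuous[OF test_fun_pd[OF t]])+
  have Ob: "\<Omega> \<in> sets borel" using open_dom by simp
  have "(\<integral>x. v x * pd i \<phi> x \<partial>lebesgue_on \<Omega>) = (\<integral>x. v x * pd i \<phi> x \<partial>lborel)"
    by (rule integral_lebesgue_on_eq_lborel[OF Ob]) (use m v in \<open>auto simp: Vh_def\<close>)
  moreover have "(\<integral>x. pw_const (\<lambda>T. a T $ i) x * \<phi> x \<partial>lebesgue_on \<Omega>) = (\<integral>x. pw_const (\<lambda>T. a T $ i) x * \<phi> x \<partial>lborel)"
    by (rule integral_lebesgue_on_eq_lborel[OF Ob]) (use m pw_const_measurable pw_const_outside in auto)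
  ultimately show "(\<integral>x. v x * pd i \<phi> x \<partial>lebesgue_on \<Omega>) = - (\<integral>x. pw_const (\<lambda>T. a T $ i) x * \<phi> x \<partial>lebesgue_on \<Omega>)"
    using Vh_integration_by_parts[OF v ab U] by simp
qed

text \<open>There is no boundary term because \<open>v\<close> vanishes outside \<Omega>; in the
  application \<open>w\<close> is a component of the weak gradient of the target, which satisfies no
  boundary condition.\<close>

lemma Vh_green:
  assumes v: "v \<in> Vh \<Omega> M" and ab: "\<And>T x. T \<in> M \<Longrightarrow> x \<in> T \<Longrightarrow> v x = a T \<bullet> x + b T"
    and w: "L2 \<Omega> w" "L2 \<Omega> g" "weak_deriv1 \<Omega> w i g"
  shows "(\<integral>x. w x * pw_const (\<lambda>T. a T $ i) x \<partial>lebesgue_on \<Omega>) = - (\<integral>x. g x * v x \<partial>lebesgue_on \<Omega>)"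
  by (rule weak_deriv_against_zero_extension[OF Vh_continuous[OF v] _ pw_const_measurable pw_const_bound pw_const_outside
        Vh_integration_by_parts[OF v ab] w]) (use v in \<open>auto simp: Vh_def\<close>)

lemma Vh_diff:
  assumes "u \<in> Vh \<Omega> M" "v \<in> Vh \<Omega> M" shows "(\<lambda>x. u x - v x) \<in> Vh \<Omega> M"
  unfolding Vh_def
proof (intro CollectI conjI ballI allI impI)
  show "continuous_on (closure \<Omega>) (\<lambda>x. u x - v x)" using assms by (auto simp: Vh_def intro!: continuous_intros)
  show "u x - v x = 0" if "x \<notin> \<Omega>" for x using assms that by (simp add: Vh_def)
  fix T assume T: "T \<in> M"
  obtain a b a' b' where "\<forall>x\<in>T. u x = a \<bullet> x + b" "\<forall>x\<in>T. v x = a' \<bullet> x + b'"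
    using assms T by (auto simp: Vh_def) metis
  then have "\<forall>x\<in>T. u x - v x = (a - a') \<bullet> x + (b - b')" by (simp add: inner_diff_left)
  then show "\<exists>a b. \<forall>x\<in>T. u x - v x = a \<bullet> x + b" by blast
qed

text \<open>Conformity of the mesh makes the element-wise interpolants fit together; convexity of
  \<Omega> spreads the zero values from the boundary nodes to the whole boundary.\<close>

lemma nodal_interpolant:
  assumes "\<And>x. x \<in> closure \<Omega> \<Longrightarrow> x \<notin> \<Omega> \<Longrightarrow> ut x = 0"
  obtains v a b where "v \<in> Vh \<Omega> M" "\<forall>T\<in>M. \<forall>x\<in>T. v x = a T \<bullet> x + b T"
    "\<forall>T\<in>M. \<forall>x. x extreme_point_of T \<longrightarrow> a T \<bullet> x + b T = ut x"
proof -
  have "\<forall>T\<in>M. \<exists>a b. \<forall>x\<in>{x. x extreme_point_of T}. a \<bullet> x + b = ut x"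
    using affine_interpolation[OF simplex3_extreme_points(3)[OF meshD(3)]] by blast
  then obtain a b where ab: "\<And>T x. T \<in> M \<Longrightarrow> x extreme_point_of T \<Longrightarrow> a T \<bullet> x + b T = ut x"
    by (metis mem_Collect_eq)
  \<comment> \<open>An arbitrary element containing \<open>x\<close>; \<open>agree\<close> shows
    that the choice does not matter.\<close>
  define el where "el x = (SOME T. T \<in> M \<and> x \<in> T)" for x
  define v where "v x = (if x \<in> \<Omega> then a (el x) \<bullet> x + b (el x) else 0)" for x
  have agree: "a T1 \<bullet> x + b T1 = a T2 \<bullet> x + b T2" if T: "T1 \<in> M" "T2 \<in> M" "x \<in> T1" "x \<in> T2" for T1 T2 x
  proof (rule affine_eq_on_compact_convex)
    show "compact (T1 \<inter> T2)" "convex (T1 \<inter> T2)"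
      using element(1,2,3) T by (auto intro: compact_Int convex_Int)
    show "a T1 \<bullet> y + b T1 = a T2 \<bullet> y + b T2" if "y extreme_point_of (T1 \<inter> T2)" for y
      using that ab extreme_point_of_face[OF meshD(5)[OF T(1,2)]] extreme_point_of_face[OF meshD(6)[OF T(1,2)]] T by metis
  qed (use T in auto)
  \<comment> \<open>A hyperplane supporting \<Omega> at \<open>x\<close> cuts a face out of
    \<open>T\<close>; it misses the open set \<Omega>, so the vertices of that face are boundary
    points with nodal value 0.\<close>
  have bdry: "a T \<bullet> x + b T = 0" if T: "T \<in> M" "x \<in> T" "x \<notin> \<Omega>" for T x
  proof -
    have xc: "x \<in> closure \<Omega>" using element(4)[OF T(1)] T(2) by blast
    have ri: "rel_interior \<Omega> = \<Omega>" by (rule rel_interior_open[OF open_dom])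
    obtain n where n: "\<And>y. y \<in> closure \<Omega> \<Longrightarrow> n \<bullet> x \<le> n \<bullet> y" "\<And>y. y \<in> \<Omega> \<Longrightarrow> n \<bullet> x < n \<bullet> y"
      using supporting_hyperplane_relative_frontier[OF convex_dom xc] T(3) unfolding ri by metis
    let ?F = "T \<inter> {y. n \<bullet> y = n \<bullet> x}"
    have F: "?F face_of T"
      by (rule face_of_Int_supporting_hyperplane_ge) (use element(2,4)[OF T(1)] n(1) in auto)
    have "a T \<bullet> x + b T = 0 \<bullet> x + 0"
    proof (rule affine_eq_on_compact_convex)
      show "compact ?F" by (intro compact_Int_closed element(1)[OF T(1)] closed_hyperplane)
      show "convex ?F" by (intro convex_Int element(2)[OF T(1)] convex_hyperplane)
      show "x \<in> ?F" using T by simp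
      fix y assume "y extreme_point_of ?F"
      then have y: "y extreme_point_of T" "y \<in> ?F" using extreme_point_of_face[OF F] by auto
      have "y \<in> closure \<Omega>" "y \<notin> \<Omega>" using y(2) element(4)[OF T(1)] n(2)[of y] by auto
      then have "ut y = 0" by (rule assms)
      then show "a T \<bullet> y + b T = 0 \<bullet> y + 0" using ab[OF T(1) y(1)] by simp
    qed
    then show ?thesis by simp
  qed
  have veq: "v x = a T \<bullet> x + b T" if T: "T \<in> M" "x \<in> T" for T x
  proof (cases "x \<in> \<Omega>")
    case True
    have "el x \<in> M \<and> x \<in> el x" unfolding el_def by (rule someI[of _ T]) (use T in simp)
    then show ?thesis using True agree[of "el x" T x] T by (simp add: v_def)
  next
    case False
    then show ?thesis using bdry[OF T] by (simp add: v_def)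
  qed
  have "v \<in> Vh \<Omega> M"
    unfolding Vh_def
  proof (intro CollectI conjI ballI allI impI)
    have "continuous_on (\<Union>T\<in>M. T) v"
    proof (rule continuous_on_closed_Union[OF meshD(1)])
      fix T assume T: "T \<in> M"
      show "closed T" by (rule element(3)[OF T])
      have "continuous_on T (\<lambda>x. a T \<bullet> x + b T)" by (intro continuous_intros)
      then show "continuous_on T v" using veq[OF T] by (simp cong: continuous_on_cong)
    qed
    then show "continuous_on (closure \<Omega>) v" using meshD(4) by simp
    show "v x = 0" if "x \<notin> \<Omega>" for x using that by (simp add: v_def)
    show "\<exists>a b. \<forall>x\<in>T. v x = a \<bullet> x + b" if "T \<in> M" for T using veq[OF that] by blast
  qed
  then show ?thesis using that veq ab by blast
qed

lemma integral_dom_eq_sum: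
  fixes f :: "R3 \<Rightarrow> real"
  assumes "integrable (lebesgue_on \<Omega>) f"
  shows "(\<integral>x. f x \<partial>lebesgue_on \<Omega>) = (\<Sum>T\<in>M. \<integral>x. f x \<partial>lebesgue_on (interior T))"
proof -
  have s: "interior T \<in> sets lebesgue" for T :: "R3 set" by simp
  have i: "integrable lebesgue (\<lambda>x. indicator (interior T) x *\<^sub>R f x)" if "T \<in> M" for T
    using integrable_lebesgue_on_subset[OF assms element(6)[OF that] s sets_dom]
    by (subst (asm) integrable_restrict_space) auto
  have "AE x in lebesgue. x \<notin> skeleton" using AE_not_in[OF null_sets_completionI[OF skeleton_null]] .
  then have ae: "AE x in lebesgue. indicator \<Omega> x *\<^sub>R f x = (\<Sum>T\<in>M. indicator (interior T) x *\<^sub>R f x)"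
  proof eventually_elim
    case (elim x)
    \<comment> \<open>With \<open>x\<close> frozen, the sum is \<open>pw_const\<close> of a constant
      family, so the evaluation lemmas for \<open>pw_const\<close> apply.\<close>
    have e: "(\<Sum>T\<in>M. indicator (interior T) x *\<^sub>R f x) = pw_const (\<lambda>_. f x) x" by (simp add: pw_const_def)
    show ?case
    proof (cases "x \<in> \<Omega>")
      case True
      then obtain T where "T \<in> M" "x \<in> interior T" using off_skeleton[OF elim] closure_subset by blast
      then show ?thesis using True pw_const_eq e by simp
    qed (use pw_const_outside e in simp)
  qed
  have "(\<integral>x. f x \<partial>lebesgue_on \<Omega>) = (\<integral>x. indicator \<Omega> x *\<^sub>R f x \<partial>lebesgue)"
    using sets_dom by (subst integral_restrict_space) auto
  also have "\<dots> = (\<integral>x. (\<Sum>T\<in>M. indicator (interior T) x *\<^sub>R f x) \<partial>lebesgue)"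
  proof (rule integral_cong_AE[OF _ _ ae])
    show "(\<lambda>x. indicator \<Omega> x *\<^sub>R f x) \<in> borel_measurable lebesgue"
      using assms sets_dom by (subst (asm) integrable_restrict_space) auto
    show "(\<lambda>x. \<Sum>T\<in>M. indicator (interior T) x *\<^sub>R f x) \<in> borel_measurable lebesgue"
      using i by (intro borel_measurable_sum) auto
  qed
  also have "\<dots> = (\<Sum>T\<in>M. \<integral>x. indicator (interior T) x *\<^sub>R f x \<partial>lebesgue)"
    using i by (rule Bochner_Integration.integral_sum)
  also have "\<dots> = (\<Sum>T\<in>M. \<integral>x. f x \<partial>lebesgue_on (interior T))"
    by (intro sum.cong refl, subst integral_restrict_space) auto
  finally show ?thesis .
qed

end

section \<open>Galerkin error\<close>

text \<open>The slab where the affine function is bounded by \<open>\<mu>\<close> is convex and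
  contains the extreme points, hence their hull.\<close>

lemma affine_abs_bound:
  fixes T :: "R3 set"
  assumes "compact T" "convex T" "\<And>y. y extreme_point_of T \<Longrightarrow> \<bar>q \<bullet> y + k\<bar> \<le> \<mu>" "x \<in> T"
  shows "\<bar>q \<bullet> x + k\<bar> \<le> \<mu>"
proof -
  let ?H = "{y. q \<bullet> y \<le> \<mu> - k} \<inter> {y. q \<bullet> y \<ge> - \<mu> - k}"
  have "{x. x extreme_point_of T} \<subseteq> ?H"
  proof
    fix y assume "y \<in> {x. x extreme_point_of T}"
    then have "\<bar>q \<bullet> y + k\<bar> \<le> \<mu>" using assms(3) by blast
    then show "y \<in> ?H" by (auto simp: abs_le_iff)
  qed
  then have "convex hull {x. x extreme_point_of T} \<subseteq> ?H"
    by (intro hull_minimal convex_Int convex_halfspace_le convex_halfspace_ge)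
  then have "x \<in> ?H" using Krein_Milman_Minkowski[OF assms(1,2)] assms(4) by blast
  then show ?thesis by auto
qed

text \<open>Compare the values at \<open>z + y\<close> and \<open>z - y\<close> with
  \<open>y\<close> along \<open>q\<close>; half the radius keeps both points in the open
  ball.\<close>

lemma affine_slope_bound:
  fixes q z :: R3
  assumes b: "ball z \<rho> \<subseteq> T" and \<rho>: "\<rho> > 0" and bd: "\<And>y. y \<in> T \<Longrightarrow> \<bar>q \<bullet> y + k\<bar> \<le> \<mu>"
  shows "norm q * \<rho> \<le> 2 * \<mu>"
proof (cases "q = 0")
  case True
  have "z \<in> T" using b \<rho> by (meson centre_in_ball subsetD)
  then show ?thesis using bd[of z] True by simp
next
  case False
  define y where "y = (\<rho> / (2 * norm q)) *\<^sub>R q"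
  have ny: "norm y = \<rho> / 2" using False \<rho> by (simp add: y_def)
  have "z + y \<in> T" "z - y \<in> T" using b ny \<rho> by (auto simp: dist_norm subset_iff)
  then have "q \<bullet> (z + y) + k - (q \<bullet> (z - y) + k) \<le> 2 * \<mu>" using bd[of "z + y"] bd[of "z - y"] by linarith
  moreover have "q \<bullet> (z + y) + k - (q \<bullet> (z - y) + k) = 2 * (q \<bullet> y)" by (simp add: inner_add_right inner_diff_right)
  moreover have "2 * (q \<bullet> y) = norm q * \<rho>"
    using False by (simp add: y_def dot_square_norm power2_eq_square)
  ultimately show ?thesis by simp
qed

text \<open>Instead of a ball attaining the supremum \<open>inradius\<close>, one with more than
  half of it is taken, whence the factor 2. The absolute value lets \<open>\<sigma>\<close> be any
  real.\<close>

lemma simplex3_inner_ball: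
  fixes T :: "R3 set"
  assumes T: "3 simplex T" and reg: "diameter T \<le> \<sigma> * inradius T"
  obtains z \<rho> where "\<rho> > 0" "ball z \<rho> \<subseteq> T" "diameter T \<le> 2 * \<bar>\<sigma>\<bar> * \<rho>" "diameter T > 0"
proof -
  have bT: "bounded T" using compact_simplex[OF T] compact_imp_bounded by blast
  obtain z0 where "z0 \<in> interior T" using simplex3_interior_nonempty[OF T] by blast
  then obtain r0 where r0: "r0 > 0" "ball z0 r0 \<subseteq> T" by (auto simp: mem_interior)
  let ?R = "{r. \<exists>x. ball x r \<subseteq> T}"
  have up: "r \<le> diameter T / 2" if r: "r \<in> ?R" "r > 0" for r
  proof -
    obtain x where "ball x r \<subseteq> T" using r by blast
    then have "diameter (ball x r) \<le> diameter T" using bT by (rule diameter_subset)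
    then show ?thesis using r(2) by simp
  qed
  have r0R: "r0 \<in> ?R" using r0 by blast
  have dpos: "diameter T > 0" using up[OF r0R r0(1)] r0(1) by simp
  have "bdd_above ?R"
  proof (rule bdd_aboveI)
    \<comment> \<open>Nonpositive radii belong to the set too, their balls being empty. The bound is
      what makes \<open>Sup\<close> meaningful.\<close>
    show "r \<le> diameter T / 2" if "r \<in> ?R" for r using up[OF that] dpos by (cases "r > 0") auto
  qed
  then have "r0 \<le> inradius T" unfolding inradius_def by (intro cSup_upper r0R)
  then have ipos: "inradius T > 0" using r0 by simp
  then have "inradius T / 2 < Sup ?R" unfolding inradius_def by simp
  then obtain \<rho> where \<rho>: "\<rho> \<in> ?R" "inradius T / 2 < \<rho>" using less_cSupD[of ?R] r0R by blast
  then obtain z where z: "ball z \<rho> \<subseteq> T" by blast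
  have "\<sigma> * inradius T \<le> \<bar>\<sigma>\<bar> * (2 * \<rho>)" using ipos \<rho>(2) by (intro mult_mono) auto
  then have "diameter T \<le> 2 * \<bar>\<sigma>\<bar> * \<rho>" using reg by simp
  then show ?thesis using that[of \<rho> z] z \<rho>(2) ipos dpos by simp
qed

context mesh_domain
begin

lemma mesh_size_ge: "T \<in> M \<Longrightarrow> diameter T \<le> mesh_size M"
  unfolding mesh_size_def using meshD(1) by (intro Max_ge) auto

lemma interpolant_element_error:
  assumes u: "H2 \<Omega> u" and T: "T \<in> M" and ball: "ball z \<rho> \<subseteq> T" "\<rho> > 0"
    and rem: "taylor_estimate u ut"
    and v: "v \<in> Vh \<Omega> M" and ab: "\<And>T x. T \<in> M \<Longrightarrow> x \<in> T \<Longrightarrow> v x = a T \<bullet> x + b T"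
    and node: "\<And>T x. T \<in> M \<Longrightarrow> x extreme_point_of T \<Longrightarrow> a T \<bullet> x + b T = ut x"
  defines "H \<equiv> (\<Sum>i\<in>UNIV. \<Sum>j\<in>UNIV. \<integral>x. (wd2 \<Omega> u i j x)\<^sup>2 \<partial>lebesgue_on (interior T))"
  shows "(\<integral>x. (v x - u x)\<^sup>2 \<partial>lebesgue_on (interior T)) \<le> 16 * diameter T ^ 4 * H"
    "(\<integral>x. (\<Sum>i\<in>UNIV. (pw_const (\<lambda>T. a T $ i) x - wd1 \<Omega> u i x)\<^sup>2) \<partial>lebesgue_on (interior T)) \<le> (4 / \<rho>\<^sup>2) * (16 * diameter T ^ 4 * H)"
proof -
  define S where "S = interior T"
  define V where "V = {y. y extreme_point_of T}"
  define R where "R y = taylor_rem y (ut y) u (wd1 \<Omega> u)" for y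
  \<comment> \<open>\<open>sqrt (m x)\<close> bounds all four vertex remainders at \<open>x\<close>,
    and the integral of \<open>m\<close> is a sum of four Taylor estimates.\<close>
  define m where "m x = (\<Sum>y\<in>V. (R y x)\<^sup>2)" for x
  have V: "finite V" "card V = 4" using simplex3_extreme_points[OF meshD(3)[OF T]] by (auto simp: V_def)
  have VT: "y \<in> T" if "y \<in> V" for y using that by (auto simp: V_def extreme_point_of_def)
  have S: "open S" "convex S" "S \<subseteq> \<Omega>" "S \<subseteq> T" "closure S = T"
    using element[OF T] interior_subset[of T] by (auto simp: S_def convex_interior)
  have mS: "S \<in> lmeasurable" using lmeasurable_open[OF bounded_subset[OF bounded_dom S(3)] S(1)] .
  have sS: "S \<in> sets lebesgue" using S(1) by simp
  have uL: "L2 \<Omega> u" and H1u: "H1 \<Omega> u" using u by (auto simp: H2_def H1_def)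
  note sub = L2_subset[OF _ S(3) sS sets_dom]
  have L: "L2 S u" "L2 S (wd1 \<Omega> u i)" for i using sub[OF uL] sub[OF H1_wd1(1)[OF H1u]] by auto
  have dd: "norm (x - y) \<le> diameter T" if "x \<in> S" "y \<in> V" for x y
    using diameter_bounded_bound[OF compact_imp_bounded[OF element(1)[OF T]], of x y] that S(4) VT
    by (auto simp: dist_norm)
  have RL: "L2 S (R y)" if "y \<in> V" for y
    unfolding R_def by (rule L2_taylor_rem[OF mS L]) (rule dd[OF _ that])
  have RI: "(\<integral>x. (R y x)\<^sup>2 \<partial>lebesgue_on S) \<le> 4 * diameter T ^ 4 * H" if "y \<in> V" for y
  proof -
    have "open S \<and> convex S \<and> S \<subseteq> \<Omega> \<and> y \<in> closure S \<and> (\<forall>x\<in>S. norm (x - y) \<le> diameter T)"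
      using S VT[OF that] dd[OF _ that] by simp
    then show ?thesis using rem unfolding taylor_estimate_def R_def H_def S_def[symmetric] by blast
  qed
  have mi: "integrable (lebesgue_on S) m"
    unfolding m_def[abs_def] by (intro Bochner_Integration.integrable_sum L2_sq_integrable RL)
  have "(\<integral>x. m x \<partial>lebesgue_on S) = (\<Sum>y\<in>V. \<integral>x. (R y x)\<^sup>2 \<partial>lebesgue_on S)"
    unfolding m_def by (intro Bochner_Integration.integral_sum L2_sq_integrable RL)
  also have "\<dots> \<le> (\<Sum>y\<in>V. 4 * diameter T ^ 4 * H)" by (intro sum_mono RI)
  also have "\<dots> = 16 * diameter T ^ 4 * H" by (simp add: V(2))
  finally have mI: "(\<integral>x. m x \<partial>lebesgue_on S) \<le> 16 * diameter T ^ 4 * H" .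
  have m0: "m x \<ge> 0" for x by (simp add: m_def sum_nonneg)
  have key: "(v x - u x)\<^sup>2 \<le> m x \<and> (\<Sum>i\<in>UNIV. (pw_const (\<lambda>T. a T $ i) x - wd1 \<Omega> u i x)\<^sup>2) \<le> (4 / \<rho>\<^sup>2) * m x"
    if x: "x \<in> S" for x
  proof -
    define D :: R3 where "D = (\<chi> i. wd1 \<Omega> u i x)"
    define q where "q = a T - D"
    define k where "k = b T - u x + x \<bullet> D"
    have ext: "\<bar>q \<bullet> y + k\<bar> \<le> sqrt (m x)" if y: "y extreme_point_of T" for y
    proof -
      have "R y x = ut y - u x - (y - x) \<bullet> D"
        by (simp add: R_def taylor_rem_def D_def inner_vec_def)
      also have "\<dots> = q \<bullet> y + k"
        unfolding node[OF T y, symmetric] by (simp add: q_def k_def inner_diff_left inner_diff_right inner_commute[of _ D])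
      finally have "(q \<bullet> y + k)\<^sup>2 \<le> m x"
        unfolding m_def using member_le_sum[of y V "\<lambda>y. (R y x)\<^sup>2"] V(1) y by (simp add: V_def)
      then have "sqrt ((q \<bullet> y + k)\<^sup>2) \<le> sqrt (m x)" by (rule real_sqrt_le_mono)
      then show ?thesis by simp
    qed
    have all: "\<bar>q \<bullet> y + k\<bar> \<le> sqrt (m x)" if "y \<in> T" for y
      by (rule affine_abs_bound[OF element(1,2)[OF T] ext that])
    have "q \<bullet> x + k = v x - u x"
      using ab[OF T, of x] x S(4) by (simp add: q_def k_def inner_diff_left inner_diff_right inner_commute[of _ D] subset_iff)
    then have "\<bar>v x - u x\<bar> \<le> sqrt (m x)" using all[of x] x S(4) by auto
    then have 1: "(v x - u x)\<^sup>2 \<le> m x" using m0[of x] power_mono[of "\<bar>v x - u x\<bar>" "sqrt (m x)" 2] by simp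
    have "norm q * \<rho> \<le> 2 * sqrt (m x)" by (rule affine_slope_bound[OF ball all])
    then have "(norm q * \<rho>)\<^sup>2 \<le> (2 * sqrt (m x))\<^sup>2" using ball(2) by (intro power_mono) auto
    then have "(norm q)\<^sup>2 * \<rho>\<^sup>2 \<le> 4 * m x" using m0[of x] by (simp add: power_mult_distrib)
    then have 2: "(norm q)\<^sup>2 \<le> (4 / \<rho>\<^sup>2) * m x" using ball(2) by (simp add: field_simps)
    have "(norm q)\<^sup>2 = (\<Sum>i\<in>UNIV. (pw_const (\<lambda>T. a T $ i) x - wd1 \<Omega> u i x)\<^sup>2)"
    proof -
      have "pw_const (\<lambda>T. a T $ i) x = a T $ i" for i using pw_const_eq[OF T] x by (simp add: S_def)
      then show ?thesis
        unfolding power2_norm_eq_inner inner_vec_def by (simp add: q_def D_def power2_eq_square)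
    qed
    then show ?thesis using 1 2 by simp
  qed
  have pwL: "L2 S (\<lambda>x. pw_const (\<lambda>T. a T $ i) x - wd1 \<Omega> u i x)" for i
    by (rule L2_diff[OF sub[OF L2_pw_const] L(2)])
  have "(\<integral>x. (v x - u x)\<^sup>2 \<partial>lebesgue_on S) \<le> (\<integral>x. m x \<partial>lebesgue_on S)"
    using key by (intro integral_mono mi L2_sq_integrable L2_diff sub[OF Vh_L2[OF v]] L) auto
  then show "(\<integral>x. (v x - u x)\<^sup>2 \<partial>lebesgue_on (interior T)) \<le> 16 * diameter T ^ 4 * H"
    using mI by (simp add: S_def)
  have "(\<integral>x. (\<Sum>i\<in>UNIV. (pw_const (\<lambda>T. a T $ i) x - wd1 \<Omega> u i x)\<^sup>2) \<partial>lebesgue_on S) \<le> (\<integral>x. (4 / \<rho>\<^sup>2) * m x \<partial>lebesgue_on S)"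
  proof (rule integral_mono)
    show "integrable (lebesgue_on S) (\<lambda>x. \<Sum>i\<in>UNIV. (pw_const (\<lambda>T. a T $ i) x - wd1 \<Omega> u i x)\<^sup>2)"
      by (intro Bochner_Integration.integrable_sum L2_sq_integrable pwL)
    show "integrable (lebesgue_on S) (\<lambda>x. (4 / \<rho>\<^sup>2) * m x)" by (rule integrable_mult_right[OF mi])
    show "(\<Sum>i\<in>UNIV. (pw_const (\<lambda>T. a T $ i) x - wd1 \<Omega> u i x)\<^sup>2) \<le> (4 / \<rho>\<^sup>2) * m x" if "x \<in> space (lebesgue_on S)" for x
      using key that by simp
  qed
  also have "\<dots> = (4 / \<rho>\<^sup>2) * (\<integral>x. m x \<partial>lebesgue_on S)" by simp
  also have "\<dots> \<le> (4 / \<rho>\<^sup>2) * (16 * diameter T ^ 4 * H)" by (intro mult_left_mono mI) simp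
  finally show "(\<integral>x. (\<Sum>i\<in>UNIV. (pw_const (\<lambda>T. a T $ i) x - wd1 \<Omega> u i x)\<^sup>2) \<partial>lebesgue_on (interior T)) \<le> (4 / \<rho>\<^sup>2) * (16 * diameter T ^ 4 * H)"
    by (simp only: S_def)
qed

lemma interpolation_error:
  assumes u: "H10 \<Omega> u" "H2 \<Omega> u" and reg: "shape_regular \<sigma> M"
  defines "H \<equiv> (\<Sum>i\<in>UNIV. \<Sum>j\<in>UNIV. \<integral>x. (wd2 \<Omega> u i j x)\<^sup>2 \<partial>lebesgue_on \<Omega>)"
  obtains v a b where "v \<in> Vh \<Omega> M" "\<forall>T\<in>M. \<forall>x\<in>T. v x = a T \<bullet> x + b T"
    "(\<integral>x. (v x - u x)\<^sup>2 \<partial>lebesgue_on \<Omega>) \<le> 16 * mesh_size M ^ 4 * H"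
    "(\<integral>x. (\<Sum>i\<in>UNIV. (pw_const (\<lambda>T. a T $ i) x - wd1 \<Omega> u i x)\<^sup>2) \<partial>lebesgue_on \<Omega>) \<le> 256 * \<sigma>\<^sup>2 * (mesh_size M)\<^sup>2 * H"
proof -
  obtain ut where ut: "continuous_on (closure \<Omega>) ut" "AE x in lebesgue_on \<Omega>. ut x = u x"
    and rem: "taylor_estimate u ut"
    using H2_continuous_representative[OF u(2)] by blast
  obtain v a b where v: "v \<in> Vh \<Omega> M" and ab': "\<forall>T\<in>M. \<forall>x\<in>T. v x = a T \<bullet> x + b T"
    and node': "\<forall>T\<in>M. \<forall>x. x extreme_point_of T \<longrightarrow> a T \<bullet> x + b T = ut x"
    by (rule nodal_interpolant[OF H10_boundary_zero[OF u(1) ut]])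
  have ab: "v x = a T \<bullet> x + b T" if "T \<in> M" "x \<in> T" for T x using ab' that by blast
  have node: "a T \<bullet> x + b T = ut x" if "T \<in> M" "x extreme_point_of T" for T x using node' that by blast
  define HT where "HT T = (\<Sum>i\<in>UNIV. \<Sum>j\<in>UNIV. \<integral>x. (wd2 \<Omega> u i j x)\<^sup>2 \<partial>lebesgue_on (interior T))" for T
  have HT0: "HT T \<ge> 0" for T unfolding HT_def by (auto intro!: sum_nonneg integral_nonneg_AE)
  have Hsum: "(\<Sum>T\<in>M. HT T) = H"
  proof -
    have "H = (\<Sum>i\<in>UNIV. \<Sum>j\<in>UNIV. \<Sum>T\<in>M. \<integral>x. (wd2 \<Omega> u i j x)\<^sup>2 \<partial>lebesgue_on (interior T))"
      unfolding H_def by (intro sum.cong refl integral_dom_eq_sum L2_sq_integrable H2_wd2(1)[OF u(2)])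
    also have "\<dots> = (\<Sum>T\<in>M. HT T)" unfolding HT_def by (simp only: sum.swap[of _ M])
    finally show ?thesis by simp
  qed
  have uL: "L2 \<Omega> u" and H1u: "H1 \<Omega> u" using u(2) by (auto simp: H2_def H1_def)
  let ?h = "mesh_size M"
  have el: "(\<integral>x. (v x - u x)\<^sup>2 \<partial>lebesgue_on (interior T)) \<le> 16 * ?h ^ 4 * HT T
      \<and> (\<integral>x. (\<Sum>i\<in>UNIV. (pw_const (\<lambda>T. a T $ i) x - wd1 \<Omega> u i x)\<^sup>2) \<partial>lebesgue_on (interior T)) \<le> 256 * \<sigma>\<^sup>2 * ?h\<^sup>2 * HT T"
    if T: "T \<in> M" for T
  proof -
    have "diameter T \<le> \<sigma> * inradius T" using reg T by (simp add: shape_regular_def)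
    then obtain z \<rho> where \<rho>: "\<rho> > 0" "ball z \<rho> \<subseteq> T" "diameter T \<le> 2 * \<bar>\<sigma>\<bar> * \<rho>" "diameter T > 0"
      using simplex3_inner_ball[OF meshD(3)[OF T]] by blast
    let ?d = "diameter T"
    note e = interpolant_element_error[where a = a and b = b, OF u(2) T \<rho>(2,1) rem v ab node, folded HT_def]
    have dh: "?d \<le> ?h" by (rule mesh_size_ge[OF T])
    have "16 * ?d ^ 4 * HT T \<le> 16 * ?h ^ 4 * HT T"
      using dh \<rho>(4) HT0 by (intro mult_right_mono mult_left_mono power_mono) auto
    then have 1: "(\<integral>x. (v x - u x)\<^sup>2 \<partial>lebesgue_on (interior T)) \<le> 16 * ?h ^ 4 * HT T" using e(1) by linarith
    have "?d\<^sup>2 \<le> (2 * \<bar>\<sigma>\<bar> * \<rho>)\<^sup>2" using \<rho>(3,4) by (intro power_mono) auto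
    then have "?d\<^sup>2 / \<rho>\<^sup>2 \<le> 4 * \<sigma>\<^sup>2" using \<rho>(1) by (simp add: power_mult_distrib divide_le_eq)
    \<comment> \<open>Of \<open>?d^4\<close> one half is spent against the inscribed radius, the
      other is bounded by the mesh size; \<open>64 * 4\<close> is the 256 of the claim.\<close>
    then have "64 * ?d\<^sup>2 * (?d\<^sup>2 / \<rho>\<^sup>2) \<le> 64 * ?h\<^sup>2 * (4 * \<sigma>\<^sup>2)"
      using dh \<rho>(4) by (intro mult_mono power_mono) auto
    then have "(64 * ?d\<^sup>2 * (?d\<^sup>2 / \<rho>\<^sup>2)) * HT T \<le> (64 * ?h\<^sup>2 * (4 * \<sigma>\<^sup>2)) * HT T"
      by (rule mult_right_mono[OF _ HT0])
    moreover have "(4 / \<rho>\<^sup>2) * (16 * ?d ^ 4 * HT T) = (64 * ?d\<^sup>2 * (?d\<^sup>2 / \<rho>\<^sup>2)) * HT T"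
      by (simp add: power4_eq_xxxx power2_eq_square)
    ultimately have "(\<integral>x. (\<Sum>i\<in>UNIV. (pw_const (\<lambda>T. a T $ i) x - wd1 \<Omega> u i x)\<^sup>2) \<partial>lebesgue_on (interior T)) \<le> (64 * ?h\<^sup>2 * (4 * \<sigma>\<^sup>2)) * HT T"
      using e(2) by linarith
    then show ?thesis using 1 by (simp add: mult_ac)
  qed
  have "(\<integral>x. (v x - u x)\<^sup>2 \<partial>lebesgue_on \<Omega>) = (\<Sum>T\<in>M. \<integral>x. (v x - u x)\<^sup>2 \<partial>lebesgue_on (interior T))"
    by (intro integral_dom_eq_sum L2_sq_integrable L2_diff Vh_L2[OF v] uL)
  also have "\<dots> \<le> (\<Sum>T\<in>M. 16 * ?h ^ 4 * HT T)" by (intro sum_mono) (use el in blast)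
  also have "\<dots> = 16 * ?h ^ 4 * H" unfolding Hsum[symmetric] sum_distrib_left ..
  finally have 1: "(\<integral>x. (v x - u x)\<^sup>2 \<partial>lebesgue_on \<Omega>) \<le> 16 * ?h ^ 4 * H" .
  have "(\<integral>x. (\<Sum>i\<in>UNIV. (pw_const (\<lambda>T. a T $ i) x - wd1 \<Omega> u i x)\<^sup>2) \<partial>lebesgue_on \<Omega>)
     = (\<Sum>T\<in>M. \<integral>x. (\<Sum>i\<in>UNIV. (pw_const (\<lambda>T. a T $ i) x - wd1 \<Omega> u i x)\<^sup>2) \<partial>lebesgue_on (interior T))"
    by (intro integral_dom_eq_sum Bochner_Integration.integrable_sum L2_sq_integrable L2_diff L2_pw_const H1_wd1(1)[OF H1u])
  also have "\<dots> \<le> (\<Sum>T\<in>M. 256 * \<sigma>\<^sup>2 * ?h\<^sup>2 * HT T)" by (intro sum_mono) (use el in blast)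
  also have "\<dots> = 256 * \<sigma>\<^sup>2 * ?h\<^sup>2 * H" unfolding Hsum[symmetric] sum_distrib_left ..
  finally have 2: "(\<integral>x. (\<Sum>i\<in>UNIV. (pw_const (\<lambda>T. a T $ i) x - wd1 \<Omega> u i x)\<^sup>2) \<partial>lebesgue_on \<Omega>) \<le> 256 * \<sigma>\<^sup>2 * ?h\<^sup>2 * H" .
  show ?thesis by (rule that[OF v ab' 1 2])
qed

lemma galerkin_error:
  assumes ub: "H10 \<Omega> ub" "H2 \<Omega> ub" and reg: "shape_regular \<sigma> M" and \<rho>: "\<rho> > 0"
    and gal: "galerkin_sol \<Omega> M \<rho> ub u"
  shows "(L2_norm \<Omega> (\<lambda>x. u x - ub x))\<^sup>2 + \<rho> * grad_norm_sq \<Omega> (\<lambda>x. u x - ub x)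
     \<le> (16 * mesh_size M ^ 4 + 256 * \<sigma>\<^sup>2 * \<rho> * (mesh_size M)\<^sup>2 + 3 * \<rho>\<^sup>2) * (H2_norm \<Omega> ub)\<^sup>2"
proof -
  define H where "H = (\<Sum>i\<in>UNIV. \<Sum>j\<in>UNIV. \<integral>x. (wd2 \<Omega> ub i j x)\<^sup>2 \<partial>lebesgue_on \<Omega>)"
  obtain v a b where v: "v \<in> Vh \<Omega> M" and ab0: "\<forall>T\<in>M. \<forall>x\<in>T. v x = a T \<bullet> x + b T"
    and e0: "(\<integral>x. (v x - ub x)\<^sup>2 \<partial>lebesgue_on \<Omega>) \<le> 16 * mesh_size M ^ 4 * H"
    and e1: "(\<integral>x. (\<Sum>i\<in>UNIV. (pw_const (\<lambda>T. a T $ i) x - wd1 \<Omega> ub i x)\<^sup>2) \<partial>lebesgue_on \<Omega>) \<le> 256 * \<sigma>\<^sup>2 * (mesh_size M)\<^sup>2 * H"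
    by (rule interpolation_error[OF ub reg, folded H_def])
  have ab: "v x = a T \<bullet> x + b T" if "T \<in> M" "x \<in> T" for T x using ab0 that by blast
  have uV: "u \<in> Vh \<Omega> M" using gal by (simp add: galerkin_sol_def)
  obtain a' b' where ab': "\<And>T x. T \<in> M \<Longrightarrow> x \<in> T \<Longrightarrow> u x = a' T \<bullet> x + b' T" using Vh_coeffs[OF uV] by blast
  define w where "w x = u x - v x" for x
  have wV: "w \<in> Vh \<Omega> M" unfolding w_def[abs_def] by (rule Vh_diff[OF uV v])
  define ac where "ac T = a' T - a T" for T
  have abw: "w x = ac T \<bullet> x + (b' T - b T)" if "T \<in> M" "x \<in> T" for T x
    using ab[OF that] ab'[OF that] by (simp add: w_def ac_def inner_diff_left)
  define P where "P i = pw_const (\<lambda>T. a' T $ i)" for i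
  define Q where "Q i = pw_const (\<lambda>T. a T $ i)" for i
  define W where "W i = pw_const (\<lambda>T. ac T $ i)" for i
  define D where "D i = wd1 \<Omega> ub i" for i
  define L where "L x = (\<Sum>i\<in>UNIV. wd2 \<Omega> ub i i x)" for x
  have WPQ: "W i x = P i x - Q i x" for i x
    by (simp add: W_def P_def Q_def pw_const_def ac_def right_diff_distrib sum_subtractf)
  have H1u: "H1 \<Omega> ub" and ubL: "L2 \<Omega> ub" using ub(2) by (auto simp: H2_def H1_def)
  have uL: "L2 \<Omega> u" and vL: "L2 \<Omega> v" and wL: "L2 \<Omega> w" using Vh_L2 uV v wV by auto
  have PL: "L2 \<Omega> (P i)" and QL: "L2 \<Omega> (Q i)" and WL: "L2 \<Omega> (W i)" for i
    unfolding P_def Q_def W_def by (rule L2_pw_const)+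
  have DL: "L2 \<Omega> (D i)" for i unfolding D_def by (rule H1_wd1(1)[OF H1u])
  have L2L: "L2 \<Omega> L" unfolding L_def[abs_def] by (intro L2_sum H2_wd2(1)[OF ub(2)])
  have wdu: "weak_deriv1 \<Omega> u i (P i)" for i unfolding P_def by (rule Vh_weak_deriv1[OF uV ab'])
  have wdw: "weak_deriv1 \<Omega> w i (W i)" for i unfolding W_def by (rule Vh_weak_deriv1[OF wV abw])
  let ?I = "\<lambda>f. \<integral>x. f x \<partial>lebesgue_on \<Omega>"
  have gal1: "\<rho> * ?I (\<lambda>x. \<Sum>i\<in>UNIV. P i x * W i x) + ?I (\<lambda>x. u x * w x) = ?I (\<lambda>x. ub x * w x)"
  proof -
    \<comment> \<open>\<open>galerkin_sol\<close> is phrased with the chosen \<open>wd1\<close>;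
      almost everywhere these are the piecewise constant gradients.\<close>
    have "?I (\<lambda>x. \<Sum>i\<in>UNIV. wd1 \<Omega> u i x * wd1 \<Omega> w i x) = ?I (\<lambda>x. \<Sum>i\<in>UNIV. P i x * W i x)"
    proof (rule integral_cong_AE)
      have "AE x in lebesgue_on \<Omega>. \<forall>i\<in>UNIV. wd1 \<Omega> u i x = P i x \<and> wd1 \<Omega> w i x = W i x"
        using wd1_AE_eq(2)[OF PL wdu] wd1_AE_eq(2)[OF WL wdw] by (intro AE_finite_allI) auto
      then show "AE x in lebesgue_on \<Omega>. (\<Sum>i\<in>UNIV. wd1 \<Omega> u i x * wd1 \<Omega> w i x) = (\<Sum>i\<in>UNIV. P i x * W i x)"
        by eventually_elim simp
      show "(\<lambda>x. \<Sum>i\<in>UNIV. wd1 \<Omega> u i x * wd1 \<Omega> w i x) \<in> borel_measurable (lebesgue_on \<Omega>)"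
        using wd1_AE_eq(1)[OF PL wdu] wd1_AE_eq(1)[OF WL wdw] by (intro borel_measurable_sum borel_measurable_times) (auto simp: L2_def)
      show "(\<lambda>x. \<Sum>i\<in>UNIV. P i x * W i x) \<in> borel_measurable (lebesgue_on \<Omega>)"
        using PL WL by (intro borel_measurable_sum borel_measurable_times) (auto simp: L2_def)
    qed
    then show ?thesis using gal wV unfolding galerkin_sol_def by auto
  qed
  have green: "?I (\<lambda>x. \<Sum>i\<in>UNIV. D i x * W i x) = - ?I (\<lambda>x. L x * w x)"
  proof -
    have "?I (\<lambda>x. \<Sum>i\<in>UNIV. D i x * W i x) = (\<Sum>i\<in>UNIV. ?I (\<lambda>x. D i x * W i x))"
      by (intro Bochner_Integration.integral_sum L2_mult_integrable DL WL)
    also have "\<dots> = (\<Sum>i\<in>UNIV. - ?I (\<lambda>x. wd2 \<Omega> ub i i x * w x))"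
      unfolding W_def D_def
      by (intro sum.cong refl Vh_green[OF wV abw] H1_wd1(1)[OF H1u] H2_wd2(1)[OF ub(2)] H2_wd2_weak_deriv1[OF ub(2)])
    also have "\<dots> = - ?I (\<lambda>x. \<Sum>i\<in>UNIV. wd2 \<Omega> ub i i x * w x)"
      unfolding sum_negf
      by (subst Bochner_Integration.integral_sum) (auto intro: L2_mult_integrable H2_wd2(1)[OF ub(2)] wL)
    finally show ?thesis by (simp add: L_def sum_distrib_right)
  qed
  define E where "E i x = P i x - D i x" for i x
  define N where "N i x = D i x - Q i x" for i x
  define e where "e x = u x - ub x" for x
  define \<eta> where "\<eta> x = ub x - v x" for x
  have EL: "L2 \<Omega> (E i)" and NL: "L2 \<Omega> (N i)" for i unfolding E_def[abs_def] N_def[abs_def] by (intro L2_diff PL QL DL)+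
  have eL: "L2 \<Omega> e" and \<eta>L: "L2 \<Omega> \<eta>" unfolding e_def[abs_def] \<eta>_def[abs_def] by (intro L2_diff uL ubL vL)+
  have WEN: "W i x = E i x + N i x" for i x by (simp add: WPQ E_def N_def)
  have wen: "w x = e x + \<eta> x" for x by (simp add: w_def e_def \<eta>_def)
  \<comment> \<open>Integrand of the Galerkin equation tested with \<open>w\<close>, after Green's
    formula; its integral is 0.\<close>
  define J where "J x = \<rho> * (\<Sum>i\<in>UNIV. E i x * W i x) + e x * w x - \<rho> * (L x * w x)" for x
  have iEW: "integrable (lebesgue_on \<Omega>) (\<lambda>x. \<Sum>i\<in>UNIV. E i x * W i x)"
    by (intro Bochner_Integration.integrable_sum L2_mult_integrable EL WL)
  have iJ: "integrable (lebesgue_on \<Omega>) J"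
    unfolding J_def[abs_def]
    by (intro Bochner_Integration.integrable_add Bochner_Integration.integrable_diff integrable_mult_right iEW L2_mult_integrable eL wL L2L)
  have J0: "?I J = 0"
  proof -
    have IE: "?I (\<lambda>x. \<Sum>i\<in>UNIV. E i x * W i x) = ?I (\<lambda>x. \<Sum>i\<in>UNIV. P i x * W i x) - ?I (\<lambda>x. \<Sum>i\<in>UNIV. D i x * W i x)"
    proof -
      have "?I (\<lambda>x. \<Sum>i\<in>UNIV. E i x * W i x) = ?I (\<lambda>x. (\<Sum>i\<in>UNIV. P i x * W i x) - (\<Sum>i\<in>UNIV. D i x * W i x))"
        by (simp add: E_def left_diff_distrib sum_subtractf)
      also have "\<dots> = ?I (\<lambda>x. \<Sum>i\<in>UNIV. P i x * W i x) - ?I (\<lambda>x. \<Sum>i\<in>UNIV. D i x * W i x)"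
        by (intro Bochner_Integration.integral_diff Bochner_Integration.integrable_sum L2_mult_integrable PL DL WL)
      finally show ?thesis .
    qed
    have Ie: "?I (\<lambda>x. e x * w x) = ?I (\<lambda>x. u x * w x) - ?I (\<lambda>x. ub x * w x)"
      unfolding e_def left_diff_distrib by (intro Bochner_Integration.integral_diff L2_mult_integrable uL ubL wL)
    have "?I J = \<rho> * ?I (\<lambda>x. \<Sum>i\<in>UNIV. E i x * W i x) + ?I (\<lambda>x. e x * w x) - \<rho> * ?I (\<lambda>x. L x * w x)"
      unfolding J_def using iEW L2_mult_integrable[OF eL wL] L2_mult_integrable[OF L2L wL] by simp
    also have "\<dots> = 0" unfolding IE Ie green right_diff_distrib using gal1 by simp
    finally show ?thesis .
  qed
  define X where "X x = \<rho> * (\<Sum>i\<in>UNIV. (E i x)\<^sup>2) + (e x)\<^sup>2" for x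
  define Y where "Y x = \<rho>\<^sup>2 * (L x)\<^sup>2 + (\<eta> x)\<^sup>2 + \<rho> * (\<Sum>i\<in>UNIV. (N i x)\<^sup>2)" for x
  have pt: "X x \<le> Y x + 2 * J x" for x
  proof -
    have "(\<Sum>i\<in>UNIV. (W i x)\<^sup>2) = (\<Sum>i\<in>UNIV. 2 * (E i x * W i x) + (N i x)\<^sup>2 - (E i x)\<^sup>2)"
      by (intro sum.cong refl) (simp add: WEN power2_eq_square algebra_simps)
    also have "\<dots> = 2 * (\<Sum>i\<in>UNIV. E i x * W i x) + (\<Sum>i\<in>UNIV. (N i x)\<^sup>2) - (\<Sum>i\<in>UNIV. (E i x)\<^sup>2)"
      by (simp add: sum.distrib sum_subtractf sum_distrib_left)
    finally have s: "(\<Sum>i\<in>UNIV. (W i x)\<^sup>2) = 2 * (\<Sum>i\<in>UNIV. E i x * W i x) + (\<Sum>i\<in>UNIV. (N i x)\<^sup>2) - (\<Sum>i\<in>UNIV. (E i x)\<^sup>2)" .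
    \<comment> \<open>Completing the square is a pointwise identity, from \<open>W = E + N\<close>
      and \<open>w = e + \<eta>\<close>; integration afterwards removes \<open>J\<close>.\<close>
    have "Y x + 2 * J x - X x = \<rho> * (\<Sum>i\<in>UNIV. (W i x)\<^sup>2) + (w x - \<rho> * L x)\<^sup>2"
      unfolding s X_def Y_def J_def wen by (simp add: power2_eq_square algebra_simps)
    moreover have "\<dots> \<ge> 0" using \<rho> by (simp add: sum_nonneg)
    ultimately show ?thesis by linarith
  qed
  have sqi: "integrable (lebesgue_on \<Omega>) (\<lambda>x. \<Sum>i\<in>UNIV. (E i x)\<^sup>2)" "integrable (lebesgue_on \<Omega>) (\<lambda>x. \<Sum>i\<in>UNIV. (N i x)\<^sup>2)"
    by (intro Bochner_Integration.integrable_sum L2_sq_integrable EL NL)+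
  have iX: "integrable (lebesgue_on \<Omega>) X" and iY: "integrable (lebesgue_on \<Omega>) Y"
    unfolding X_def[abs_def] Y_def[abs_def]
    by (intro Bochner_Integration.integrable_add integrable_mult_right sqi L2_sq_integrable eL \<eta>L L2L)+
  have "?I X \<le> ?I (\<lambda>x. Y x + 2 * J x)" using pt iX iY iJ by (intro integral_mono) auto
  also have "\<dots> = ?I Y" using iY iJ J0 by simp
  finally have XY: "?I X \<le> ?I Y" .
  have IX: "?I X = (L2_norm \<Omega> e)\<^sup>2 + \<rho> * grad_norm_sq \<Omega> e"
  proof -
    have "weak_deriv1 \<Omega> e i (E i)" for i
      unfolding e_def[abs_def] E_def[abs_def]
      using weak_deriv1_diff[OF uL ubL PL DL lmeasurable_dom wdu] H1_wd1(2)[OF H1u] by (simp add: D_def)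
    then have "grad_norm_sq \<Omega> e = (\<Sum>i\<in>UNIV. ?I (\<lambda>x. (E i x)\<^sup>2))"
      unfolding grad_norm_sq_def by (intro sum.cong refl L2_norm_wd1 EL)
    also have "\<dots> = ?I (\<lambda>x. \<Sum>i\<in>UNIV. (E i x)\<^sup>2)"
      by (intro Bochner_Integration.integral_sum[symmetric] L2_sq_integrable EL)
    finally have g: "grad_norm_sq \<Omega> e = ?I (\<lambda>x. \<Sum>i\<in>UNIV. (E i x)\<^sup>2)" .
    show ?thesis unfolding X_def L2_norm_power2 g using sqi L2_sq_integrable[OF eL] by simp
  qed
  have IY: "?I Y \<le> (16 * mesh_size M ^ 4 + 256 * \<sigma>\<^sup>2 * \<rho> * (mesh_size M)\<^sup>2 + 3 * \<rho>\<^sup>2) * H"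
  proof -
    have "?I Y = \<rho>\<^sup>2 * ?I (\<lambda>x. (L x)\<^sup>2) + ?I (\<lambda>x. (\<eta> x)\<^sup>2) + \<rho> * ?I (\<lambda>x. \<Sum>i\<in>UNIV. (N i x)\<^sup>2)"
      unfolding Y_def using sqi L2_sq_integrable[OF L2L] L2_sq_integrable[OF \<eta>L] by simp
    moreover have "?I (\<lambda>x. (\<eta> x)\<^sup>2) \<le> 16 * mesh_size M ^ 4 * H"
      using e0 unfolding \<eta>_def by (simp only: power2_commute[of "ub _"])
    moreover have "\<rho> * ?I (\<lambda>x. \<Sum>i\<in>UNIV. (N i x)\<^sup>2) \<le> \<rho> * (256 * \<sigma>\<^sup>2 * (mesh_size M)\<^sup>2 * H)"
      using e1 \<rho> unfolding N_def Q_def D_def by (intro mult_left_mono) (simp_all only: power2_commute[of "wd1 _ _ _ _"] less_imp_le)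
    moreover have "\<rho>\<^sup>2 * ?I (\<lambda>x. (L x)\<^sup>2) \<le> \<rho>\<^sup>2 * (3 * H)"
    proof (rule mult_left_mono)
      \<comment> \<open>The Laplacian has three summands, hence the factor 3; the diagonal entries
        are part of the Hessian sum \<open>H\<close>.\<close>
      have "?I (\<lambda>x. (L x)\<^sup>2) \<le> ?I (\<lambda>x. 3 * (\<Sum>i\<in>UNIV. (wd2 \<Omega> ub i i x)\<^sup>2))"
      proof (rule integral_mono)
        show "integrable (lebesgue_on \<Omega>) (\<lambda>x. 3 * (\<Sum>i\<in>UNIV. (wd2 \<Omega> ub i i x)\<^sup>2))"
          by (intro integrable_mult_right Bochner_Integration.integrable_sum L2_sq_integrable H2_wd2(1)[OF ub(2)])
        show "(L x)\<^sup>2 \<le> 3 * (\<Sum>i\<in>UNIV. (wd2 \<Omega> ub i i x)\<^sup>2)" for x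
          using Cauchy_Schwarz_ineq_sum[of "\<lambda>_. 1" "\<lambda>i. wd2 \<Omega> ub i i x" "UNIV :: 3 set"] by (simp add: L_def)
      qed (rule L2_sq_integrable[OF L2L])
      also have "\<dots> = 3 * (\<Sum>i\<in>UNIV. ?I (\<lambda>x. (wd2 \<Omega> ub i i x)\<^sup>2))"
        using L2_sq_integrable[OF H2_wd2(1)[OF ub(2)]] by simp
      also have "\<dots> \<le> 3 * H"
        unfolding H_def
        by (intro mult_left_mono sum_mono member_le_sum[where f = "\<lambda>j. ?I (\<lambda>x. (wd2 \<Omega> ub _ j x)\<^sup>2)"]) (auto intro!: integral_nonneg_AE)
      finally show "?I (\<lambda>x. (L x)\<^sup>2) \<le> 3 * H" .
    qed simp
    ultimately show ?thesis by (simp add: algebra_simps)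
  qed
  have "H \<le> (H2_norm \<Omega> ub)\<^sup>2"
  proof -
    have "0 \<le> grad_norm_sq \<Omega> ub" by (simp add: grad_norm_sq_def sum_nonneg)
    then have "(H2_norm \<Omega> ub)\<^sup>2 = (L2_norm \<Omega> ub)\<^sup>2 + grad_norm_sq \<Omega> ub + (\<Sum>i\<in>UNIV. \<Sum>j\<in>UNIV. (L2_norm \<Omega> (wd2 \<Omega> ub i j))\<^sup>2)"
      unfolding H2_norm_def by (intro real_sqrt_pow2 add_nonneg_nonneg sum_nonneg) auto
    then show ?thesis using \<open>0 \<le> grad_norm_sq \<Omega> ub\<close> by (simp add: H_def L2_norm_power2[of _ "wd2 _ _ _ _"])
  qed
  then have "(16 * mesh_size M ^ 4 + 256 * \<sigma>\<^sup>2 * \<rho> * (mesh_size M)\<^sup>2 + 3 * \<rho>\<^sup>2) * H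
     \<le> (16 * mesh_size M ^ 4 + 256 * \<sigma>\<^sup>2 * \<rho> * (mesh_size M)\<^sup>2 + 3 * \<rho>\<^sup>2) * (H2_norm \<Omega> ub)\<^sup>2"
    using \<rho> by (intro mult_left_mono) (auto intro!: add_nonneg_nonneg mult_nonneg_nonneg simp: zero_le_even_power)
  then show ?thesis using XY IX IY unfolding e_def[abs_def] by linarith
qed

text \<open>Makes the choice \<open>\<rho> = h^2\<close> a positive regularization
  parameter.\<close>

lemma mesh_size_pos: "mesh_size M > 0"
proof -
  obtain T where T: "T \<in> M" using meshD(2) by blast
  obtain z \<delta> where "\<delta> > 0" "ball z \<delta> \<subseteq> T" using element(5)[OF T] by (auto simp: mem_interior)
  then have "0 < diameter (ball z \<delta>)" "diameter (ball z \<delta>) \<le> diameter T"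
    using diameter_subset[OF _ compact_imp_bounded[OF element(1)[OF T]], of "ball z \<delta>"] by auto
  then show ?thesis using mesh_size_ge[OF T] by linarith
qed

end

text \<open>One energy inequality gives both bounds: drop the gradient term, or drop the L2 term and
  divide by \<open>\<rho>\<close>. So the same 3 serves as \<open>C2\<close> and \<open>C3\<close>,
  and the witnesses depend on \<open>\<sigma>\<close> alone.\<close>

theorem theorem1:
  fixes \<Omega> :: "R3 set" and \<sigma> :: real
  assumes "open \<Omega>" "bounded \<Omega>" "convex \<Omega>" "\<Omega> \<noteq> {}"
  shows "(\<exists>C0 C1 C2 C3. C0 > 0 \<and> C1 > 0 \<and> C2 > 0 \<and> C3 > 0 \<and>
           (\<forall>M \<rho> ubar u. admissible_mesh \<Omega> M \<and> shape_regular \<sigma> M \<and> \<rho> > 0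
              \<and> H10 \<Omega> ubar \<and> H2 \<Omega> ubar \<and> galerkin_sol \<Omega> M \<rho> ubar u \<longrightarrow>
              (let h = mesh_size M; w = (\<lambda>x. u x - ubar x) in
                 (L2_norm \<Omega> w)\<^sup>2 \<le> (C0 * h^4 + C1 * \<rho> * h\<^sup>2 + C2 * \<rho>\<^sup>2) * (H2_norm \<Omega> ubar)\<^sup>2
               \<and> grad_norm_sq \<Omega> w \<le> (C0 * h^4 / \<rho> + C1 * h\<^sup>2 + C3 * \<rho>) * (H2_norm \<Omega> ubar)\<^sup>2)))
       \<and> (\<exists>c ct. c > 0 \<and> ct > 0 \<and>
           (\<forall>M ubar u. admissible_mesh \<Omega> M \<and> shape_regular \<sigma> M
              \<and> H10 \<Omega> ubar \<and> H2 \<Omega> ubar \<and> galerkin_sol \<Omega> M ((mesh_size M)\<^sup>2) ubar u \<longrightarrow>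
              (let h = mesh_size M; w = (\<lambda>x. u x - ubar x) in
                 L2_norm \<Omega> w \<le> c * h\<^sup>2 * H2_norm \<Omega> ubar
               \<and> sqrt (grad_norm_sq \<Omega> w) \<le> ct * h * H2_norm \<Omega> ubar)))"
proof -
  obtain x0 where "x0 \<in> \<Omega>" using assms(4) by blast
  then obtain r where r: "r > 0" "ball x0 r \<subseteq> \<Omega>" using assms(1) open_contains_ball by blast
  have dom: "convex_domain \<Omega> x0 r" using assms r by unfold_locales
  \<comment> \<open>The \<open>+ 1\<close> keeps the constant positive for
    \<open>\<sigma> = 0\<close>.\<close>
  define C1 where "C1 = 256 * \<sigma>\<^sup>2 + 1"
  have C1: "C1 > 0" by (simp add: C1_def add_nonneg_pos)
  have main: "(L2_norm \<Omega> (\<lambda>x. u x - ubar x))\<^sup>2 \<le> (16 * mesh_size M ^ 4 + C1 * \<rho> * (mesh_size M)\<^sup>2 + 3 * \<rho>\<^sup>2) * (H2_norm \<Omega> ubar)\<^sup>2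
      \<and> grad_norm_sq \<Omega> (\<lambda>x. u x - ubar x) \<le> (16 * mesh_size M ^ 4 / \<rho> + C1 * (mesh_size M)\<^sup>2 + 3 * \<rho>) * (H2_norm \<Omega> ubar)\<^sup>2
      \<and> mesh_size M > 0"
    if h: "admissible_mesh \<Omega> M" "shape_regular \<sigma> M" "\<rho> > 0" "H10 \<Omega> ubar" "H2 \<Omega> ubar" "galerkin_sol \<Omega> M \<rho> ubar u"
    for M \<rho> ubar u
  proof -
    interpret mesh_domain \<Omega> x0 r M
      using dom h(1) by (simp add: mesh_domain_def mesh_domain_axioms_def)
    let ?h = "mesh_size M" and ?A = "L2_norm \<Omega> (\<lambda>x. u x - ubar x)" and ?B = "grad_norm_sq \<Omega> (\<lambda>x. u x - ubar x)" and ?U = "(H2_norm \<Omega> ubar)\<^sup>2"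
    have B0: "?B \<ge> 0" by (simp add: grad_norm_sq_def sum_nonneg)
    have "?A\<^sup>2 + \<rho> * ?B \<le> (16 * ?h ^ 4 + 256 * \<sigma>\<^sup>2 * \<rho> * ?h\<^sup>2 + 3 * \<rho>\<^sup>2) * ?U"
      by (rule galerkin_error[OF h(4,5,2,3,6)])
    also have "\<dots> \<le> (16 * ?h ^ 4 + C1 * \<rho> * ?h\<^sup>2 + 3 * \<rho>\<^sup>2) * ?U"
      using h(3) by (intro mult_right_mono add_mono) (auto simp: C1_def)
    finally have le: "?A\<^sup>2 + \<rho> * ?B \<le> (16 * ?h ^ 4 + C1 * \<rho> * ?h\<^sup>2 + 3 * \<rho>\<^sup>2) * ?U" .
    have "0 \<le> \<rho> * ?B" using B0 h(3) by simp
    then have 1: "?A\<^sup>2 \<le> (16 * ?h ^ 4 + C1 * \<rho> * ?h\<^sup>2 + 3 * \<rho>\<^sup>2) * ?U" using le by linarith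
    have eq: "16 * ?h ^ 4 + C1 * \<rho> * ?h\<^sup>2 + 3 * \<rho>\<^sup>2 = \<rho> * (16 * ?h ^ 4 / \<rho> + C1 * ?h\<^sup>2 + 3 * \<rho>)"
      using h(3) by (simp add: field_simps power2_eq_square)
    have "0 \<le> ?A\<^sup>2" by simp
    then have "\<rho> * ?B \<le> (16 * ?h ^ 4 + C1 * \<rho> * ?h\<^sup>2 + 3 * \<rho>\<^sup>2) * ?U" using le by linarith
    then have "\<rho> * ?B \<le> \<rho> * ((16 * ?h ^ 4 / \<rho> + C1 * ?h\<^sup>2 + 3 * \<rho>) * ?U)" unfolding eq by (simp only: mult.assoc)
    then have "?B \<le> (16 * ?h ^ 4 / \<rho> + C1 * ?h\<^sup>2 + 3 * \<rho>) * ?U" using h(3) by (simp only: mult_le_cancel_left_pos)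
    then show ?thesis using 1 mesh_size_pos by blast
  qed
  \<comment> \<open>For \<open>\<rho> = h^2\<close> all three terms have the same order in
    \<open>h\<close>, and 19 is \<open>16 + 3\<close>; one constant serves both norms.\<close>
  define c where "c = sqrt (19 + C1)"
  have c: "c > 0" "c\<^sup>2 = 19 + C1" using C1 by (auto simp: c_def)
  have sq: "L2_norm \<Omega> (\<lambda>x. u x - ubar x) \<le> c * (mesh_size M)\<^sup>2 * H2_norm \<Omega> ubar
      \<and> sqrt (grad_norm_sq \<Omega> (\<lambda>x. u x - ubar x)) \<le> c * mesh_size M * H2_norm \<Omega> ubar"
    if h: "admissible_mesh \<Omega> M" "shape_regular \<sigma> M" "H10 \<Omega> ubar" "H2 \<Omega> ubar" "galerkin_sol \<Omega> M ((mesh_size M)\<^sup>2) ubar u"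
    for M ubar u
  proof -
    interpret mesh_domain \<Omega> x0 r M
      using dom h(1) by (simp add: mesh_domain_def mesh_domain_axioms_def)
    let ?h = "mesh_size M" and ?U = "H2_norm \<Omega> ubar"
    have hp: "?h > 0" by (rule mesh_size_pos)
    have U0: "?U \<ge> 0" unfolding H2_norm_def grad_norm_sq_def by (intro real_sqrt_ge_zero add_nonneg_nonneg sum_nonneg) auto
    have "?h\<^sup>2 > 0" using hp by simp
    note m = main[OF h(1,2) this h(3,4,5)]
    have e1: "(16 * ?h ^ 4 + C1 * ?h\<^sup>2 * ?h\<^sup>2 + 3 * (?h\<^sup>2)\<^sup>2) * ?U\<^sup>2 = (c * ?h\<^sup>2 * ?U)\<^sup>2"
    proof -
      have "?h\<^sup>2 * ?h\<^sup>2 = ?h ^ 4" "(?h\<^sup>2)\<^sup>2 = ?h ^ 4" by (simp_all add: power4_eq_xxxx power2_eq_square)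
      then show ?thesis by (simp add: power_mult_distrib c(2) mult.assoc) (simp add: algebra_simps)
    qed
    have e2: "(16 * ?h ^ 4 / ?h\<^sup>2 + C1 * ?h\<^sup>2 + 3 * ?h\<^sup>2) * ?U\<^sup>2 = (c * ?h * ?U)\<^sup>2"
    proof -
      have "?h ^ 4 / ?h\<^sup>2 = ?h\<^sup>2" using hp by (simp add: power4_eq_xxxx power2_eq_square)
      then have "16 * ?h ^ 4 / ?h\<^sup>2 = 16 * ?h\<^sup>2" by simp
      then show ?thesis by (simp add: power_mult_distrib c(2) algebra_simps)
    qed
    have nn: "0 \<le> c * ?h\<^sup>2 * ?U" "0 \<le> c * ?h * ?U" using c(1) U0 hp by simp_all
    have "(L2_norm \<Omega> (\<lambda>x. u x - ubar x))\<^sup>2 \<le> (c * ?h\<^sup>2 * ?U)\<^sup>2"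
      using m unfolding e1 by (rule conjunct1)
    then have 1: "L2_norm \<Omega> (\<lambda>x. u x - ubar x) \<le> c * ?h\<^sup>2 * ?U" using nn(1) by (rule power2_le_imp_le)
    have "grad_norm_sq \<Omega> (\<lambda>x. u x - ubar x) \<le> (c * ?h * ?U)\<^sup>2"
      using m unfolding e2 by (elim conjE)
    then have "sqrt (grad_norm_sq \<Omega> (\<lambda>x. u x - ubar x)) \<le> sqrt ((c * ?h * ?U)\<^sup>2)" by (rule real_sqrt_le_mono)
    then have "sqrt (grad_norm_sq \<Omega> (\<lambda>x. u x - ubar x)) \<le> c * ?h * ?U" unfolding real_sqrt_abs abs_of_nonneg[OF nn(2)] .
    with 1 show ?thesis by (rule conjI)
  qed
  show ?thesis
    unfolding Let_def
  proof (intro conjI)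
    show "\<exists>C0 C1 C2 C3. C0 > 0 \<and> C1 > 0 \<and> C2 > 0 \<and> C3 > 0 \<and>
           (\<forall>M \<rho> ubar u. admissible_mesh \<Omega> M \<and> shape_regular \<sigma> M \<and> \<rho> > 0
              \<and> H10 \<Omega> ubar \<and> H2 \<Omega> ubar \<and> galerkin_sol \<Omega> M \<rho> ubar u \<longrightarrow>
                 (L2_norm \<Omega> (\<lambda>x. u x - ubar x))\<^sup>2 \<le> (C0 * mesh_size M^4 + C1 * \<rho> * (mesh_size M)\<^sup>2 + C2 * \<rho>\<^sup>2) * (H2_norm \<Omega> ubar)\<^sup>2
               \<and> grad_norm_sq \<Omega> (\<lambda>x. u x - ubar x) \<le> (C0 * mesh_size M^4 / \<rho> + C1 * (mesh_size M)\<^sup>2 + C3 * \<rho>) * (H2_norm \<Omega> ubar)\<^sup>2)"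
      by (rule exI[of _ 16], rule exI[of _ C1], rule exI[of _ 3], rule exI[of _ 3]) (use C1 main in simp)
    show "\<exists>c ct. c > 0 \<and> ct > 0 \<and>
           (\<forall>M ubar u. admissible_mesh \<Omega> M \<and> shape_regular \<sigma> M
              \<and> H10 \<Omega> ubar \<and> H2 \<Omega> ubar \<and> galerkin_sol \<Omega> M ((mesh_size M)\<^sup>2) ubar u \<longrightarrow>
                 L2_norm \<Omega> (\<lambda>x. u x - ubar x) \<le> c * (mesh_size M)\<^sup>2 * H2_norm \<Omega> ubar
               \<and> sqrt (grad_norm_sq \<Omega> (\<lambda>x. u x - ubar x)) \<le> ct * mesh_size M * H2_norm \<Omega> ubar)"
      by (rule exI[of _ c], rule exI[of _ c]) (use c(1) sq in simp)
  qed
qed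

end
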